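(* Assume $\sigma^2=o(np)$ and $\frac{np}{\log n}\rightarrow\infty$. Then there exists some $\delta=o(1)$ such that the iterates $z^{(t)}$ of the generalized power method satisfy $$\ell(z^{(t)},z^* ) \leq (1+\delta)\frac{\sigma^2}{2p}\quad\text{for all integers } t\ge 1 \text{ with } t\geq \log\left(\frac{1}{\sigma^2}\right),$$ with probability at least $1-n^{-1}-\exp\left(-\left(\frac{np}{\sigma^2}\right)^{1/4}\right)$. In particular, $\delta$ can be chosen to satisfy $\delta=O\left(\left(\frac{\log n+\sigma^2}{np}\right)^{1/4}\right)$.
   Context: Asymptotic conventions: $n\to\infty$; $p=p_n\in(0,1]$ and $\sigma=\sigma_n>0$ may depend on $n$; $o(\cdot)$, $O(\cdot)$ are as $n\to\infty$. $\delta=\delta_n$ depends only on the sequences $(p_n),(\sigma_n)$, not on $z^*$; nonasymptotic inequalities are understood for all sufficiently large $n$ and every $z^*$. Model: $\mathbb{C}_1=\{x\in\mathbb{C}:|x|=1\}$, $z^*\in\mathbb{C}_1^n$. For $1\le j<k\le n$, $A_{jk}\sim\text{Bernoulli}(p)$ independently, and $Y_{jk}=z_j^*\bar z_k^*+\sigma W_{jk}$, where the $W_{jk}$ are i.i.d. standard complex Gaussian $\mathcal{CN}(0,1)$ (real and imaginary parts are independent $\mathcal N(0,1/2)$), independent of $A$. Set $A_{kj}=A_{jk}$, $Y_{kj}=\bar Y_{jk}$ for $j<k$, and $A_{jj}=Y_{jj}=0$. $A\circ Y=(A_{jk}Y_{jk})$. Loss: $\ell(z,z^* )=\min_{a\in\mathbb{C}_1}\sum_{j=1}^n|z_j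 a-z_j^*|^2$. Generalized power method (GPM): let $\widehat u\in\mathbb{C}^n$ be a leading eigenvector of $A\circ Y$ (eigenvector for the largest eigenvalue), set $z^{(0)}_j=\widehat u_j/|\widehat u_j|$ if $\widehat u_j\ne0$ and $z_j^{(0)}=1$ otherwise; for $t\ge1$ set $z^{(t)}=f(z^{(t-1)})$, where $f:\mathbb{C}_1^n\to\mathbb{C}_1^n$ is given by $[f(z)]_j=\frac{s_j}{|s_j|}$ with $s_j=\sum_{k\in[n]\setminus\{j\}}A_{jk}Y_{jk}z_k$ if $s_j\neq0$, and $[f(z)]_j=1$ if $s_j=0$. *)

theory Defs
  imports
    "HOL-Probability.Probability"
    "HOL-Library.Landau_Symbols"
    "Jordan_Normal_Form.Char_Poly"
begin

unbundle no vec_syntax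

(* Vertices are 0, ..., n-1. *)

definition phase_vecs :: "nat \<Rightarrow> complex vec set" where
  "phase_vecs n = {z \<in> carrier_vec n. \<forall>j<n. z $ j \<in> sphere 0 1}"

(* The infimum is attained, so it is the minimum: see loss_attained. *)
definition loss :: "complex vec \<Rightarrow> complex vec \<Rightarrow> real" where
  "loss z zs = (INF a\<in>sphere 0 1. \<Sum>j<dim_vec zs. (cmod (z $ j * a - zs $ j))\<^sup>2)"

lemma loss_attained:
  "\<exists>a\<in>sphere 0 1. loss z zs = (\<Sum>j<dim_vec zs. (cmod (z $ j * a - zs $ j))\<^sup>2)
     \<and> (\<forall>b\<in>sphere 0 1. loss z zs \<le> (\<Sum>j<dim_vec zs. (cmod (z $ j * b - zs $ j))\<^sup>2))"
proof -
  let ?g = "\<lambda>a. \<Sum>j<dim_vec zs. (cmod (z $ j * a - zs $ j))\<^sup>2"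
  have "continuous_on (sphere 0 1) ?g" by (intro continuous_intros)
  moreover have "(1::complex) \<in> sphere 0 1" by simp
  ultimately obtain a where a: "a \<in> sphere 0 1" "\<forall>b\<in>sphere 0 1. ?g a \<le> ?g b"
    using continuous_attains_inf[of "sphere 0 1" ?g] compact_sphere by blast
  have "loss z zs = ?g a"
    unfolding loss_def using a by (intro cInf_eq_minimum) auto
  with a show ?thesis by auto
qed

(* CN(0,1): normal_density takes the standard deviation, so both parts have variance 1/2. *)
definition std_complex_gaussian :: "complex measure" where
  "std_complex_gaussian =
     (let N = density lborel (\<lambda>x. ennreal (normal_density 0 (sqrt (1/2)) x))
      in distr (N \<Otimes>\<^sub>M N) borel (\<lambda>(x, y). Complex x y))"

definition pairs :: "nat \<Rightarrow> (nat \<times> nat) set" where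
  "pairs n = {(j, k). j < k \<and> k < n}"

(* Joint law of (A_jk, j < k) and (W_jk, j < k). *)
definition sync_space :: "nat \<Rightarrow> real \<Rightarrow> ((nat \<times> nat \<Rightarrow> bool) \<times> (nat \<times> nat \<Rightarrow> complex)) measure" where
  "sync_space n p =
     (\<Pi>\<^sub>M e\<in>pairs n. measure_pmf (bernoulli_pmf p)) \<Otimes>\<^sub>M (\<Pi>\<^sub>M e\<in>pairs n. std_complex_gaussian)"

lemma prob_space_std_complex_gaussian: "prob_space std_complex_gaussian"
proof -
  define N where "N = density lborel (\<lambda>x. ennreal (normal_density 0 (sqrt (1/2)) x))"
  have N: "prob_space N" unfolding N_def by (rule prob_space_normal_density) simp
  have "sets N = sets borel" by (simp add: N_def)
  moreover have "(\<lambda>(x::real, y::real). Complex x y) \<in> borel \<Otimes>\<^sub>M borel \<rightarrow>\<^sub>M borel"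
    unfolding borel_prod case_prod_beta Complex_eq
    by (intro borel_measurable_continuous_onI continuous_intros)
  ultimately have "(\<lambda>(x, y). Complex x y) \<in> N \<Otimes>\<^sub>M N \<rightarrow>\<^sub>M borel"
    by (simp cong: measurable_cong_sets sets_pair_measure_cong)
  then show ?thesis
    using N unfolding std_complex_gaussian_def Let_def N_def[symmetric]
    by (intro prob_space.prob_space_distr prob_space_pair)
qed

lemma prob_space_sync_space: "prob_space (sync_space n p)"
  unfolding sync_space_def
  by (intro prob_space_pair prob_space_PiM prob_space_measure_pmf prob_space_std_complex_gaussian)

definition A_mat :: "nat \<Rightarrow> (nat \<times> nat \<Rightarrow> bool) \<Rightarrow> complex mat" where
  "A_mat n a = mat n n (\<lambda>(j, k).
     if j < k then of_bool (a (j, k)) else if k < j then of_bool (a (k, j)) else 0)"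

definition Y_mat :: "nat \<Rightarrow> complex vec \<Rightarrow> real \<Rightarrow> (nat \<times> nat \<Rightarrow> complex) \<Rightarrow> complex mat" where
  "Y_mat n zs \<sigma> w =
     (let y = (\<lambda>j k. zs $ j * cnj (zs $ k) + of_real \<sigma> * w (j, k))
      in mat n n (\<lambda>(j, k). if j < k then y j k else if k < j then cnj (y k j) else 0))"

definition hadamard :: "complex mat \<Rightarrow> complex mat \<Rightarrow> complex mat" where
  "hadamard A Y = mat (dim_row A) (dim_col A) (\<lambda>(j, k). A $$ (j, k) * Y $$ (j, k))"

(* Meant for Hermitian matrices: only real eigenvalues are compared. *)
definition leading_eigenvector :: "complex mat \<Rightarrow> complex vec \<Rightarrow> bool" where
  "leading_eigenvector B u \<longleftrightarrow>
     (\<exists>r::real. eigenvector B u (of_real r) \<and> (\<forall>s::real. eigenvalue B (of_real s) \<longrightarrow> s \<le> r))"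

(* Unlike sgn, this maps 0 to 1. *)
definition phase :: "complex \<Rightarrow> complex" where
  "phase c = (if c = 0 then 1 else c / of_real (cmod c))"

definition gpm_step :: "nat \<Rightarrow> complex mat \<Rightarrow> complex mat \<Rightarrow> complex vec \<Rightarrow> complex vec" where
  "gpm_step n A Y z = vec n (\<lambda>j. phase (\<Sum>k\<in>{..<n} - {j}. A $$ (j, k) * Y $$ (j, k) * z $ k))"

definition gpm :: "nat \<Rightarrow> complex mat \<Rightarrow> complex mat \<Rightarrow> complex vec \<Rightarrow> nat \<Rightarrow> complex vec" where
  "gpm n A Y u t = (gpm_step n A Y ^^ t) (map_vec phase u)"

end

theory Submission
  imports Defs "HOL-Real_Asymp.Real_Asymp"
begin

text \<open>
  Write \<open>R = n p\<close> and let \<open>\<eta>\<close> be the fourth root of \<open>(ln n + \<sigma>\<^sup>2) / R\<close>, which tends to 0.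
  After a rotation by the true phases, the data matrix is \<open>p (1 1\<^sup>T - I)\<close> plus the centred adjacency
  matrix plus \<open>\<sigma>\<close> times the masked noise \<open>A \<circ> W\<close>. The two random matrices have operator norm
  \<open>O(sqrt R)\<close> outside a small event. Hence a leading eigenvector is within relative distance
  \<open>O(\<eta>\<^sup>2)\<close> of a multiple of the truth, which gives a starting loss of order \<open>(1 + \<sigma>\<^sup>2) / p\<close>
  (\<open>spectral_loss\<close>).

  One step of the power method replaces coordinate \<open>j\<close> by the phase of a number whose real part is
  close to \<open>R\<close>, so its error is governed by the imaginary part divided by \<open>R\<close>. The dominant term
  of that imaginary part is \<open>\<sigma>\<close> times the imaginary part of the \<open>j\<close>-th row sum of the rotated
  noise, and these squares sum to about \<open>n R / 2\<close>; this produces \<open>\<sigma>\<^sup>2 / (2 p)\<close>. What depends on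
  the current iterate is at most \<open>\<eta>\<close> times its loss, and the few coordinates with a small real part
  are counted separately. So the loss satisfies
  \<open>l' \<le> \<eta> l + (1 + O(\<eta>)) \<sigma>\<^sup>2 / (2 p)\<close> (\<open>power_step_loss\<close>). For \<open>t \<ge> 1\<close> and
  \<open>t \<ge> ln (1 / \<sigma>\<^sup>2)\<close> the factor \<open>\<eta>\<^sup>t \<le> e \<eta> exp (- t)\<close> turns the starting loss into
  \<open>O(\<eta> \<sigma>\<^sup>2 / p)\<close>.

  The norm bounds must hold without a logarithmic factor although the entries are sparse. They come
  from the moment method (\<open>expected_trace_power_le\<close>): a closed walk on \<open>m\<close> vertices
  uses at least \<open>m - 1\<close> edges, so sparsity contributes \<open>p\<close> to the power \<open>m - 1\<close>, and the walk sum
  over \<open>n\<close> vertices is at most that of a dense matrix with independent entries and only \<open>N = O(R)\<close>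
  rows. The dense matrix is bounded by a net argument (\<open>iid_trace_power_le\<close>).

  For the sharp constant the squared imaginary parts need a Gaussian chaos bound (\<open>Im_energy_tail\<close>).
  Averaging over an auxiliary Gaussian vector \<open>g\<close> reduces it to the Laplacian form
  \<open>\<Sum> A\<^sub>j\<^sub>k (g\<^sub>j - g\<^sub>k)\<^sup>2\<close>, which is at most \<open>(1 + \<eta>) R |g|\<^sup>2\<close> because the mean adjacency matrix
  enters with a favourable sign.
\<close>

section \<open>Words and their repetition patterns\<close>

text \<open>
  Both products run over the classes of the same partition of \<open>I\<close>.
\<close>

lemma fibre_prod_cong:
  fixes c :: "nat \<Rightarrow> real"
  assumes K: "\<And>i j. i \<in> I \<Longrightarrow> j \<in> I \<Longrightarrow> f i = f j \<longleftrightarrow> g i = g j"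
  shows "(\<Prod>e\<in>f ` I. c (card {i \<in> I. f i = e})) = (\<Prod>e\<in>g ` I. c (card {i \<in> I. g i = e}))"
proof (rule prod.reindex_bij_witness[where i = "\<lambda>e. f (inv_into I g e)" and j = "\<lambda>e. g (inv_into I f e)"])
  fix e assume e: "e \<in> f ` I"
  define i where "i = inv_into I f e"
  have i: "i \<in> I" "f i = e"
    using e by (auto simp: i_def inv_into_into f_inv_into_f)
  have gi: "inv_into I g (g i) \<in> I" "g (inv_into I g (g i)) = g i"
    using i by (auto intro: inv_into_into f_inv_into_f)
  show "f (inv_into I g (g (inv_into I f e))) = e"
    using K[of "inv_into I g (g i)" i] gi i by (simp add: i_def)
  show "g (inv_into I f e) \<in> g ` I"
    using i by (simp add: i_def)
  have "{j \<in> I. g j = g i} = {j \<in> I. f j = e}"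
    using K[of _ i] i by auto
  then show "c (card {j \<in> I. g j = g (inv_into I f e)}) = c (card {j \<in> I. f j = e})"
    by (simp add: i_def)
next
  fix e assume e: "e \<in> g ` I"
  define i where "i = inv_into I g e"
  have i: "i \<in> I" "g i = e"
    using e by (auto simp: i_def inv_into_into f_inv_into_f)
  have fi: "inv_into I f (f i) \<in> I" "f (inv_into I f (f i)) = f i"
    using i by (auto intro: inv_into_into f_inv_into_f)
  show "g (inv_into I f (f (inv_into I g e))) = e"
    using K[of "inv_into I f (f i)" i] fi i by (simp add: i_def)
  show "f (inv_into I g e) \<in> f ` I"
    using i by (simp add: i_def)
qed

text \<open>
  Composing \<open>u\<close> with an injection of its letters into \<open>{..<N}\<close> gives a word with the same
  repetition pattern, and different injections give different words.
\<close>

lemma relabelled_words_ge: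
  fixes u :: "'i \<Rightarrow> nat"
  assumes L: "finite L" and N: "card L \<le> N"
  shows "(real N - real (card L)) ^ card (u ` L)
    \<le> real (card {w \<in> L \<rightarrow>\<^sub>E {..<N}. \<forall>i\<in>L. \<forall>j\<in>L. u i = u j \<longleftrightarrow> w i = w j})"
proof -
  let ?R = "u ` L"
  let ?G = "{g \<in> ?R \<rightarrow>\<^sub>E {..<N}. inj_on g ?R}"
  let ?W = "{w \<in> L \<rightarrow>\<^sub>E {..<N}. \<forall>i\<in>L. \<forall>j\<in>L. u i = u j \<longleftrightarrow> w i = w j}"
  have cR: "card ?R \<le> card L"
    using L by (rule card_image_le)
  have "(N - card L) ^ card ?R = (\<Prod>i\<in>{0..<card ?R}. N - card L)"
    by simp
  also have "\<dots> \<le> (\<Prod>i\<in>{0..<card ?R}. N - i)"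
    using cR by (intro prod_mono) auto
  also have "\<dots> = card ?G"
    using card_inj_on_subset_funcset[of ?R "{..<N}" ?R] L by simp
  also have "\<dots> \<le> card ?W"
  proof (rule card_inj_on_le[where f = "\<lambda>g. restrict (g \<circ> u) L"])
    show "inj_on (\<lambda>g. restrict (g \<circ> u) L) ?G"
    proof (rule inj_onI)
      fix g h assume g: "g \<in> ?G" and h: "h \<in> ?G" and eq: "restrict (g \<circ> u) L = restrict (h \<circ> u) L"
      show "g = h"
      proof (rule PiE_ext[of g ?R "\<lambda>_. {..<N}" h])
        fix x assume "x \<in> ?R"
        then obtain i where "i \<in> L" "x = u i" by auto
        with fun_cong[OF eq, of i] show "g x = h x" by simp
      qed (use g h in auto)
    qed
    show "(\<lambda>g. restrict (g \<circ> u) L) ` ?G \<subseteq> ?W"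
    proof (rule image_subsetI)
      fix g assume g: "g \<in> ?G"
      then have "g (u i) = g (u j) \<longleftrightarrow> u i = u j" if "i \<in> L" "j \<in> L" for i j
        using that by (auto dest: inj_onD)
      moreover have "g (u i) < N" if "i \<in> L" for i
        using g that by (auto dest!: PiE_mem[of _ _ _ "u i"])
      ultimately show "restrict (g \<circ> u) L \<in> ?W"
        by simp
    qed
    show "finite ?W"
      using L by (intro finite_subset[OF _ finite_PiE[of L "\<lambda>_. {..<N}"]]) auto
  qed
  finally have "real ((N - card L) ^ card ?R) \<le> real (card ?W)"
    by (rule of_nat_mono)
  then show ?thesis
    using N by (simp add: of_nat_diff)
qed

text \<open>
  A word with the repetition pattern of \<open>w\<close> is determined by the letters that replace those of \<open>w\<close>.
\<close>

lemma relabelled_words_le: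
  fixes w :: "'i \<Rightarrow> nat"
  assumes L: "finite L"
  shows "card {u \<in> L \<rightarrow>\<^sub>E {..<n}. \<forall>i\<in>L. \<forall>j\<in>L. u i = u j \<longleftrightarrow> w i = w j} \<le> n ^ card (w ` L)"
    (is "card ?U \<le> _")
proof -
  have "card ?U \<le> card (w ` L \<rightarrow>\<^sub>E {..<n})"
  proof (rule card_inj_on_le[where f = "\<lambda>u. \<lambda>x\<in>w ` L. u (inv_into L w x)"])
    have key: "u (inv_into L w (w i)) = u i" if "u \<in> ?U" "i \<in> L" for u i
    proof -
      have "inv_into L w (w i) \<in> L" "w (inv_into L w (w i)) = w i"
        using that by (auto intro: inv_into_into f_inv_into_f)
      then show ?thesis using that by blast
    qed
    show "inj_on (\<lambda>u. \<lambda>x\<in>w ` L. u (inv_into L w x)) ?U"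
    proof (rule inj_onI)
      fix u v assume u: "u \<in> ?U" and v: "v \<in> ?U"
        and eq: "(\<lambda>x\<in>w ` L. u (inv_into L w x)) = (\<lambda>x\<in>w ` L. v (inv_into L w x))"
      show "u = v"
      proof (rule PiE_ext[of u L "\<lambda>_. {..<n}" v])
        fix i assume i: "i \<in> L"
        with fun_cong[OF eq, of "w i"] show "u i = v i"
          using key[OF u i] key[OF v i] by simp
      qed (use u v in auto)
    qed
    show "(\<lambda>u. \<lambda>x\<in>w ` L. u (inv_into L w x)) ` ?U \<subseteq> w ` L \<rightarrow>\<^sub>E {..<n}"
    proof (rule image_subsetI)
      fix u assume "u \<in> ?U"
      then have "\<And>i. i \<in> L \<Longrightarrow> u i \<in> {..<n}" by auto
      then show "(\<lambda>x\<in>w ` L. u (inv_into L w x)) \<in> w ` L \<rightarrow>\<^sub>E {..<n}"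
        by (intro restrict_PiE_iff[THEN iffD2] ballI) (meson inv_into_into)
    qed
    show "finite (w ` L \<rightarrow>\<^sub>E {..<n})"
      using L by (intro finite_PiE) auto
  qed
  also have "\<dots> = n ^ card (w ` L)"
    using L by (subst card_funcsetE) auto
  finally show ?thesis .
qed

text \<open>
  Double counting of the pairs of words with a common repetition pattern. A pattern with \<open>m\<close> letters
  is realised by at most \<open>n\<^sup>m\<close> words over \<open>n\<close> letters and by at least \<open>(N - |L|)\<^sup>m\<close> words over
  \<open>N\<close> letters, so the weight \<open>q\<^sup>m\<close> pays for the passage to the smaller alphabet.
\<close>

lemma relabel_sum_le:
  fixes F :: "('i \<Rightarrow> nat) \<Rightarrow> real"
  assumes L: "finite L"
    and F0: "\<And>u. 0 \<le> F u"
    and inv: "\<And>u w. (\<And>i j. i \<in> L \<Longrightarrow> j \<in> L \<Longrightarrow> u i = u j \<longleftrightarrow> w i = w j) \<Longrightarrow> F u = F w"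
    and q: "0 \<le> q" "q * real n \<le> real N - real (card L)" "card L < N"
  shows "(\<Sum>u\<in>L \<rightarrow>\<^sub>E {..<n}. q ^ card (u ` L) * F u) \<le> (\<Sum>w\<in>L \<rightarrow>\<^sub>E {..<N}. F w)"
proof -
  define D where "D = real N - real (card L)"
  have D: "D > 0" using q by (simp add: D_def)
  define K where "K u w \<longleftrightarrow> (\<forall>i\<in>L. \<forall>j\<in>L. u i = u j \<longleftrightarrow> w i = w j)" for u w :: "'i \<Rightarrow> nat"
  have KF: "F u = F w" if "K u w" for u w
    using that by (intro inv) (auto simp: K_def)
  have Kq: "x ^ card (u ` L) = x ^ card (w ` L)" if "K u w" for x :: real and u w
    using fibre_prod_cong[of L u w "\<lambda>_. x"] that by (auto simp: K_def)
  have fin: "finite (L \<rightarrow>\<^sub>E {..<m})" for m :: nat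
    using L by (intro finite_PiE) auto
  have "(\<Sum>u\<in>L \<rightarrow>\<^sub>E {..<n}. q ^ card (u ` L) * F u)
     \<le> (\<Sum>u\<in>L \<rightarrow>\<^sub>E {..<n}. \<Sum>w\<in>{w \<in> L \<rightarrow>\<^sub>E {..<N}. K u w}. (q / D) ^ card (w ` L) * F w)"
  proof (rule sum_mono)
    fix u assume "u \<in> L \<rightarrow>\<^sub>E {..<n}"
    have "(q / D) ^ card (u ` L) * F u * D ^ card (u ` L)
      \<le> (q / D) ^ card (u ` L) * F u * real (card {w \<in> L \<rightarrow>\<^sub>E {..<N}. K u w})"
      using relabelled_words_ge[OF L, of N u] q(1,3) D F0[of u]
      by (intro mult_left_mono mult_nonneg_nonneg zero_le_power divide_nonneg_pos) (simp_all add: D_def K_def)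
    also have "\<dots> = (\<Sum>w\<in>{w \<in> L \<rightarrow>\<^sub>E {..<N}. K u w}. (q / D) ^ card (u ` L) * F u)"
      by simp
    also have "\<dots> = (\<Sum>w\<in>{w \<in> L \<rightarrow>\<^sub>E {..<N}. K u w}. (q / D) ^ card (w ` L) * F w)"
    proof (rule sum.cong[OF refl])
      fix w assume "w \<in> {w \<in> L \<rightarrow>\<^sub>E {..<N}. K u w}"
      then have "K u w" by simp
      from KF[OF this] Kq[OF this, of "q / D"]
      show "(q / D) ^ card (u ` L) * F u = (q / D) ^ card (w ` L) * F w" by simp
    qed
    finally show "q ^ card (u ` L) * F u \<le> (\<Sum>w\<in>{w \<in> L \<rightarrow>\<^sub>E {..<N}. K u w}. (q / D) ^ card (w ` L) * F w)"
      using D by (simp add: power_divide)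
  qed
  also have "\<dots> = (\<Sum>w\<in>L \<rightarrow>\<^sub>E {..<N}. \<Sum>u\<in>{u \<in> L \<rightarrow>\<^sub>E {..<n}. K u w}. (q / D) ^ card (w ` L) * F w)"
    using fin by (intro sum.swap_restrict) auto
  also have "\<dots> \<le> (\<Sum>w\<in>L \<rightarrow>\<^sub>E {..<N}. F w)"
  proof (rule sum_mono)
    fix w
    have "real (card {u \<in> L \<rightarrow>\<^sub>E {..<n}. K u w}) \<le> real n ^ card (w ` L)"
      using relabelled_words_le[OF L, of n w] unfolding K_def of_nat_power[symmetric] of_nat_le_iff .
    then have "real (card {u \<in> L \<rightarrow>\<^sub>E {..<n}. K u w}) * ((q / D) ^ card (w ` L) * F w)
       \<le> real n ^ card (w ` L) * ((q / D) ^ card (w ` L) * F w)"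
      using q(1) D F0[of w] by (intro mult_right_mono mult_nonneg_nonneg zero_le_power divide_nonneg_pos) 
    also have "\<dots> = (q * real n / D) ^ card (w ` L) * F w"
      by (simp add: power_mult_distrib power_divide)
    also have "\<dots> \<le> 1 * F w"
    proof (intro mult_right_mono power_le_one F0)
      show "0 \<le> q * real n / D" using q D by simp
      show "q * real n / D \<le> 1" using q(2) D unfolding D_def[symmetric] by simp
    qed
    finally show "(\<Sum>u\<in>{u \<in> L \<rightarrow>\<^sub>E {..<n}. K u w}. (q / D) ^ card (w ` L) * F w) \<le> F w"
      by simp
  qed
  finally show ?thesis .
qed

section \<open>Trace moments as sums over closed walks\<close>

text \<open>
  The matrix \<open>X X\<^sup>T\<close> acting on vectors; matrices and vectors of varying size are functions of
  which only the indices below \<open>n\<close> matter.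
\<close>

definition gram :: "nat \<Rightarrow> (nat \<times> nat \<Rightarrow> real) \<Rightarrow> (nat \<Rightarrow> real) \<Rightarrow> nat \<Rightarrow> real" where
  "gram n X f a = (\<Sum>b<n. \<Sum>d<n. X (a, d) * X (b, d) * f b)"

text \<open>
  The trace of \<open>(X X\<^sup>T)\<^sup>k\<close>.
\<close>

definition trace_power :: "nat \<Rightarrow> (nat \<times> nat \<Rightarrow> real) \<Rightarrow> nat \<Rightarrow> real" where
  "trace_power n X k = (\<Sum>a<n. (gram n X ^^ k) (\<lambda>b. of_bool (b = a)) a)"

lemma gram_sym: "(\<Sum>a<n. g a * gram n X f a) = (\<Sum>a<n. gram n X g a * f a)"
proof -
  have "(\<Sum>a<n. g a * gram n X f a) = (\<Sum>a<n. \<Sum>b<n. \<Sum>d<n. g a * (X (a, d) * X (b, d) * f b))"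
    by (simp add: gram_def sum_distrib_left)
  also have "\<dots> = (\<Sum>b<n. \<Sum>a<n. \<Sum>d<n. g a * (X (a, d) * X (b, d) * f b))"
    by (rule sum.swap)
  also have "\<dots> = (\<Sum>b<n. gram n X g b * f b)"
    by (simp add: gram_def sum_distrib_right sum_distrib_left mult_ac)
  finally show ?thesis .
qed

lemma gram_quadratic: "(\<Sum>a<n. f a * gram n X f a) = (\<Sum>d<n. (\<Sum>a<n. X (a, d) * f a)\<^sup>2)"
proof -
  have "(\<Sum>d<n. (\<Sum>a<n. X (a, d) * f a)\<^sup>2)
      = (\<Sum>d<n. \<Sum>a<n. \<Sum>b<n. f a * (X (a, d) * X (b, d) * f b))"
    by (simp add: power2_eq_square sum_product mult_ac)
  also have "\<dots> = (\<Sum>a<n. \<Sum>d<n. \<Sum>b<n. f a * (X (a, d) * X (b, d) * f b))"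
    by (rule sum.swap)
  also have "\<dots> = (\<Sum>a<n. \<Sum>b<n. \<Sum>d<n. f a * (X (a, d) * X (b, d) * f b))"
    by (intro sum.cong[OF refl] sum.swap)
  finally show ?thesis
    by (simp add: gram_def sum_distrib_left)
qed

lemma gram_power_sym:
  "(\<Sum>a<n. g a * (gram n X ^^ k) f a) = (\<Sum>a<n. (gram n X ^^ k) g a * f a)"
proof (induction k arbitrary: f g)
  case (Suc k)
  have "(\<Sum>a<n. g a * (gram n X ^^ Suc k) f a) = (\<Sum>a<n. gram n X g a * (gram n X ^^ k) f a)"
    by (simp add: gram_sym)
  also have "\<dots> = (\<Sum>a<n. (gram n X ^^ Suc k) g a * f a)"
    by (simp only: Suc.IH funpow_Suc_right o_def)
  finally show ?case .
qed simp

lemma gram_power_double: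
  "(\<Sum>a<n. g a * (gram n X ^^ (2 * l)) g a) = (\<Sum>a<n. ((gram n X ^^ l) g a)\<^sup>2)"
  by (simp add: mult_2 funpow_add gram_power_sym power2_eq_square)

lemma gram_power_at:
  assumes "a < n"
  shows "(gram n X ^^ l) f a = (\<Sum>b<n. (gram n X ^^ l) (\<lambda>b. of_bool (b = a)) b * f b)"
proof -
  have "(gram n X ^^ l) f a = (\<Sum>b<n. of_bool (b = a) * (gram n X ^^ l) f b)"
    using assms by (simp add: of_bool_def if_distrib[of "\<lambda>x. x * _"] sum.delta cong: if_cong)
  then show ?thesis by (simp add: gram_power_sym)
qed

lemma trace_power_double:
  "trace_power n X (2 * l) = (\<Sum>a<n. \<Sum>b<n. ((gram n X ^^ l) (\<lambda>b. of_bool (b = a)) b)\<^sup>2)"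
  unfolding trace_power_def
proof (rule sum.cong[OF refl])
  fix a assume "a \<in> {..<n}"
  then have "(gram n X ^^ (2 * l)) (\<lambda>b. of_bool (b = a)) a
      = (\<Sum>b<n. of_bool (b = a) * (gram n X ^^ (2 * l)) (\<lambda>b. of_bool (b = a)) b)"
    by (simp add: of_bool_def if_distrib[of "\<lambda>x. x * _"] sum.delta cong: if_cong)
  also have "\<dots> = (\<Sum>b<n. ((gram n X ^^ l) (\<lambda>b. of_bool (b = a)) b)\<^sup>2)"
    by (rule gram_power_double)
  finally show "(gram n X ^^ (2 * l)) (\<lambda>b. of_bool (b = a)) a = \<dots>" .
qed

text \<open>
  The moments \<open>m i = \<langle>f, (X X\<^sup>T)\<^sup>i f\<rangle>\<close> satisfy \<open>(m i)\<^sup>2 \<le> |f|\<^sup>2 m (2 i)\<close> by Cauchy-Schwarz. Repeated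
  doubling reaches \<open>m (2 l) = |(X X\<^sup>T)\<^sup>l f|\<^sup>2\<close>, which the Frobenius norm of \<open>(X X\<^sup>T)\<^sup>l\<close> bounds,
  and the square of that norm is a trace.
\<close>

lemma power_le_trace_power:
  fixes f :: "nat \<Rightarrow> real"
  shows "(\<Sum>d<n. (\<Sum>a<n. X (a, d) * f a)\<^sup>2) ^ (2 ^ Suc r)
    \<le> trace_power n X (2 ^ Suc r) * (\<Sum>a<n. (f a)\<^sup>2) ^ (2 ^ Suc r)"
proof -
  define s where "s = (\<Sum>a<n. (f a)\<^sup>2)"
  define m where "m i = (\<Sum>a<n. f a * (gram n X ^^ i) f a)" for i
  have s0: "s \<ge> 0" by (simp add: s_def sum_nonneg)
  have m1: "m 1 = (\<Sum>d<n. (\<Sum>a<n. X (a, d) * f a)\<^sup>2)"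
    by (simp add: m_def gram_quadratic)
  then have m10: "m 1 \<ge> 0" by (simp add: sum_nonneg)
  have cs: "(m i)\<^sup>2 \<le> s * m (2 * i)" for i
    unfolding m_def s_def gram_power_double by (rule Cauchy_Schwarz_ineq_sum)
  have ind: "m 1 ^ (2 ^ i) * s \<le> s ^ (2 ^ i) * m (2 ^ i)" for i
  proof (induction i)
    case (Suc i)
    show ?case
    proof (cases "s = 0")
      case False
      with s0 have s: "s > 0" by simp
      have "(m 1 ^ (2 ^ i) * s)\<^sup>2 \<le> (s ^ (2 ^ i) * m (2 ^ i))\<^sup>2"
        using Suc m10 s0 by (intro power_mono) auto
      also have "\<dots> = s ^ (2 ^ Suc i) * (m (2 ^ i))\<^sup>2"
        by (simp add: power_mult_distrib power_mult[symmetric] mult.commute)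
      also have "\<dots> \<le> s ^ (2 ^ Suc i) * (s * m (2 ^ Suc i))"
        using cs[of "2 ^ i"] s0 by (intro mult_left_mono) auto
      finally have "m 1 ^ (2 ^ Suc i) * s * s \<le> s ^ (2 ^ Suc i) * m (2 ^ Suc i) * s"
        by (simp add: power_mult_distrib power2_eq_square power_mult[symmetric] mult_ac flip: power_add mult_2)
      with s show ?thesis by simp
    qed (simp add: power_0_left)
  qed simp
  have "m (2 * l) \<le> s * trace_power n X (2 * l)" for l
  proof -
    have "m (2 * l) = (\<Sum>a<n. ((gram n X ^^ l) f a)\<^sup>2)"
      by (simp add: m_def gram_power_double)
    also have "\<dots> \<le> (\<Sum>a<n. (\<Sum>b<n. ((gram n X ^^ l) (\<lambda>b. of_bool (b = a)) b)\<^sup>2) * s)"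
    proof (rule sum_mono)
      fix a assume "a \<in> {..<n}"
      then show "((gram n X ^^ l) f a)\<^sup>2 \<le> (\<Sum>b<n. ((gram n X ^^ l) (\<lambda>b. of_bool (b = a)) b)\<^sup>2) * s"
        using Cauchy_Schwarz_ineq_sum[of "(gram n X ^^ l) (\<lambda>b. of_bool (b = a))" f "{..<n}"]
        by (subst gram_power_at) (simp_all add: s_def)
    qed
    finally show ?thesis
      unfolding trace_power_double sum_distrib_right[symmetric] by (simp only: mult.commute)
  qed
  from this[of "2 ^ r"] have tr: "m (2 ^ Suc r) \<le> s * trace_power n X (2 ^ Suc r)"
    by simp
  show ?thesis
  proof (cases "s = 0")
    case True
    then have "f a = 0" if "a < n" for a
      using that unfolding s_def by (subst (asm) sum_nonneg_eq_0_iff) auto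
    then show ?thesis by (simp add: sum.neutral power_0_left)
  next
    case False
    with s0 have s: "s > 0" by simp
    have "m 1 ^ (2 ^ Suc r) * s \<le> s ^ (2 ^ Suc r) * (s * trace_power n X (2 ^ Suc r))"
      using ind[of "Suc r"] tr s0 by (meson mult_left_mono order_trans zero_le_power)
    with s have "m 1 ^ (2 ^ Suc r) \<le> s ^ (2 ^ Suc r) * trace_power n X (2 ^ Suc r)"
      by (simp add: mult.assoc[symmetric] mult.commute[of s])
    then show ?thesis unfolding m1 s_def by (simp only: mult.commute)
  qed
qed

text \<open>
  Step \<open>i\<close> of the bipartite walk \<open>u 0, v 0, u 1, v 1, \<dots>\<close>. The even steps lead from a row to a
  column and the odd ones back; an edge is recorded as (row, column) in both cases.
\<close>

definition walk_edge :: "(nat \<Rightarrow> nat) \<Rightarrow> (nat \<Rightarrow> nat) \<Rightarrow> nat \<Rightarrow> nat \<times> nat" where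
  "walk_edge u v i = (u (Suc i div 2), v (i div 2))"

lemma sum_PiE_insert:
  fixes G :: "('i \<Rightarrow> 'b) \<Rightarrow> real"
  assumes "x \<notin> S"
  shows "(\<Sum>u\<in>insert x S \<rightarrow>\<^sub>E A. G u) = (\<Sum>c\<in>A. \<Sum>u\<in>S \<rightarrow>\<^sub>E A. G (u(x := c)))"
proof -
  have "(\<Sum>u\<in>insert x S \<rightarrow>\<^sub>E A. G u) = (\<Sum>(c, u)\<in>A \<times> (S \<rightarrow>\<^sub>E A). G (u(x := c)))"
    unfolding PiE_insert_eq using inj_combinator[OF assms, of "\<lambda>_. A"]
    by (subst sum.reindex) (auto simp: o_def case_prod_unfold)
  then show ?thesis by (simp add: sum.cartesian_product)
qed

lemma gram_power_walks:
  assumes "a < n"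
  shows "(gram n X ^^ k) f a = (\<Sum>u\<in>{..k} \<rightarrow>\<^sub>E {..<n}. \<Sum>v\<in>{..<k} \<rightarrow>\<^sub>E {..<n}.
     of_bool (u 0 = a) * (\<Prod>i<2 * k. X (walk_edge u v i)) * f (u k))"
proof (induction k arbitrary: f)
  case 0
  have [simp]: "{..0::nat} = {0}" by auto
  have "(\<Sum>u\<in>insert 0 {} \<rightarrow>\<^sub>E {..<n}. of_bool (u 0 = a) * f (u 0)) = f a"
    using assms by (subst sum_PiE_insert)
      (simp_all add: of_bool_def if_distrib[of "\<lambda>x. x * _"] sum.delta cong: if_cong)
  from this[symmetric] show ?case by simp
next
  case (Suc k)
  let ?U = "{..k} \<rightarrow>\<^sub>E {..<n}" and ?V = "{..<k} \<rightarrow>\<^sub>E {..<n}"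
  let ?P = "\<lambda>u v. \<Prod>i<2 * k. X (walk_edge u v i)"
  have step: "(\<Prod>i<2 * Suc k. X (walk_edge (u(Suc k := c)) (v(k := d)) i)) = ?P u v * X (u k, d) * X (c, d)"
    for u v c d
  proof -
    have "(\<Prod>i<2 * Suc k. X (walk_edge (u(Suc k := c)) (v(k := d)) i))
       = (\<Prod>i<2 * k. X (walk_edge (u(Suc k := c)) (v(k := d)) i)) * X (u k, d) * X (c, d)"
      by (simp add: walk_edge_def)
    also have "(\<Prod>i<2 * k. X (walk_edge (u(Suc k := c)) (v(k := d)) i)) = ?P u v"
      by (intro prod.cong refl) (auto simp: walk_edge_def)
    finally show ?thesis .
  qed
  have ins: "{..Suc k} = insert (Suc k) {..k}" "{..<Suc k} = insert k {..<k}"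
    by auto
  have "(\<Sum>u\<in>{..Suc k} \<rightarrow>\<^sub>E {..<n}. \<Sum>v\<in>{..<Suc k} \<rightarrow>\<^sub>E {..<n}.
       of_bool (u 0 = a) * (\<Prod>i<2 * Suc k. X (walk_edge u v i)) * f (u (Suc k)))
     = (\<Sum>c<n. \<Sum>u\<in>?U. \<Sum>d<n. \<Sum>v\<in>?V.
       of_bool (u 0 = a) * (?P u v * X (u k, d) * X (c, d)) * f c)"
    unfolding ins by (simp add: sum_PiE_insert step del: mult_Suc_right)
  also have "\<dots> = (\<Sum>u\<in>?U. \<Sum>c<n. \<Sum>v\<in>?V. \<Sum>d<n. of_bool (u 0 = a) * (?P u v * X (u k, d) * X (c, d)) * f c)"
    by (subst sum.swap) (intro sum.cong refl sum.swap)
  also have "\<dots> = (\<Sum>u\<in>?U. \<Sum>v\<in>?V. \<Sum>c<n. \<Sum>d<n. of_bool (u 0 = a) * (?P u v * X (u k, d) * X (c, d)) * f c)"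
    by (intro sum.cong refl sum.swap)
  also have "\<dots> = (\<Sum>u\<in>?U. \<Sum>v\<in>?V. of_bool (u 0 = a) * ?P u v * gram n X f (u k))"
    by (simp add: gram_def sum_distrib_left mult_ac)
  also have "\<dots> = (gram n X ^^ Suc k) f a"
    by (simp only: Suc.IH[symmetric] funpow_Suc_right o_def)
  finally show ?case by simp
qed

lemma trace_power_walks:
  "trace_power n X k = (\<Sum>u\<in>{..k} \<rightarrow>\<^sub>E {..<n}. \<Sum>v\<in>{..<k} \<rightarrow>\<^sub>E {..<n}.
     of_bool (u 0 = u k) * (\<Prod>i<2 * k. X (walk_edge u v i)))"
proof -
  let ?U = "{..k} \<rightarrow>\<^sub>E {..<n}" and ?V = "{..<k} \<rightarrow>\<^sub>E {..<n}"
  let ?P = "\<lambda>u v. \<Prod>i<2 * k. X (walk_edge u v i)"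
  have "trace_power n X k = (\<Sum>a<n. \<Sum>u\<in>?U. \<Sum>v\<in>?V. of_bool (u 0 = a) * ?P u v * of_bool (u k = a))"
    by (simp add: trace_power_def gram_power_walks)
  also have "\<dots> = (\<Sum>u\<in>?U. \<Sum>v\<in>?V. \<Sum>a<n. of_bool (u 0 = a) * ?P u v * of_bool (u k = a))"
    by (subst sum.swap) (intro sum.cong refl sum.swap)
  also have "\<dots> = (\<Sum>u\<in>?U. \<Sum>v\<in>?V. of_bool (u 0 = u k) * ?P u v)"
  proof (intro sum.cong refl)
    fix u v assume "u \<in> ?U"
    then have "u k < n" by auto
    then show "(\<Sum>a<n. of_bool (u 0 = a) * ?P u v * of_bool (u k = a)) = of_bool (u 0 = u k) * ?P u v"
      by (simp add: of_bool_def if_distrib[of "\<lambda>x. _ * x"] sum.delta' cong: if_cong)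
  qed
  finally show ?thesis .
qed

text \<open>
  Every vertex after the first is reached along a new edge.
\<close>

lemma card_walk_vertices_le:
  "card (u ` {..k}) + card (v ` {..<k}) \<le> card (walk_edge u v ` {..<2 * k}) + 1"
proof (induction k)
  case 0
  have "{..0::nat} = {0}" by auto
  then show ?case by simp
next
  case (Suc k)
  let ?E = "walk_edge u v ` {..<2 * k}"
  have E: "walk_edge u v ` {..<2 * Suc k} = insert (u (Suc k), v k) (insert (u k, v k) ?E)"
    by (simp add: lessThan_Suc walk_edge_def)
  have U: "u ` {..Suc k} = insert (u (Suc k)) (u ` {..k})"
    by (simp add: atMost_Suc)
  have V: "v ` {..<Suc k} = insert (v k) (v ` {..<k})"
    by (simp add: lessThan_Suc)
  have 1: "(a, v k) \<notin> ?E" if "v k \<notin> v ` {..<k}" for a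
  proof
    assume "(a, v k) \<in> ?E"
    then obtain i where "i < 2 * k" "v k = v (i div 2)"
      by (auto simp: walk_edge_def)
    with that show False by auto
  qed
  have 2: "(u (Suc k), v k) \<notin> insert (u k, v k) ?E" if new: "u (Suc k) \<notin> u ` {..k}"
  proof
    assume "(u (Suc k), v k) \<in> insert (u k, v k) ?E"
    then consider "u (Suc k) = u k" | i where "i < 2 * k" "u (Suc k) = u (Suc i div 2)"
      by (auto simp: walk_edge_def)
    then show False
    proof cases
      case 1
      with new show False by auto
    next
      case (2 i)
      then have "Suc i div 2 \<in> {..k}" by auto
      with 2 new show False by blast
    qed
  qed
  have "card (u ` {..Suc k}) + card (v ` {..<Suc k})
     \<le> card (u ` {..k}) + card (v ` {..<k}) + of_bool (v k \<notin> v ` {..<k}) + of_bool (u (Suc k) \<notin> u ` {..k})"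
    unfolding U V by (simp add: card_insert_if)
  also have "\<dots> \<le> card ?E + of_bool (v k \<notin> v ` {..<k}) + of_bool (u (Suc k) \<notin> u ` {..k}) + 1"
    using Suc by simp
  also have "card ?E + of_bool (v k \<notin> v ` {..<k}) \<le> card (insert (u k, v k) ?E)"
    using 1[of "u k"] by (auto simp: card_insert_if)
  also have "card (insert (u k, v k) ?E) + of_bool (u (Suc k) \<notin> u ` {..k}) \<le> card (insert (u (Suc k), v k) (insert (u k, v k) ?E))"
    using 2 by (auto simp: card_insert_if)
  finally show ?case unfolding E by simp
qed

section \<open>Sparse matrices are dominated by small dense ones\<close>

lemma prod_eq_prod_fibres:
  fixes X :: "'e \<Rightarrow> real"
  assumes "finite I" "finite S" "f ` I \<subseteq> S"
  shows "(\<Prod>i\<in>I. X (f i)) = (\<Prod>e\<in>S. X e ^ card {i \<in> I. f i = e})"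
proof -
  have "(\<Prod>e\<in>S. X e ^ card {i \<in> I. f i = e}) = (\<Prod>e\<in>S. \<Prod>i\<in>{i \<in> I. f i = e}. X (f i))"
    by (intro prod.cong refl) simp
  also have "\<dots> = (\<Prod>i\<in>I. X (f i))"
    using assms by (rule prod.group)
  finally show ?thesis by simp
qed

lemma walk_edge_in:
  assumes "u \<in> {..k} \<rightarrow>\<^sub>E {..<n}" "v \<in> {..<k} \<rightarrow>\<^sub>E {..<n}"
  shows "walk_edge u v ` {..<2 * k} \<subseteq> {..<n} \<times> {..<n}"
  using assms by (auto simp: walk_edge_def PiE_iff)

text \<open>
  The expected product of the entries along a closed walk, for independent entries with moments \<open>c\<close>;
  it is 0 on walks that are not closed.
\<close>

definition walk_weight :: "(nat \<Rightarrow> real) \<Rightarrow> nat \<Rightarrow> (nat \<Rightarrow> nat) \<Rightarrow> (nat \<Rightarrow> nat) \<Rightarrow> real" where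
  "walk_weight c k u v = of_bool (u 0 = u k) *
     (\<Prod>e\<in>walk_edge u v ` {..<2 * k}. c (card {i \<in> {..<2 * k}. walk_edge u v i = e}))"

lemma walk_weight_nonneg: "(\<And>m. 0 \<le> c m) \<Longrightarrow> 0 \<le> walk_weight c k u v"
  by (simp add: walk_weight_def prod_nonneg)

lemma walk_weight_cong:
  assumes u: "\<And>i j. i \<in> {..k} \<Longrightarrow> j \<in> {..k} \<Longrightarrow> u i = u j \<longleftrightarrow> u' i = u' j"
    and v: "\<And>i j. i \<in> {..<k} \<Longrightarrow> j \<in> {..<k} \<Longrightarrow> v i = v j \<longleftrightarrow> v' i = v' j"
  shows "walk_weight c k u v = walk_weight c k u' v'"
proof -
  have "(\<Prod>e\<in>walk_edge u v ` {..<2 * k}. c (card {i \<in> {..<2 * k}. walk_edge u v i = e}))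
     = (\<Prod>e\<in>walk_edge u' v' ` {..<2 * k}. c (card {i \<in> {..<2 * k}. walk_edge u' v' i = e}))"
  proof (rule fibre_prod_cong)
    fix i j assume ij: "i \<in> {..<2 * k}" "j \<in> {..<2 * k}"
    then have "Suc i div 2 \<in> {..k}" "Suc j div 2 \<in> {..k}" "i div 2 \<in> {..<k}" "j div 2 \<in> {..<k}"
      by auto
    with u[of "Suc i div 2" "Suc j div 2"] v[of "i div 2" "j div 2"]
    show "walk_edge u v i = walk_edge u v j \<longleftrightarrow> walk_edge u' v' i = walk_edge u' v' j"
      by (simp add: walk_edge_def)
  qed
  then show ?thesis
    using u[of 0 k] by (simp add: walk_weight_def)
qed

text \<open>
  Expanding the trace over closed walks, a walk with \<open>m\<close> vertices has at least \<open>m - 1\<close> distinct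
  edges, each of which contributes a factor \<open>p\<close>. Thus \<open>p\<close> times the expected trace for \<open>X\<close> is at most
  the walk sum weighted by \<open>p\<^sup>m\<close>, and the weights depend only on the repetition pattern. Relabelling
  first the rows and then the columns gives the walk sum of a matrix with only \<open>N\<close> rows and columns,
  for any \<open>N\<close> from \<open>n p + k + 1\<close> on.
\<close>

theorem expected_trace_power_le:
  fixes X :: "'w \<Rightarrow> nat \<times> nat \<Rightarrow> real" and Z :: "'v \<Rightarrow> nat \<times> nat \<Rightarrow> real"
  assumes X_int: "\<And>m :: nat \<times> nat \<Rightarrow> nat. integrable M (\<lambda>\<omega>. \<Prod>e\<in>{..<n} \<times> {..<n}. X \<omega> e ^ m e)"
    and X_mom: "\<And>m :: nat \<times> nat \<Rightarrow> nat. \<bar>\<integral>\<omega>. (\<Prod>e\<in>{..<n} \<times> {..<n}. X \<omega> e ^ m e) \<partial>M\<bar>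
        \<le> (\<Prod>e\<in>{e \<in> {..<n} \<times> {..<n}. m e > 0}. p * c (m e))"
    and Z_int: "\<And>m :: nat \<times> nat \<Rightarrow> nat. integrable M' (\<lambda>\<omega>. \<Prod>e\<in>{..<N} \<times> {..<N}. Z \<omega> e ^ m e)"
    and Z_mom: "\<And>m :: nat \<times> nat \<Rightarrow> nat. (\<integral>\<omega>. (\<Prod>e\<in>{..<N} \<times> {..<N}. Z \<omega> e ^ m e) \<partial>M')
        = (\<Prod>e\<in>{e \<in> {..<N} \<times> {..<N}. m e > 0}. c (m e))"
    and p: "0 \<le> p" "p \<le> 1" and c: "\<And>m. 0 \<le> c m"
    and N: "p * real n \<le> real N - real (Suc k)" "Suc k < N"
  shows "integrable M (\<lambda>\<omega>. trace_power n (X \<omega>) k)"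
    and "integrable M' (\<lambda>\<omega>. trace_power N (Z \<omega>) k)"
    and "p * (\<integral>\<omega>. trace_power n (X \<omega>) k \<partial>M) \<le> (\<integral>\<omega>. trace_power N (Z \<omega>) k \<partial>M')"
proof -
  define mu where "mu u v e = card {i \<in> {..<2 * k}. walk_edge u v i = e}" for u v e
  let ?U = "\<lambda>n. {..k} \<rightarrow>\<^sub>E {..<n}" and ?V = "\<lambda>n. {..<k} \<rightarrow>\<^sub>E {..<n}"
  have prodX: "(\<Prod>i<2 * k. Y (walk_edge u v i)) = (\<Prod>e\<in>{..<n} \<times> {..<n}. Y e ^ mu u v e)"
    if "u \<in> ?U n" "v \<in> ?V n" for Y :: "nat \<times> nat \<Rightarrow> real" and u v and n :: nat
    unfolding mu_def by (rule prod_eq_prod_fibres) (use walk_edge_in[OF that] in auto)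
  have mu_pos: "{e \<in> {..<n} \<times> {..<n}. mu u v e > 0} = walk_edge u v ` {..<2 * k}"
    if "u \<in> ?U n" "v \<in> ?V n" for u v and n :: nat
  proof -
    have "mu u v e > 0 \<longleftrightarrow> e \<in> walk_edge u v ` {..<2 * k}" for e
      by (auto simp: mu_def card_gt_0_iff)
    then show ?thesis using walk_edge_in[OF that] by auto
  qed
  have intX: "integrable M (\<lambda>\<omega>. \<Prod>i<2 * k. X \<omega> (walk_edge u v i))" if "u \<in> ?U n" "v \<in> ?V n" for u v
    using X_int by (simp add: prodX[OF that])
  have intZ: "integrable M' (\<lambda>\<omega>. \<Prod>i<2 * k. Z \<omega> (walk_edge u v i))" if "u \<in> ?U N" "v \<in> ?V N" for u v
    using Z_int by (simp add: prodX[OF that])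
  show "integrable M (\<lambda>\<omega>. trace_power n (X \<omega>) k)"
    unfolding trace_power_walks
    by (intro Bochner_Integration.integrable_sum integrable_mult_right intX)
  show "integrable M' (\<lambda>\<omega>. trace_power N (Z \<omega>) k)"
    unfolding trace_power_walks
    by (intro Bochner_Integration.integrable_sum integrable_mult_right intZ)
  have valZ: "(\<integral>\<omega>. trace_power N (Z \<omega>) k \<partial>M') = (\<Sum>u\<in>?U N. \<Sum>v\<in>?V N. walk_weight c k u v)"
  proof -
    have "(\<integral>\<omega>. trace_power N (Z \<omega>) k \<partial>M')
      = (\<Sum>u\<in>?U N. \<Sum>v\<in>?V N. of_bool (u 0 = u k) * (\<integral>\<omega>. (\<Prod>i<2 * k. Z \<omega> (walk_edge u v i)) \<partial>M'))"
      unfolding trace_power_walks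
      by (simp add: Bochner_Integration.integral_sum Bochner_Integration.integrable_sum intZ)
    also have "\<dots> = (\<Sum>u\<in>?U N. \<Sum>v\<in>?V N. walk_weight c k u v)"
    proof (intro sum.cong refl)
      fix u v assume uv: "u \<in> ?U N" "v \<in> ?V N"
      have "(\<integral>\<omega>. (\<Prod>i<2 * k. Z \<omega> (walk_edge u v i)) \<partial>M') = (\<Prod>e\<in>walk_edge u v ` {..<2 * k}. c (mu u v e))"
        using Z_mom[of "mu u v"] by (simp add: prodX[OF uv] mu_pos[OF uv])
      then show "of_bool (u 0 = u k) * (\<integral>\<omega>. (\<Prod>i<2 * k. Z \<omega> (walk_edge u v i)) \<partial>M') = walk_weight c k u v"
        by (simp add: walk_weight_def mu_def)
    qed
    finally show ?thesis .
  qed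
  have "p * (\<integral>\<omega>. trace_power n (X \<omega>) k \<partial>M)
     = (\<Sum>u\<in>?U n. \<Sum>v\<in>?V n. p * (of_bool (u 0 = u k) * (\<integral>\<omega>. (\<Prod>i<2 * k. X \<omega> (walk_edge u v i)) \<partial>M)))"
    unfolding trace_power_walks
    by (simp add: Bochner_Integration.integral_sum Bochner_Integration.integrable_sum intX sum_distrib_left)
  also have "\<dots> \<le> (\<Sum>u\<in>?U n. \<Sum>v\<in>?V n. p ^ card (u ` {..k}) * (p ^ card (v ` {..<k}) * walk_weight c k u v))"
  proof (intro sum_mono)
    fix u v assume uv: "u \<in> ?U n" "v \<in> ?V n"
    let ?E = "walk_edge u v ` {..<2 * k}"
    have "(\<integral>\<omega>. (\<Prod>i<2 * k. X \<omega> (walk_edge u v i)) \<partial>M) \<le> (\<Prod>e\<in>?E. p * c (mu u v e))"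
      using X_mom[of "mu u v"] by (simp add: prodX[OF uv] mu_pos[OF uv])
    also have "\<dots> = p ^ card ?E * (\<Prod>e\<in>?E. c (mu u v e))"
      by (simp add: prod.distrib)
    finally have "p * (of_bool (u 0 = u k) * (\<integral>\<omega>. (\<Prod>i<2 * k. X \<omega> (walk_edge u v i)) \<partial>M))
       \<le> p * (of_bool (u 0 = u k) * (p ^ card ?E * (\<Prod>e\<in>?E. c (mu u v e))))"
      using p by (intro mult_left_mono) auto
    also have "\<dots> = p ^ (card ?E + 1) * walk_weight c k u v"
      by (simp add: walk_weight_def mu_def)
    also have "\<dots> \<le> p ^ (card (u ` {..k}) + card (v ` {..<k})) * walk_weight c k u v"
      using p c card_walk_vertices_le[of u k v]
      by (intro mult_right_mono power_decreasing walk_weight_nonneg) auto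
    finally show "p * (of_bool (u 0 = u k) * (\<integral>\<omega>. (\<Prod>i<2 * k. X \<omega> (walk_edge u v i)) \<partial>M))
       \<le> p ^ card (u ` {..k}) * (p ^ card (v ` {..<k}) * walk_weight c k u v)"
      by (simp add: power_add)
  qed
  also have "\<dots> = (\<Sum>u\<in>?U n. p ^ card (u ` {..k}) * (\<Sum>v\<in>?V n. p ^ card (v ` {..<k}) * walk_weight c k u v))"
    by (simp add: sum_distrib_left)
  also have "\<dots> \<le> (\<Sum>u\<in>?U N. \<Sum>v\<in>?V n. p ^ card (v ` {..<k}) * walk_weight c k u v)"
  proof (rule relabel_sum_le)
    fix u u' :: "nat \<Rightarrow> nat"
    assume "\<And>i j. i \<in> {..k} \<Longrightarrow> j \<in> {..k} \<Longrightarrow> u i = u j \<longleftrightarrow> u' i = u' j"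
    then have "walk_weight c k u v = walk_weight c k u' v" for v
      by (intro walk_weight_cong) auto
    then show "(\<Sum>v\<in>?V n. p ^ card (v ` {..<k}) * walk_weight c k u v)
      = (\<Sum>v\<in>?V n. p ^ card (v ` {..<k}) * walk_weight c k u' v)" by simp
  qed (use p N c in \<open>auto intro!: sum_nonneg mult_nonneg_nonneg walk_weight_nonneg\<close>)
  also have "\<dots> = (\<Sum>v\<in>?V n. p ^ card (v ` {..<k}) * (\<Sum>u\<in>?U N. walk_weight c k u v))"
    by (subst sum.swap) (simp add: sum_distrib_left)
  also have "\<dots> \<le> (\<Sum>v\<in>?V N. \<Sum>u\<in>?U N. walk_weight c k u v)"
  proof (rule relabel_sum_le)
    fix v v' :: "nat \<Rightarrow> nat"
    assume "\<And>i j. i \<in> {..<k} \<Longrightarrow> j \<in> {..<k} \<Longrightarrow> v i = v j \<longleftrightarrow> v' i = v' j"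
    then have "walk_weight c k u v = walk_weight c k u v'" for u
      by (intro walk_weight_cong) auto
    then show "(\<Sum>u\<in>?U N. walk_weight c k u v) = (\<Sum>u\<in>?U N. walk_weight c k u v')" by simp
  qed (use p N c in \<open>auto intro!: sum_nonneg mult_nonneg_nonneg walk_weight_nonneg\<close>)
  also have "\<dots> = (\<integral>\<omega>. trace_power N (Z \<omega>) k \<partial>M')"
    unfolding valZ by (rule sum.swap)
  finally show "p * (\<integral>\<omega>. trace_power n (X \<omega>) k \<partial>M) \<le> (\<integral>\<omega>. trace_power N (Z \<omega>) k \<partial>M')" .
qed

section \<open>A lattice net for the operator norm\<close>

definition lattice_ball :: "nat \<Rightarrow> (nat \<Rightarrow> int) set" where
  "lattice_ball N = {z \<in> {..<N} \<rightarrow>\<^sub>E {- (4 * int N)..4 * int N}. (\<Sum>i<N. (z i)\<^sup>2) \<le> 4 * int N}"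

lemma finite_lattice_ball: "finite (lattice_ball N)"
  unfolding lattice_ball_def by (intro finite_Collect_conjI disjI1) (auto intro: finite_PiE)

lemma sum_half_power_abs: "(\<Sum>t\<in>{- int m..int m}. (1 / 2 :: real) ^ nat \<bar>t\<bar>) \<le> 3"
proof -
  have "(\<Sum>t\<in>{- int m..int m}. (1 / 2 :: real) ^ nat \<bar>t\<bar>) = 3 - 2 * (1 / 2) ^ m"
  proof (induction m)
    case (Suc m)
    have "{- int (Suc m)..int (Suc m)} = insert (int (Suc m)) (insert (- int (Suc m)) {- int m..int m})"
      by auto
    then show ?case using Suc by (simp add: nat_add_distrib)
  qed simp
  then show ?thesis by simp
qed

text \<open>
  The weight \<open>(1/2) ^ |t|\<close> has total mass 3 on the integers, and its product is at least \<open>16\<close> to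
  the power \<open>- N\<close> on the ball because \<open>|t| \<le> t\<^sup>2\<close>.
\<close>

lemma card_lattice_ball: "real (card (lattice_ball N)) \<le> 48 ^ N"
proof -
  let ?w = "\<lambda>t :: int. (1 / 2 :: real) ^ nat \<bar>t\<bar>"
  let ?B = "{..<N} \<rightarrow>\<^sub>E {- int (4 * N)..int (4 * N)}"
  have "real (card (lattice_ball N)) * (1 / 16) ^ N = (\<Sum>z\<in>lattice_ball N. (1 / 2) ^ (4 * N))"
    by (simp add: power_mult power_one_over)
  also have "\<dots> \<le> (\<Sum>z\<in>lattice_ball N. \<Prod>i<N. ?w (z i))"
  proof (rule sum_mono)
    fix z assume z: "z \<in> lattice_ball N"
    have "int (nat \<bar>t\<bar>) \<le> t\<^sup>2" for t :: int
      using self_le_power[of "\<bar>t\<bar>" 2] by (cases "t = 0") auto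
    then have "int (\<Sum>i<N. nat \<bar>z i\<bar>) \<le> (\<Sum>i<N. (z i)\<^sup>2)"
      unfolding of_nat_sum by (intro sum_mono)
    also have "\<dots> \<le> int (4 * N)" using z by (simp add: lattice_ball_def)
    finally have "(\<Sum>i<N. nat \<bar>z i\<bar>) \<le> 4 * N" by linarith
    then have "(1 / 2 :: real) ^ (4 * N) \<le> (1 / 2) ^ (\<Sum>i<N. nat \<bar>z i\<bar>)"
      by (rule power_decreasing) simp_all
    then show "(1 / 2) ^ (4 * N) \<le> (\<Prod>i<N. ?w (z i))"
      by (simp only: power_sum)
  qed
  also have "\<dots> \<le> (\<Sum>z\<in>?B. \<Prod>i<N. ?w (z i))"
    by (intro sum_mono2 finite_PiE prod_nonneg) (simp_all add: lattice_ball_def)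
  also have "\<dots> = (\<Prod>i<N. \<Sum>t\<in>{- int (4 * N)..int (4 * N)}. ?w t)"
    by (subst prod_sum_PiE) auto
  also have "\<dots> \<le> (\<Prod>i<N. 3)"
    by (intro prod_mono conjI sum_nonneg sum_half_power_abs) auto
  finally have "real (card (lattice_ball N)) * (1 / 16) ^ N * 16 ^ N \<le> 3 ^ N * 16 ^ N"
    by simp
  then show ?thesis
    by (simp add: power_divide flip: power_mult_distrib)
qed

text \<open>
  Rounding the coordinates of \<open>sqrt N x\<close> up or down according to the signs of \<open>b\<close> can only increase
  the pairing with \<open>b\<close>, and changes every coordinate by at most 1.
\<close>

lemma lattice_rounding:
  fixes x b :: "nat \<Rightarrow> real"
  assumes x: "(\<Sum>i<N. (x i)\<^sup>2) \<le> 1"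
  shows "\<exists>z\<in>lattice_ball N. sqrt (real N) * (\<Sum>i<N. x i * b i) \<le> (\<Sum>i<N. real_of_int (z i) * b i)"
proof -
  \<comment> \<open>The scale \<open>sqrt N\<close> makes the rounding error, at most \<open>N\<close> in squared norm, comparable to \<open>|y|\<^sup>2\<close>.\<close>
  define y where "y i = sqrt (real N) * x i" for i
  define z where "z = (\<lambda>i\<in>{..<N}. if b i \<ge> 0 then \<lceil>y i\<rceil> else \<lfloor>y i\<rfloor>)"
  have "real_of_int (\<Sum>i<N. (z i)\<^sup>2) \<le> (\<Sum>i<N. 2 * (y i)\<^sup>2 + 2)"
    unfolding of_int_sum
  proof (rule sum_mono)
    fix i assume "i \<in> {..<N}"
    then have "\<bar>real_of_int (z i) - y i\<bar> \<le> 1"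
      by (simp add: z_def) linarith
    then have "\<bar>real_of_int (z i)\<bar> \<le> \<bar>y i\<bar> + 1" by linarith
    then have "(real_of_int (z i))\<^sup>2 \<le> (\<bar>y i\<bar> + 1)\<^sup>2"
      by (metis abs_ge_zero power2_abs power_mono)
    also have "\<dots> \<le> 2 * (y i)\<^sup>2 + 2"
      using sum_squares_bound[of "\<bar>y i\<bar>" 1] by (simp add: power2_sum)
    finally show "real_of_int ((z i)\<^sup>2) \<le> 2 * (y i)\<^sup>2 + 2" by simp
  qed
  also have "\<dots> = 2 * real N * (\<Sum>i<N. (x i)\<^sup>2) + 2 * real N"
    by (simp add: y_def power_mult_distrib sum.distrib sum_distrib_left mult.assoc)
  also have "\<dots> \<le> 2 * real N * 1 + 2 * real N"
    using x by (intro add_mono mult_left_mono) auto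
  finally have sq: "(\<Sum>i<N. (z i)\<^sup>2) \<le> 4 * int N"
    by linarith
  have "z i \<in> {- (4 * int N)..4 * int N}" if i: "i \<in> {..<N}" for i
  proof -
    have "\<bar>z i\<bar> \<le> (z i)\<^sup>2"
      using self_le_power[of "\<bar>z i\<bar>" 2] by (cases "z i = 0") auto
    also have "\<dots> \<le> (\<Sum>i<N. (z i)\<^sup>2)"
      using i by (intro member_le_sum) auto
    finally show ?thesis using sq by auto
  qed
  then have "z \<in> lattice_ball N"
    using sq by (auto simp: lattice_ball_def z_def)
  moreover have "sqrt (real N) * (\<Sum>i<N. x i * b i) \<le> (\<Sum>i<N. real_of_int (z i) * b i)"
    unfolding sum_distrib_left
  proof (rule sum_mono)
    fix i assume i: "i \<in> {..<N}"
    show "sqrt (real N) * (x i * b i) \<le> real_of_int (z i) * b i"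
    proof (cases "b i \<ge> 0")
      case True
      with i have "y i * b i \<le> real_of_int (z i) * b i"
        by (intro mult_right_mono) (auto simp: z_def)
      then show ?thesis by (simp add: y_def mult_ac)
    next
      case False
      with i have "y i * b i \<le> real_of_int (z i) * b i"
        by (intro mult_right_mono_neg) (auto simp: z_def)
      then show ?thesis by (simp add: y_def mult_ac)
    qed
  qed
  ultimately show ?thesis by blast
qed

definition bil :: "nat \<Rightarrow> (nat \<times> nat \<Rightarrow> real) \<Rightarrow> (nat \<Rightarrow> real) \<Rightarrow> (nat \<Rightarrow> real) \<Rightarrow> real" where
  "bil N Z x y = (\<Sum>a<N. \<Sum>d<N. x a * Z (a, d) * y d)"

lemma bil_left: "bil N Z x y = (\<Sum>a<N. x a * (\<Sum>d<N. Z (a, d) * y d))"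
  by (simp add: bil_def sum_distrib_left mult_ac)

lemma bil_right: "bil N Z x y = (\<Sum>d<N. y d * (\<Sum>a<N. Z (a, d) * x a))"
  unfolding bil_def by (subst sum.swap) (simp add: sum_distrib_left mult_ac)

text \<open>
  A bilinear form is linear in each argument, so the arguments can be rounded one after the other.
\<close>

lemma bil_lattice_bound:
  assumes x: "(\<Sum>i<N. (x i)\<^sup>2) \<le> 1" and y: "(\<Sum>i<N. (y i)\<^sup>2) \<le> 1"
  shows "\<exists>z\<in>lattice_ball N. \<exists>w\<in>lattice_ball N.
    real N * bil N Z x y \<le> bil N Z (\<lambda>i. real_of_int (z i)) (\<lambda>i. real_of_int (w i))"
proof -
  obtain z where z: "z \<in> lattice_ball N"
    "sqrt (real N) * bil N Z x y \<le> bil N Z (\<lambda>i. real_of_int (z i)) y"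
    using lattice_rounding[OF x, of "\<lambda>a. \<Sum>d<N. Z (a, d) * y d"] by (auto simp: bil_left)
  obtain w where w: "w \<in> lattice_ball N"
    "sqrt (real N) * bil N Z (\<lambda>i. real_of_int (z i)) y \<le> bil N Z (\<lambda>i. real_of_int (z i)) (\<lambda>i. real_of_int (w i))"
    using lattice_rounding[OF y, of "\<lambda>d. \<Sum>a<N. Z (a, d) * real_of_int (z a)"] by (auto simp: bil_right)
  have "real N * bil N Z x y = sqrt (real N) * (sqrt (real N) * bil N Z x y)"
    by (simp add: mult.assoc[symmetric])
  also have "\<dots> \<le> sqrt (real N) * bil N Z (\<lambda>i. real_of_int (z i)) y"
    using z by (intro mult_left_mono) auto
  finally show ?thesis using z w by force
qed

lemma bil_homogeneous:
  assumes D: "\<And>x y. (\<Sum>i<N. (x i)\<^sup>2) \<le> 1 \<Longrightarrow> (\<Sum>i<N. (y i)\<^sup>2) \<le> 1 \<Longrightarrow> bil N Z x y \<le> D"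
  shows "bil N Z x y \<le> D * L2_set x {..<N} * L2_set y {..<N}"
proof (cases "L2_set x {..<N} = 0 \<or> L2_set y {..<N} = 0")
  case True
  then have "bil N Z x y = 0" by (auto simp: L2_set_eq_0_iff bil_def)
  with True show ?thesis by auto
next
  case False
  let ?a = "L2_set x {..<N}" and ?b = "L2_set y {..<N}"
  have pos: "?a > 0" "?b > 0"
    using False L2_set_nonneg[of x "{..<N}"] L2_set_nonneg[of y "{..<N}"] by linarith+
  have unit: "(\<Sum>i<N. (f i / L2_set f {..<N})\<^sup>2) \<le> 1" for f :: "nat \<Rightarrow> real"
    by (simp add: power_divide sum_divide_distrib[symmetric] L2_set_def sum_nonneg divide_le_eq_1 order_less_le)
  have "bil N Z (\<lambda>i. x i / ?a) (\<lambda>i. y i / ?b) \<le> D"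
    by (intro D unit)
  moreover have "bil N Z (\<lambda>i. x i / ?a) (\<lambda>i. y i / ?b) = bil N Z x y / (?a * ?b)"
    by (simp add: bil_def sum_divide_distrib)
  ultimately show ?thesis
    using pos by (simp add: field_simps)
qed

text \<open>
  The bound \<open>D\<close> on the form is a bound on the operator norm, and the trace of \<open>(Z Z\<^sup>T)\<^bsup>2l\<^esup>\<close> is the sum
  of the \<open>N\<close> squared norms \<open>|(Z Z\<^sup>T)\<^sup>l e\<^sub>a|\<^sup>2\<close>.
\<close>

lemma trace_power_le_of_bil:
  assumes D: "\<And>x y. (\<Sum>i<N. (x i)\<^sup>2) \<le> 1 \<Longrightarrow> (\<Sum>i<N. (y i)\<^sup>2) \<le> 1 \<Longrightarrow> bil N Z x y \<le> D"
  shows "trace_power N Z (2 * l) \<le> real N * D ^ (4 * l)"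
proof -
  have D0: "D \<ge> 0" using D[of "\<lambda>_. 0" "\<lambda>_. 0"] by (simp add: bil_def)
  have norm_sq: "L2_set f {..<N} * L2_set f {..<N} = (\<Sum>i<N. f i * f i)" for f :: "nat \<Rightarrow> real"
    by (simp add: L2_set_def sum_nonneg power2_eq_square)
  have cancel: "a \<le> b * c" if "a * a \<le> b * a * c" "0 \<le> a" "0 \<le> b" "0 \<le> c" for a b c :: real
  proof (cases "a = 0")
    case False
    with that have "a * a \<le> (b * c) * a" "0 < a" by (simp_all add: mult_ac)
    then show ?thesis by simp
  qed (use that in simp)
  have Zy: "L2_set (\<lambda>a. \<Sum>d<N. Z (a, d) * y d) {..<N} \<le> D * L2_set y {..<N}" for y
  proof -
    let ?v = "\<lambda>a. \<Sum>d<N. Z (a, d) * y d"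
    have "L2_set ?v {..<N} * L2_set ?v {..<N} = bil N Z ?v y"
      by (simp add: norm_sq bil_left)
    also have "\<dots> \<le> D * L2_set ?v {..<N} * L2_set y {..<N}"
      by (rule bil_homogeneous[OF D])
    finally show ?thesis
      by (rule cancel) (simp_all add: D0)
  qed
  have Zx: "L2_set (\<lambda>d. \<Sum>a<N. Z (a, d) * x a) {..<N} \<le> D * L2_set x {..<N}" for x
  proof -
    let ?v = "\<lambda>d. \<Sum>a<N. Z (a, d) * x a"
    have "L2_set ?v {..<N} * L2_set ?v {..<N} = bil N Z x ?v"
      by (simp add: norm_sq bil_right)
    also have "\<dots> \<le> D * L2_set x {..<N} * L2_set ?v {..<N}"
      by (rule bil_homogeneous[OF D])
    also have "\<dots> = D * L2_set ?v {..<N} * L2_set x {..<N}"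
      by (simp only: mult_ac)
    finally show ?thesis
      by (rule cancel) (simp_all add: D0)
  qed
  have gram: "L2_set (gram N Z f) {..<N} \<le> D\<^sup>2 * L2_set f {..<N}" for f
  proof -
    have "gram N Z f = (\<lambda>a. \<Sum>d<N. Z (a, d) * (\<Sum>b<N. Z (b, d) * f b))"
      unfolding gram_def by (subst sum.swap) (simp add: sum_distrib_left mult_ac)
    then have "L2_set (gram N Z f) {..<N} \<le> D * (D * L2_set f {..<N})"
      using Zy[of "\<lambda>d. \<Sum>b<N. Z (b, d) * f b"] mult_left_mono[OF Zx[of f] D0] by simp
    then show ?thesis by (simp add: power2_eq_square mult_ac)
  qed
  have pow: "L2_set ((gram N Z ^^ l) f) {..<N} \<le> D ^ (2 * l) * L2_set f {..<N}" for f l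
  proof (induction l)
    case (Suc l)
    have "L2_set ((gram N Z ^^ Suc l) f) {..<N} \<le> D\<^sup>2 * L2_set ((gram N Z ^^ l) f) {..<N}"
      using gram[of "(gram N Z ^^ l) f"] by simp
    also have "\<dots> \<le> D\<^sup>2 * (D ^ (2 * l) * L2_set f {..<N})"
      by (intro mult_left_mono Suc.IH) simp
    finally show ?case by (simp add: power2_eq_square mult_ac)
  qed simp
  have "trace_power N Z (2 * l) = (\<Sum>a<N. (L2_set ((gram N Z ^^ l) (\<lambda>b. of_bool (b = a))) {..<N})\<^sup>2)"
    by (simp add: trace_power_double L2_set_def sum_nonneg)
  also have "\<dots> \<le> (\<Sum>a<N. (D ^ (2 * l) * 1)\<^sup>2)"
  proof (intro sum_mono power_mono)
    fix a assume "a \<in> {..<N}"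
    then have "L2_set (\<lambda>b. of_bool (b = a)) {..<N} = 1"
      by (simp add: L2_set_def of_bool_def if_distrib[of "\<lambda>x. x\<^sup>2"] sum.delta cong: if_cong)
    with pow[of l "\<lambda>b. of_bool (b = a)"]
    show "L2_set ((gram N Z ^^ l) (\<lambda>b. of_bool (b = a))) {..<N} \<le> D ^ (2 * l) * 1" by simp
  qed simp
  also have "\<dots> = real N * D ^ (4 * l)"
    by (simp add: power_mult[symmetric] mult_ac)
  finally show ?thesis .
qed

text \<open>
  The even power of a maximum is at most the sum of the even powers. The sum has an
  expectation that can be computed term by term.
\<close>

lemma trace_power_le_lattice_sum:
  assumes N: "N > 0"
  shows "trace_power N Z (2 * l) \<le> real N * ((1 / real N) ^ (4 * l) *
    (\<Sum>z\<in>lattice_ball N. \<Sum>w\<in>lattice_ball N. bil N Z (\<lambda>i. real_of_int (z i)) (\<lambda>i. real_of_int (w i)) ^ (4 * l)))"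
proof -
  let ?b = "\<lambda>(z, w). bil N Z (\<lambda>i. real_of_int (z i)) (\<lambda>i. real_of_int (w i))"
  let ?S = "lattice_ball N \<times> lattice_ball N"
  have fin: "finite ?S" by (simp add: finite_lattice_ball)
  have "(\<lambda>i\<in>{..<N}. 0) \<in> lattice_ball N" by (auto simp: lattice_ball_def)
  then have ne: "?S \<noteq> {}" by auto
  have "\<exists>m\<in>?S. Max (?b ` ?S) = ?b m"
    using Max_in[of "?b ` ?S"] fin ne by (auto simp del: Max_in)
  then obtain m where m: "m \<in> ?S" and Mm: "Max (?b ` ?S) = ?b m" by blast
  have "trace_power N Z (2 * l) \<le> real N * (?b m / real N) ^ (4 * l)"
  proof (rule trace_power_le_of_bil)
    fix x y :: "nat \<Rightarrow> real"
    assume "(\<Sum>i<N. (x i)\<^sup>2) \<le> 1" "(\<Sum>i<N. (y i)\<^sup>2) \<le> 1"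
    then obtain z w where zw: "z \<in> lattice_ball N" "w \<in> lattice_ball N" "real N * bil N Z x y \<le> ?b (z, w)"
      using bil_lattice_bound[where N = N and x = x and y = y and Z = Z] by auto
    have "?b (z, w) \<le> Max (?b ` ?S)"
      using zw fin by (intro Max_ge) auto
    with zw Mm have "real N * bil N Z x y \<le> ?b m" by simp
    then show "bil N Z x y \<le> ?b m / real N"
      using N by (simp add: field_simps)
  qed
  also have "?b m ^ (4 * l) \<le> (\<Sum>s\<in>?S. ?b s ^ (4 * l))"
    using m fin by (intro member_le_sum) (auto simp: zero_le_even_power split: prod.splits)
  then have "real N * (?b m / real N) ^ (4 * l) \<le> real N * ((1 / real N) ^ (4 * l) * (\<Sum>s\<in>?S. ?b s ^ (4 * l)))"
    by (simp add: power_divide divide_right_mono mult_left_mono)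
  finally show ?thesis
    by (simp add: sum.cartesian_product case_prod_unfold)
qed

section \<open>Trace moments of dense matrices with independent entries\<close>

lemma power_le_fact_exp:
  fixes x :: real
  assumes "x \<ge> 0"
  shows "x ^ m \<le> fact m * exp x"
proof -
  have "(\<Sum>n\<in>{m}. x ^ n /\<^sub>R fact n) \<le> (\<Sum>n. x ^ n /\<^sub>R fact n)"
    using assms by (intro sum_le_suminf summable_exp_generic) auto
  then show ?thesis
    by (simp add: exp_def field_simps)
qed

lemma even_power_le_fact_exp:
  fixes s :: real
  shows "s ^ (2 * m) \<le> fact (2 * m) * (exp s + exp (- s))"
proof -
  have "s ^ (2 * m) = \<bar>s\<bar> ^ (2 * m)"
    by (simp add: power_mult)
  also have "\<dots> \<le> fact (2 * m) * exp \<bar>s\<bar>"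
    by (rule power_le_fact_exp) simp
  also have "\<dots> \<le> fact (2 * m) * (exp s + exp (- s))"
    by (intro mult_left_mono) (auto simp: abs_if)
  finally show ?thesis .
qed

definition subgaussian_const :: "real \<Rightarrow> real" where
  "subgaussian_const K = 2 * 48 ^ 6 * (4 / 3) * exp (48 * K)"

text \<open>
  Laws for the entries of the dense comparison matrix. Their moments are nonnegative so that the walk
  sums can be compared term by term.
\<close>

locale subgaussian_law = prob_space Q for Q :: "real measure" +
  fixes K :: real
  assumes id_measurable: "(\<lambda>x. x) \<in> borel_measurable Q"
    and K_nonneg: "0 \<le> K"
    and mgf: "\<And>s. (\<integral>\<^sup>+ x. ennreal (exp (s * x)) \<partial>Q) \<le> ennreal (exp (K * s\<^sup>2))"
    and moment_nonneg: "\<And>m. 0 \<le> (\<integral>x. x ^ m \<partial>Q)"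
begin

lemma integrable_moment: "integrable Q (\<lambda>x. x ^ m)"
proof (rule integrableI_bounded)
  note id_measurable[measurable]
  show "(\<lambda>x. x ^ m) \<in> borel_measurable Q" by measurable
  have "(\<integral>\<^sup>+ x. ennreal (norm (x ^ m)) \<partial>Q)
     \<le> (\<integral>\<^sup>+ x. ennreal (fact m) * (ennreal (exp (1 * x)) + ennreal (exp (- 1 * x))) \<partial>Q)"
  proof (rule nn_integral_mono)
    fix x :: real
    have "norm (x ^ m) \<le> fact m * exp \<bar>x\<bar>"
      using power_le_fact_exp[of "\<bar>x\<bar>" m] by (simp add: power_abs)
    also have "\<dots> \<le> fact m * (exp (1 * x) + exp (- 1 * x))"
      by (intro mult_left_mono) (auto simp: abs_if)
    finally show "ennreal (norm (x ^ m)) \<le> ennreal (fact m) * (ennreal (exp (1 * x)) + ennreal (exp (- 1 * x)))"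
      by (simp add: ennreal_mult'[symmetric] ennreal_plus[symmetric] ennreal_leI del: ennreal_plus)
  qed
  also have "\<dots> = ennreal (fact m) * ((\<integral>\<^sup>+ x. ennreal (exp (1 * x)) \<partial>Q) + (\<integral>\<^sup>+ x. ennreal (exp (- 1 * x)) \<partial>Q))"
    by (subst nn_integral_cmult, measurable) (subst nn_integral_add, auto)
  also have "\<dots> \<le> ennreal (fact m) * (ennreal (exp (K * 1\<^sup>2)) + ennreal (exp (K * (- 1)\<^sup>2)))"
    by (intro mult_left_mono add_mono mgf) simp
  also have "\<dots> < \<infinity>"
    by (simp add: ennreal_mult_less_top)
  finally show "(\<integral>\<^sup>+ x. ennreal (norm (x ^ m)) \<partial>Q) < \<infinity>" .
qed

abbreviation "entries N \<equiv> {..<N} \<times> {..<N} :: (nat \<times> nat) set"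
abbreviation "iid_matrix N \<equiv> \<Pi>\<^sub>M e\<in>entries N. Q"

lemma product_prob: "product_prob_space (\<lambda>_. Q)"
  by unfold_locales

lemma
  shows iid_moment_integrable: "integrable (iid_matrix N) (\<lambda>Z. \<Prod>e\<in>entries N. Z e ^ m e)"
    and iid_moment: "(\<integral>Z. (\<Prod>e\<in>entries N. Z e ^ m e) \<partial>iid_matrix N)
       = (\<Prod>e\<in>{e \<in> entries N. m e > 0}. \<integral>x. x ^ m e \<partial>Q)"
proof -
  interpret P: product_prob_space "\<lambda>_ :: nat \<times> nat. Q" by (rule product_prob)
  show "integrable (iid_matrix N) (\<lambda>Z. \<Prod>e\<in>entries N. Z e ^ m e)"
    by (rule P.product_integrable_prod) (auto intro: integrable_moment)
  have "(\<integral>Z. (\<Prod>e\<in>entries N. Z e ^ m e) \<partial>iid_matrix N) = (\<Prod>e\<in>entries N. \<integral>x. x ^ m e \<partial>Q)"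
    by (rule P.product_integral_prod) (auto intro: integrable_moment)
  also have "\<dots> = (\<Prod>e\<in>{e \<in> entries N. m e > 0}. \<integral>x. x ^ m e \<partial>Q)"
    by (rule prod.mono_neutral_right) (auto simp: prob_space)
  finally show "(\<integral>Z. (\<Prod>e\<in>entries N. Z e ^ m e) \<partial>iid_matrix N)
       = (\<Prod>e\<in>{e \<in> entries N. m e > 0}. \<integral>x. x ^ m e \<partial>Q)" .
qed

text \<open>
  The form is a linear combination of independent entries, so the moment generating functions multiply.
\<close>

lemma iid_mgf:
  "(\<integral>\<^sup>+ Z. ennreal (exp (s * bil N Z x y)) \<partial>iid_matrix N)
    \<le> ennreal (exp (K * s\<^sup>2 * (\<Sum>a<N. (x a)\<^sup>2) * (\<Sum>d<N. (y d)\<^sup>2)))"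
proof -
  interpret P: product_prob_space "\<lambda>_ :: nat \<times> nat. Q" by (rule product_prob)
  note id_measurable[measurable]
  let ?c = "\<lambda>e. s * (x (fst e) * y (snd e))"
  have "s * bil N Z x y = (\<Sum>e\<in>entries N. ?c e * Z e)" for Z
    by (simp add: bil_def sum.cartesian_product sum_distrib_left case_prod_unfold mult_ac)
  then have "(\<integral>\<^sup>+ Z. ennreal (exp (s * bil N Z x y)) \<partial>iid_matrix N)
     = (\<integral>\<^sup>+ Z. (\<Prod>e\<in>entries N. ennreal (exp (?c e * Z e))) \<partial>iid_matrix N)"
    by (simp add: exp_sum prod_ennreal)
  also have "\<dots> = (\<Prod>e\<in>entries N. \<integral>\<^sup>+ t. ennreal (exp (?c e * t)) \<partial>Q)"
    by (rule P.product_nn_integral_prod) auto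
  also have "\<dots> \<le> (\<Prod>e\<in>entries N. ennreal (exp (K * (?c e)\<^sup>2)))"
    by (intro prod_mono_ennreal mgf)
  also have "\<dots> = ennreal (exp (\<Sum>e\<in>entries N. K * (?c e)\<^sup>2))"
    by (simp add: exp_sum prod_ennreal)
  also have "(\<Sum>e\<in>entries N. K * (?c e)\<^sup>2) = K * s\<^sup>2 * (\<Sum>a<N. (x a)\<^sup>2) * (\<Sum>d<N. (y d)\<^sup>2)"
    by (simp add: sum.cartesian_product' sum_product sum_distrib_left power_mult_distrib mult_ac)
  finally show ?thesis .
qed

lemma bil_measurable [measurable]: "(\<lambda>Z. bil N Z x y) \<in> borel_measurable (iid_matrix N)"
proof -
  note id_measurable[measurable]
  have [measurable]: "(\<lambda>Z. Z e) \<in> borel_measurable (iid_matrix N)" if "e \<in> entries N" for e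
    using measurable_compose[OF measurable_component_singleton[OF that] id_measurable] .
  show ?thesis unfolding bil_def
    by (intro borel_measurable_sum borel_measurable_times) auto
qed

lemma
  assumes N: "N > 0" and x: "(\<Sum>a<N. (x a)\<^sup>2) \<le> 4 * real N" and y: "(\<Sum>d<N. (y d)\<^sup>2) \<le> 4 * real N"
  shows bil_moment_integrable: "integrable (iid_matrix N) (\<lambda>Z. bil N Z x y ^ (2 * k))"
    and bil_moment_le: "(\<integral>Z. bil N Z x y ^ (2 * k) \<partial>iid_matrix N)
      \<le> fact (2 * k) * real N ^ k * (2 * exp (16 * K * real N))"
proof -
  \<comment> \<open>At this scale the exponent \<open>K s\<^sup>2 (4 N)\<^sup>2\<close> is of order \<open>N\<close>, like the logarithm of the net size.\<close>
  define s where "s = 1 / sqrt (real N)"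
  have s: "s > 0" "s\<^sup>2 = 1 / real N" using N by (auto simp: s_def power_divide)
  let ?B = "fact (2 * k) * real N ^ k * (2 * exp (16 * K * real N))"
  have mg: "(\<integral>\<^sup>+ Z. ennreal (exp (t * bil N Z x y)) \<partial>iid_matrix N) \<le> ennreal (exp (16 * K * real N))"
    if "t\<^sup>2 = 1 / real N" for t
  proof -
    have "K * t\<^sup>2 * (\<Sum>a<N. (x a)\<^sup>2) * (\<Sum>d<N. (y d)\<^sup>2) \<le> K * t\<^sup>2 * (4 * real N) * (4 * real N)"
      using x y K_nonneg by (intro mult_mono mult_left_mono) (auto intro: sum_nonneg)
    also have "\<dots> = 16 * K * real N" using N that by simp
    finally show ?thesis
      using iid_mgf[where s = t and N = N and x = x and y = y] by (elim order_trans) (auto intro: ennreal_leI)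
  qed
  have "(\<integral>\<^sup>+ Z. ennreal (bil N Z x y ^ (2 * k)) \<partial>iid_matrix N)
    \<le> (\<integral>\<^sup>+ Z. ennreal (fact (2 * k) * real N ^ k) *
        (ennreal (exp (s * bil N Z x y)) + ennreal (exp (- s * bil N Z x y))) \<partial>iid_matrix N)"
  proof (rule nn_integral_mono)
    fix Z
    have "(s * bil N Z x y) ^ (2 * k) \<le> fact (2 * k) * (exp (s * bil N Z x y) + exp (- (s * bil N Z x y)))"
      by (rule even_power_le_fact_exp)
    also have "(s * bil N Z x y) ^ (2 * k) = bil N Z x y ^ (2 * k) / real N ^ k"
      by (simp add: power_mult_distrib power_mult s power_divide)
    finally have "bil N Z x y ^ (2 * k)
       \<le> fact (2 * k) * real N ^ k * (exp (s * bil N Z x y) + exp (- s * bil N Z x y))"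
      using N by (simp add: field_simps)
    then show "ennreal (bil N Z x y ^ (2 * k)) \<le> ennreal (fact (2 * k) * real N ^ k) *
        (ennreal (exp (s * bil N Z x y)) + ennreal (exp (- s * bil N Z x y)))"
      by (simp add: ennreal_mult'[symmetric] ennreal_plus[symmetric] ennreal_leI del: ennreal_plus)
  qed
  also have "\<dots> = ennreal (fact (2 * k) * real N ^ k) *
     ((\<integral>\<^sup>+ Z. ennreal (exp (s * bil N Z x y)) \<partial>iid_matrix N)
      + (\<integral>\<^sup>+ Z. ennreal (exp (- s * bil N Z x y)) \<partial>iid_matrix N))"
    by (subst nn_integral_cmult, measurable) (subst nn_integral_add, auto)
  also have "\<dots> \<le> ennreal (fact (2 * k) * real N ^ k) *
     (ennreal (exp (16 * K * real N)) + ennreal (exp (16 * K * real N)))"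
    using s by (intro mult_left_mono add_mono mg) auto
  also have "\<dots> = ennreal ?B"
    by (simp add: ennreal_mult'[symmetric] ennreal_plus[symmetric] del: ennreal_plus)
  finally have le: "(\<integral>\<^sup>+ Z. ennreal (bil N Z x y ^ (2 * k)) \<partial>iid_matrix N) \<le> ennreal ?B" .
  show int: "integrable (iid_matrix N) (\<lambda>Z. bil N Z x y ^ (2 * k))"
  proof (rule integrableI_nonneg)
    show "(\<integral>\<^sup>+ Z. ennreal (bil N Z x y ^ (2 * k)) \<partial>iid_matrix N) < \<infinity>"
      using le by (rule order.strict_trans1) simp
  qed (auto simp: zero_le_even_power)
  have "ennreal (\<integral>Z. bil N Z x y ^ (2 * k) \<partial>iid_matrix N) \<le> ennreal ?B"
    using le by (subst nn_integral_eq_integral[symmetric]) (auto simp: int zero_le_even_power)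
  then show "(\<integral>Z. bil N Z x y ^ (2 * k) \<partial>iid_matrix N) \<le> ?B"
    by (simp add: ennreal_le_iff)
qed

text \<open>
  With \<open>N = 3 k\<close> all factors are exponential in \<open>k\<close> up to \<open>k\<^sup>k\<close>: the net has at most \<open>48\<^sup>N\<close>
  elements, the moment generating function at scale \<open>1 / sqrt N\<close> is \<open>exp (16 K N)\<close>, and the factorial
  together with the normalisation is at most \<open>(2 k)\<^bsup>2k\<^esup> / N\<^sup>k = (4 k / 3)\<^sup>k\<close>.
\<close>

lemma iid_trace_power_le:
  assumes k: "k = 2 * l" "l > 0"
    and int: "integrable (iid_matrix (3 * k)) (\<lambda>Z. trace_power (3 * k) Z k)"
  shows "(\<integral>Z. trace_power (3 * k) Z k \<partial>iid_matrix (3 * k)) \<le> 3 * real k * (subgaussian_const K * real k) ^ k"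
proof -
  define N where "N = 3 * k"
  have N: "N > 0" using k by (simp add: N_def)
  let ?L = "lattice_ball N"
  let ?b = "\<lambda>Z z w. bil N Z (\<lambda>i. real_of_int (z i)) (\<lambda>i. real_of_int (w i)) ^ (2 * k)"
  let ?B = "fact (2 * k) * real N ^ k * (2 * exp (16 * K * real N))"
  have ball: "(\<Sum>i<N. (real_of_int (z i))\<^sup>2) \<le> 4 * real N" if "z \<in> ?L" for z
  proof -
    have "real_of_int (\<Sum>i<N. (z i)\<^sup>2) \<le> real_of_int (4 * int N)"
      using that by (subst of_int_le_iff) (simp add: lattice_ball_def)
    then show ?thesis by simp
  qed
  have bint: "integrable (iid_matrix N) (\<lambda>Z. ?b Z z w)" if "z \<in> ?L" "w \<in> ?L" for z w
    using that by (intro bil_moment_integrable N ball)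
  have "(\<integral>Z. trace_power N Z k \<partial>iid_matrix N)
     \<le> (\<integral>Z. real N * ((1 / real N) ^ (2 * k) * (\<Sum>z\<in>?L. \<Sum>w\<in>?L. ?b Z z w)) \<partial>iid_matrix N)"
  proof (rule integral_mono)
    show "integrable (iid_matrix N) (\<lambda>Z. trace_power N Z k)" using int by (simp add: N_def)
    show "integrable (iid_matrix N) (\<lambda>Z. real N * ((1 / real N) ^ (2 * k) * (\<Sum>z\<in>?L. \<Sum>w\<in>?L. ?b Z z w)))"
      by (intro integrable_mult_right Bochner_Integration.integrable_sum bint)
    show "trace_power N Z k \<le> real N * ((1 / real N) ^ (2 * k) * (\<Sum>z\<in>?L. \<Sum>w\<in>?L. ?b Z z w))" for Z
      using trace_power_le_lattice_sum[OF N, of Z l] k by (simp add: mult.assoc[symmetric])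
  qed
  also have "\<dots> = real N * ((1 / real N) ^ (2 * k) * (\<Sum>z\<in>?L. \<Sum>w\<in>?L. \<integral>Z. ?b Z z w \<partial>iid_matrix N))"
    by (simp add: Bochner_Integration.integral_sum Bochner_Integration.integrable_sum bint)
  also have "\<dots> \<le> real N * ((1 / real N) ^ (2 * k) * (\<Sum>z\<in>?L. \<Sum>w\<in>?L. ?B))"
    by (intro mult_left_mono sum_mono bil_moment_le N ball) auto
  also have "\<dots> = real N * ((1 / real N) ^ (2 * k) * ((real (card ?L))\<^sup>2 * ?B))"
    by (simp add: power2_eq_square)
  also have "\<dots> \<le> real N * ((1 / real N) ^ (2 * k) * ((48 ^ N)\<^sup>2 * (real (2 * k) ^ (2 * k) * real N ^ k * (2 ^ k * exp (16 * K * real N)))))"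
  proof (intro mult_left_mono mult_mono power_mono card_lattice_ball)
    show "fact (2 * k) \<le> real (2 * k) ^ (2 * k)"
      using fact_le_power[of "2 * k", where 'a = real] by simp
    show "(2 :: real) \<le> 2 ^ k" using k self_le_power[of "2 :: real" k] by simp
  qed auto
  also have "\<dots> = 3 * real k * (subgaussian_const K * real k) ^ k"
  proof -
    have "(48 :: real) ^ N = (48 ^ 3) ^ k" by (simp add: N_def power_mult)
    then have a: "((48 :: real) ^ N)\<^sup>2 = (48 ^ 6) ^ k"
      by (simp add: power2_eq_square flip: power_mult_distrib)
    have b: "exp (16 * K * real N) = exp (48 * K) ^ k"
      by (simp add: N_def exp_of_nat_mult[symmetric] mult_ac)
    have c: "(1 / real N) ^ (2 * k) * real N ^ k = (1 / real N) ^ k"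
      using N by (simp add: mult_2 power_add power_one_over)
    have d: "(1 / real N) ^ k * real (2 * k) ^ (2 * k) = (4 / 3 * real k) ^ k"
    proof -
      have "(1 / real N) ^ k * real (2 * k) ^ (2 * k) = (1 / real N * (real (2 * k))\<^sup>2) ^ k"
        by (simp add: power_mult_distrib power_mult power_divide)
      also have "1 / real N * (real (2 * k))\<^sup>2 = 4 / 3 * real k"
        using N by (simp add: N_def power2_eq_square)
      finally show ?thesis .
    qed
    have "(1 / real N) ^ (2 * k) * ((48 ^ N)\<^sup>2 * (real (2 * k) ^ (2 * k) * real N ^ k * (2 ^ k * exp (16 * K * real N))))
      = ((1 / real N) ^ (2 * k) * real N ^ k) * real (2 * k) ^ (2 * k) * ((48 ^ N)\<^sup>2 * (2 ^ k * exp (16 * K * real N)))"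
      by (simp only: mult_ac)
    also have "\<dots> = (4 / 3 * real k) ^ k * ((48 ^ 6) ^ k * (2 ^ k * exp (48 * K) ^ k))"
      unfolding a b c d ..
    also have "\<dots> = (subgaussian_const K * real k) ^ k"
      unfolding subgaussian_const_def power_mult_distrib by (simp only: mult_ac)
    finally show ?thesis by (simp add: N_def)
  qed
  finally show ?thesis by (simp add: N_def)
qed

text \<open>
  Markov's inequality. For a power of two \<open>k\<close> of order \<open>n p\<close>, the complementary event says that the operator norm
  is \<open>O(sqrt (n p))\<close>.
\<close>

theorem trace_power_tail:
  fixes X :: "'w \<Rightarrow> nat \<times> nat \<Rightarrow> real"
  assumes M: "prob_space M"
    and X_int: "\<And>m :: nat \<times> nat \<Rightarrow> nat. integrable M (\<lambda>\<omega>. \<Prod>e\<in>entries n. X \<omega> e ^ m e)"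
    and X_mom: "\<And>m :: nat \<times> nat \<Rightarrow> nat. \<bar>\<integral>\<omega>. (\<Prod>e\<in>entries n. X \<omega> e ^ m e) \<partial>M\<bar>
        \<le> (\<Prod>e\<in>{e \<in> entries n. m e > 0}. p * (\<integral>x. x ^ m e \<partial>Q))"
    and p: "0 < p" "p \<le> 1" and k: "k = 2 * l" "l > 0" "p * real n \<le> real k"
  shows "measure M {\<omega> \<in> space M. trace_power n (X \<omega>) k \<ge> (exp 1 * subgaussian_const K * real k) ^ k}
     \<le> 3 * real k / p * exp (- real k)"
    and "(\<lambda>\<omega>. trace_power n (X \<omega>) k) \<in> borel_measurable M"
proof -
  interpret M: prob_space M by fact
  have N: "p * real n \<le> real (3 * k) - real (Suc k)" "Suc k < 3 * k" using k by auto
  note tr = expected_trace_power_le[OF X_int X_mom iid_moment_integrable iid_moment _ p(2) moment_nonneg N]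
  have int: "integrable M (\<lambda>\<omega>. trace_power n (X \<omega>) k)"
    using p by (intro tr(1)) auto
  then show "(\<lambda>\<omega>. trace_power n (X \<omega>) k) \<in> borel_measurable M" by simp
  define C where "C = subgaussian_const K * real k"
  have C: "C > 0" using k by (simp add: C_def subgaussian_const_def)
  have "p * (\<integral>\<omega>. trace_power n (X \<omega>) k \<partial>M) \<le> (\<integral>Z. trace_power (3 * k) Z k \<partial>iid_matrix (3 * k))"
    using p by (intro tr(3)) auto
  also have "\<dots> \<le> 3 * real k * C ^ k"
    using p unfolding C_def by (intro iid_trace_power_le[OF k(1,2)] tr(2)) auto
  finally have E: "(\<integral>\<omega>. trace_power n (X \<omega>) k \<partial>M) \<le> 3 * real k * C ^ k / p"
    using p by (simp add: field_simps)
  have "measure M {\<omega> \<in> space M. trace_power n (X \<omega>) k \<ge> (exp 1 * C) ^ k}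
     \<le> (\<integral>\<omega>. trace_power n (X \<omega>) k \<partial>M) / (exp 1 * C) ^ k"
  proof (rule integral_Markov_inequality_measure[OF int])
    show "AE \<omega> in M. 0 \<le> trace_power n (X \<omega>) k"
      unfolding k(1) trace_power_double by (auto intro!: sum_nonneg)
  qed (use C in auto)
  also have "\<dots> \<le> (3 * real k * C ^ k / p) / (exp 1 * C) ^ k"
    using C by (intro divide_right_mono E) auto
  also have "\<dots> = 3 * real k / p * exp (- real k)"
    using C by (simp add: power_mult_distrib exp_minus exp_of_nat_mult[symmetric] divide_inverse)
  finally show "measure M {\<omega> \<in> space M. trace_power n (X \<omega>) k \<ge> (exp 1 * subgaussian_const K * real k) ^ k}
     \<le> 3 * real k / p * exp (- real k)"
    by (simp add: C_def mult.assoc)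
qed

end

section \<open>The laws of the entries\<close>

abbreviation "half_normal \<equiv> density lborel (\<lambda>x. ennreal (normal_density 0 (sqrt (1 / 2)) x))"

lemma prob_space_half_normal: "prob_space half_normal"
  by (rule prob_space_normal_density) simp

lemma half_normal_mgf: "(\<integral>\<^sup>+ x. ennreal (exp (s * x)) \<partial>half_normal) = ennreal (exp (s\<^sup>2 / 4))"
proof -
  \<comment> \<open>Completing the square: the exponential tilt of a normal density is a shifted normal density.\<close>
  have shift: "normal_density 0 (sqrt (1 / 2)) x * exp (s * x) = exp (s\<^sup>2 / 4) * normal_density (s / 2) (sqrt (1 / 2)) x" for x
    by (simp add: normal_density_def exp_add[symmetric] field_simps power2_eq_square)
  interpret S: prob_space "density lborel (\<lambda>x. ennreal (normal_density (s / 2) (sqrt (1 / 2)) x))"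
    by (rule prob_space_normal_density) simp
  have one: "(\<integral>\<^sup>+ x. ennreal (normal_density (s / 2) (sqrt (1 / 2)) x) \<partial>lborel) = 1"
    using S.emeasure_space_1 by (simp add: emeasure_density)
  have "(\<integral>\<^sup>+ x. ennreal (exp (s * x)) \<partial>half_normal)
      = (\<integral>\<^sup>+ x. ennreal (exp (s\<^sup>2 / 4)) * ennreal (normal_density (s / 2) (sqrt (1 / 2)) x) \<partial>lborel)"
    by (subst nn_integral_density) (auto simp: ennreal_mult'[symmetric] shift)
  also have "\<dots> = ennreal (exp (s\<^sup>2 / 4))"
    by (subst nn_integral_cmult) (simp_all add: one)
  finally show ?thesis .
qed

lemma
  shows distr_Re: "distr std_complex_gaussian borel Re = half_normal"
    and distr_Im: "distr std_complex_gaussian borel Im = half_normal"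
    and complex_gaussian_mgf:
      "(\<integral>\<^sup>+ w. ennreal (exp (Re (c * w))) \<partial>std_complex_gaussian) = ennreal (exp ((cmod c)\<^sup>2 / 4))"
proof -
  define N where "N = half_normal"
  interpret N: prob_space N unfolding N_def by (rule prob_space_half_normal)
  have sets_N [measurable_cong]: "sets N = sets borel" by (simp add: N_def)
  have [measurable]: "(\<lambda>(x, y). Complex x y) \<in> N \<Otimes>\<^sub>M N \<rightarrow>\<^sub>M borel"
  proof -
    have "(\<lambda>(x::real, y::real). Complex x y) \<in> borel \<Otimes>\<^sub>M borel \<rightarrow>\<^sub>M borel"
      unfolding borel_prod case_prod_beta Complex_eq
      by (intro borel_measurable_continuous_onI continuous_intros)
    then show ?thesis by (simp add: sets_N cong: measurable_cong_sets sets_pair_measure_cong)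
  qed
  have G: "std_complex_gaussian = distr (N \<Otimes>\<^sub>M N) borel (\<lambda>(x, y). Complex x y)"
    by (simp add: std_complex_gaussian_def N_def Let_def)
  have fstN: "distr (N \<Otimes>\<^sub>M N) borel fst = N"
    using N.distr_pair_fst[of N] by (simp add: sets_N cong: distr_cong)
  have sndN: "distr (N \<Otimes>\<^sub>M N) borel snd = N"
  proof (rule measure_eqI)
    fix A assume "A \<in> sets (distr (N \<Otimes>\<^sub>M N) borel snd)"
    then have A: "A \<in> sets borel" by simp
    then have "emeasure (distr (N \<Otimes>\<^sub>M N) borel snd) A = emeasure (N \<Otimes>\<^sub>M N) (space N \<times> A)"
      by (subst emeasure_distr) (auto simp: space_pair_measure N_def intro!: arg_cong2[where f = emeasure])
    also have "\<dots> = emeasure N A"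
      using A by (subst N.emeasure_pair_measure_Times) (auto simp: N.emeasure_space_1 sets.top)
    finally show "emeasure (distr (N \<Otimes>\<^sub>M N) borel snd) A = emeasure N A" .
  qed (simp add: sets_N)
  have "distr std_complex_gaussian borel Re = distr (N \<Otimes>\<^sub>M N) borel fst"
    unfolding G by (subst distr_distr) (auto simp: o_def case_prod_unfold intro!: distr_cong)
  then show "distr std_complex_gaussian borel Re = half_normal"
    using fstN by (simp add: N_def)
  have "distr std_complex_gaussian borel Im = distr (N \<Otimes>\<^sub>M N) borel snd"
    unfolding G by (subst distr_distr) (auto simp: o_def case_prod_unfold intro!: distr_cong)
  then show "distr std_complex_gaussian borel Im = half_normal"
    using sndN by (simp add: N_def)
  have "(\<integral>\<^sup>+ w. ennreal (exp (Re (c * w))) \<partial>std_complex_gaussian)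
     = (\<integral>\<^sup>+ xy. ennreal (exp (Re c * fst xy)) * ennreal (exp (- Im c * snd xy)) \<partial>(N \<Otimes>\<^sub>M N))"
    unfolding G by (subst nn_integral_distr)
      (auto simp: case_prod_unfold ennreal_mult'[symmetric] exp_add[symmetric] intro!: nn_integral_cong)
  also have "\<dots> = (\<integral>\<^sup>+ x. \<integral>\<^sup>+ y. ennreal (exp (Re c * x)) * ennreal (exp (- Im c * y)) \<partial>N \<partial>N)"
    by (subst N.nn_integral_fst[symmetric]) auto
  also have "\<dots> = ennreal (exp ((Re c)\<^sup>2 / 4)) * ennreal (exp ((Im c)\<^sup>2 / 4))"
    using half_normal_mgf[of "Re c"] half_normal_mgf[of "- Im c"]
    by (simp add: nn_integral_cmult nn_integral_multc flip: N_def)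
  also have "\<dots> = ennreal (exp ((cmod c)\<^sup>2 / 4))"
    by (simp add: ennreal_mult'[symmetric] exp_add[symmetric] cmod_power2 add_divide_distrib)
  finally show "(\<integral>\<^sup>+ w. ennreal (exp (Re (c * w))) \<partial>std_complex_gaussian) = ennreal (exp ((cmod c)\<^sup>2 / 4))" .
qed

lemma sets_std_complex_gaussian [measurable_cong, simp]: "sets std_complex_gaussian = sets borel"
  by (simp add: std_complex_gaussian_def Let_def)

lemma space_std_complex_gaussian [simp]: "space std_complex_gaussian = UNIV"
  by (simp add: std_complex_gaussian_def Let_def)

lemma half_normal_odd_moment: "odd m \<Longrightarrow> (\<integral>x. x ^ m \<partial>half_normal) = 0"
proof -
  assume "odd m"
  then obtain k where m: "m = 2 * k + 1" by (auto elim: oddE)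
  have "(\<integral>x. x ^ m \<partial>half_normal) = (\<integral>x. normal_density 0 (sqrt (1 / 2)) x * x ^ m \<partial>lborel)"
    by (subst integral_density) auto
  also have "\<dots> = 0"
    using integral_normal_moment_odd[of "sqrt (1 / 2)" 0 k] by (simp add: m)
  finally show ?thesis .
qed

lemma subgaussian_half_normal: "subgaussian_law half_normal (1 / 4)"
proof -
  interpret prob_space half_normal by (rule prob_space_half_normal)
  show ?thesis
  proof
    show "(\<lambda>x. x) \<in> borel_measurable half_normal" by simp
    show "(\<integral>\<^sup>+ x. ennreal (exp (s * x)) \<partial>half_normal) \<le> ennreal (exp (1 / 4 * s\<^sup>2))" for s
      by (simp add: half_normal_mgf)
    show "0 \<le> (\<integral>x. x ^ m \<partial>half_normal)" for m
      by (cases "even m") (auto simp: half_normal_odd_moment zero_le_even_power intro: integral_nonneg_AE)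
  qed simp
qed

lemma exp_le_quadratic:
  fixes x :: real
  assumes "- 1 \<le> x" "x \<le> 1"
  shows "exp x \<le> 1 + x + x\<^sup>2"
proof (cases "x \<ge> 0")
  case True
  then show ?thesis using assms exp_bound[of x] by simp
next
  case False
  define y where "y = - x"
  have y: "0 \<le> y" "y \<le> 1" using False assms by (auto simp: y_def)
  have "1 \<le> (1 - y + y\<^sup>2) * (1 + y)"
    using y by (simp add: power2_eq_square algebra_simps)
  also have "\<dots> \<le> (1 - y + y\<^sup>2) * exp y"
    using y exp_ge_add_one_self[of y] by (intro mult_left_mono) (auto simp: add_nonneg_nonneg)
  finally have "exp (- y) \<le> 1 - y + y\<^sup>2"
    by (simp add: exp_minus field_simps)
  then show ?thesis by (simp add: y_def)
qed

text \<open>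
  The linear term disappears when this is averaged over a centred law.
\<close>

lemma exp_le_add_exp_square: "exp x \<le> x + exp (x\<^sup>2)" for x :: real
proof -
  consider "x \<le> - 1" | "- 1 \<le> x" "x \<le> 1" | "1 \<le> x" by linarith
  then show ?thesis
  proof cases
    case 1
    have "exp x \<le> 1" using 1 by simp
    also have "1 \<le> x + (1 + x\<^sup>2)"
      using 1 mult_nonneg_nonneg[of "- x" "- x - 1"] by (simp add: power2_eq_square algebra_simps)
    also have "\<dots> \<le> x + exp (x\<^sup>2)" using exp_ge_add_one_self[of "x\<^sup>2"] by linarith
    finally show ?thesis .
  next
    case 2
    have "exp x \<le> 1 + x + x\<^sup>2"
      by (rule exp_le_quadratic) (use 2 in simp_all)
    also have "\<dots> \<le> x + exp (x\<^sup>2)" using exp_ge_add_one_self[of "x\<^sup>2"] by linarith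
    finally show ?thesis .
  next
    case 3
    have "x * 1 \<le> x * x" using 3 by (intro mult_left_mono) auto
    then have "exp x \<le> exp (x\<^sup>2)" by (simp add: power2_eq_square)
    then show ?thesis using 3 by linarith
  qed
qed

text \<open>
  A bounded centred law all of whose moments from the second on are at least 1. Hence \<open>p\<close> times these
  moments dominate the moments of a centred Bernoulli variable, the odd ones included.
\<close>

definition skew_coin :: "real pmf" where
  "skew_coin = map_pmf (\<lambda>b. if b then 2 else - 1) (bernoulli_pmf (1 / 3))"

lemma skew_coin_integral: "(\<integral>x. f x \<partial>measure_pmf skew_coin) = (f 2 + 2 * f (- 1)) / 3"
  for f :: "real \<Rightarrow> real"
  by (simp add: skew_coin_def)

lemma skew_coin_nn_integral:
  assumes "\<And>x. f x \<ge> 0"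
  shows "(\<integral>\<^sup>+ x. ennreal (f x) \<partial>measure_pmf skew_coin) = ennreal ((f 2 + 2 * f (- 1)) / 3)"
proof -
  have "finite (set_pmf skew_coin)" by (simp add: skew_coin_def)
  then have "integrable (measure_pmf skew_coin) f" by (rule integrable_measure_pmf_finite)
  then show ?thesis
    using assms by (subst nn_integral_eq_integral) (auto simp: skew_coin_integral)
qed

lemma skew_coin_moment:
  "(\<integral>x. x ^ m \<partial>measure_pmf skew_coin) = (2 ^ m + 2 * (- 1) ^ m) / 3"
  by (simp add: skew_coin_integral)

lemma skew_coin_moment_ge_1: "m \<ge> 2 \<Longrightarrow> 1 \<le> (\<integral>x. x ^ m \<partial>measure_pmf skew_coin)"
proof (cases "m = 2")
  case False
  assume "m \<ge> 2"
  with False have "(2 :: real) ^ 3 \<le> 2 ^ m" by (intro power_increasing) auto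
  moreover have "(- 1 :: real) ^ m \<ge> - 1" by (cases "even m") auto
  ultimately show ?thesis by (simp add: skew_coin_moment)
qed (simp add: skew_coin_moment)

lemma subgaussian_skew_coin: "subgaussian_law (measure_pmf skew_coin) 4"
proof
  fix s :: real
  have "exp (s\<^sup>2) \<le> exp (4 * s\<^sup>2)" by simp
  then have "(exp (s * 2) + 2 * exp (s * (- 1))) / 3 \<le> exp (4 * s\<^sup>2)"
    using exp_le_add_exp_square[of "s * 2"] exp_le_add_exp_square[of "- s"]
    by (simp add: power_mult_distrib mult.commute del: exp_le_cancel_iff)
  then show "(\<integral>\<^sup>+ x. ennreal (exp (s * x)) \<partial>measure_pmf skew_coin) \<le> ennreal (exp (4 * s\<^sup>2))"
    by (subst skew_coin_nn_integral) (auto intro: ennreal_leI)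
next
  fix m :: nat
  consider "m = 0" | "m = 1" | "m \<ge> 2" by linarith
  then show "0 \<le> (\<integral>x. x ^ m \<partial>measure_pmf skew_coin)"
    using skew_coin_moment_ge_1[of m] by cases (simp_all add: skew_coin_integral)
qed auto

section \<open>Operator norms of the random graph and of the masked noise\<close>

abbreviation "graph_space n p \<equiv> \<Pi>\<^sub>M e\<in>pairs n. measure_pmf (bernoulli_pmf p)"
abbreviation "noise_space n \<equiv> \<Pi>\<^sub>M e\<in>pairs n. std_complex_gaussian"

lemma pairs_subset: "pairs n \<subseteq> {..<n} \<times> {..<n}"
  by (auto simp: pairs_def)

lemma finite_pairs [simp]: "finite (pairs n)"
  by (rule finite_subset[OF pairs_subset]) simp

lemma product_prob_bernoulli: "product_prob_space (\<lambda>_. measure_pmf (bernoulli_pmf p))"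
  by (intro product_prob_spaceI prob_space_measure_pmf)

lemma product_prob_gaussian: "product_prob_space (\<lambda>_. std_complex_gaussian)"
  by (intro product_prob_spaceI prob_space_std_complex_gaussian)

lemma prob_space_graph: "prob_space (graph_space n p)"
  by (intro prob_space_PiM prob_space_measure_pmf)

lemma prob_space_noise: "prob_space (noise_space n)"
  by (intro prob_space_PiM prob_space_std_complex_gaussian)

lemma
  fixes f :: "'a \<Rightarrow> real" and g :: "'b \<Rightarrow> real"
  assumes P: "prob_space M" "prob_space N" and f: "integrable M f" and g: "integrable N g"
  shows integrable_pair_mult: "integrable (M \<Otimes>\<^sub>M N) (\<lambda>z. f (fst z) * g (snd z))"
    and integral_pair_mult: "(\<integral>z. f (fst z) * g (snd z) \<partial>(M \<Otimes>\<^sub>M N)) = (\<integral>x. f x \<partial>M) * (\<integral>y. g y \<partial>N)"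
proof -
  interpret M: prob_space M by fact
  interpret N: prob_space N by fact
  interpret P: pair_sigma_finite M N ..
  note [measurable] = borel_measurable_integrable[OF f] borel_measurable_integrable[OF g]
  show int: "integrable (M \<Otimes>\<^sub>M N) (\<lambda>z. f (fst z) * g (snd z))"
  proof (rule P.Fubini_integrable)
    show "integrable M (\<lambda>x. \<integral>y. norm (f (fst (x, y)) * g (snd (x, y))) \<partial>N)"
      using f g by (simp add: abs_mult)
    show "AE x in M. integrable N (\<lambda>y. f (fst (x, y)) * g (snd (x, y)))"
      using g by simp
  qed measurable
  show "(\<integral>z. f (fst z) * g (snd z) \<partial>(M \<Otimes>\<^sub>M N)) = (\<integral>x. f x \<partial>M) * (\<integral>y. g y \<partial>N)"
    using P.integral_fst'[OF int] g by simp
qed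

text \<open>
  The graph and the noise are independent, and both have independent coordinates, so the moments of
  the matrix with entries \<open>\<phi> (A\<^sub>e) \<psi> (W\<^sub>e)\<close> factorise over the edges. The matrix is strictly upper
  triangular, which makes its entries independent; the Hermitian matrices of interest are sums of
  such matrices and their transposes.
\<close>

theorem sync_trace_power_tail:
  fixes \<phi> :: "bool \<Rightarrow> real" and \<psi> :: "complex \<Rightarrow> real"
  assumes Q: "subgaussian_law Q K"
    and \<psi>: "\<And>m. integrable std_complex_gaussian (\<lambda>w. \<psi> w ^ m)"
    and mom: "\<And>m. m > 0 \<Longrightarrow> \<bar>(\<integral>b. \<phi> b ^ m \<partial>bernoulli_pmf p) * (\<integral>w. \<psi> w ^ m \<partial>std_complex_gaussian)\<bar>
        \<le> p * (\<integral>x. x ^ m \<partial>Q)"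
    and p: "0 < p" "p \<le> 1" and k: "k = 2 * l" "l > 0" "p * real n \<le> real k"
  defines "X \<equiv> \<lambda>\<omega> e. of_bool (e \<in> pairs n) * (\<phi> (fst \<omega> e) * \<psi> (snd \<omega> e))"
  shows "measure (sync_space n p) {\<omega> \<in> space (sync_space n p).
        trace_power n (X \<omega>) k \<ge> (exp 1 * subgaussian_const K * real k) ^ k} \<le> 3 * real k / p * exp (- real k)"
    and "(\<lambda>\<omega>. trace_power n (X \<omega>) k) \<in> borel_measurable (sync_space n p)"
proof -
  interpret Q: subgaussian_law Q K by fact
  interpret A: product_prob_space "\<lambda>_ :: nat \<times> nat. measure_pmf (bernoulli_pmf p)"
    by (rule product_prob_bernoulli)
  interpret W: product_prob_space "\<lambda>_ :: nat \<times> nat. std_complex_gaussian"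
    by (rule product_prob_gaussian)
  let ?S = "{..<n} \<times> {..<n} :: (nat \<times> nat) set"
  let ?c = "\<lambda>m. \<integral>x. x ^ m \<partial>Q"
  have \<phi>: "integrable (measure_pmf (bernoulli_pmf p)) (\<lambda>b. \<phi> b ^ m)" for m
    by (intro integrable_measure_pmf_finite) (auto intro: finite_subset[of _ UNIV])
  have key: "integrable (sync_space n p) (\<lambda>\<omega>. \<Prod>e\<in>?S. X \<omega> e ^ m e) \<and>
     \<bar>\<integral>\<omega>. (\<Prod>e\<in>?S. X \<omega> e ^ m e) \<partial>sync_space n p\<bar> \<le> (\<Prod>e\<in>{e \<in> ?S. m e > 0}. p * ?c (m e))"
    for m :: "nat \<times> nat \<Rightarrow> nat"
  proof (cases "\<exists>e\<in>?S - pairs n. m e > 0")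
    case True
    then obtain e where "e \<in> ?S" "e \<notin> pairs n" "m e > 0" by auto
    then have "(\<Prod>e\<in>?S. X \<omega> e ^ m e) = 0" for \<omega>
      by (intro prod_zero) (auto simp: X_def intro!: bexI[of _ e])
    then have zero: "(\<lambda>\<omega>. \<Prod>e\<in>?S. X \<omega> e ^ m e) = (\<lambda>_. 0)" by (rule ext)
    have "0 \<le> (\<Prod>e\<in>{e \<in> ?S. m e > 0}. p * ?c (m e))"
      using p by (intro prod_nonneg mult_nonneg_nonneg Q.moment_nonneg) auto
    then show ?thesis unfolding zero by simp
  next
    case False
    let ?f = "\<lambda>a :: nat \<times> nat \<Rightarrow> bool. \<Prod>e\<in>pairs n. \<phi> (a e) ^ m e"
    let ?g = "\<lambda>w :: nat \<times> nat \<Rightarrow> complex. \<Prod>e\<in>pairs n. \<psi> (w e) ^ m e"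
    have eq: "(\<Prod>e\<in>?S. X \<omega> e ^ m e) = ?f (fst \<omega>) * ?g (snd \<omega>)" for \<omega>
    proof -
      have "(\<Prod>e\<in>?S. X \<omega> e ^ m e) = (\<Prod>e\<in>pairs n. X \<omega> e ^ m e)"
        using False pairs_subset by (intro prod.mono_neutral_right) auto
      then show ?thesis by (simp add: X_def power_mult_distrib prod.distrib)
    qed
    have f: "integrable (graph_space n p) ?f" "(\<integral>a. ?f a \<partial>graph_space n p) = (\<Prod>e\<in>pairs n. \<integral>b. \<phi> b ^ m e \<partial>bernoulli_pmf p)"
      by (intro A.product_integrable_prod A.product_integral_prod \<phi> finite_pairs)+
    have g: "integrable (noise_space n) ?g" "(\<integral>w. ?g w \<partial>noise_space n) = (\<Prod>e\<in>pairs n. \<integral>w. \<psi> w ^ m e \<partial>std_complex_gaussian)"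
      by (intro W.product_integrable_prod W.product_integral_prod \<psi> finite_pairs)+
    note fg = prob_space_graph prob_space_noise f(1) g(1)
    let ?r = "\<lambda>e. (\<integral>b. \<phi> b ^ m e \<partial>bernoulli_pmf p) * (\<integral>w. \<psi> w ^ m e \<partial>std_complex_gaussian)"
    have "\<bar>\<integral>\<omega>. (\<Prod>e\<in>?S. X \<omega> e ^ m e) \<partial>sync_space n p\<bar> = (\<Prod>e\<in>pairs n. \<bar>?r e\<bar>)"
      unfolding eq sync_space_def integral_pair_mult[OF fg] f(2) g(2)
      by (simp add: prod.distrib[symmetric] abs_prod)
    also have "\<dots> = (\<Prod>e\<in>{e \<in> ?S. m e > 0}. \<bar>?r e\<bar>)"
    proof (rule prod.mono_neutral_right)
      show "{e \<in> ?S. m e > 0} \<subseteq> pairs n" using False by blast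
      show "\<forall>e\<in>pairs n - {e \<in> ?S. m e > 0}. \<bar>?r e\<bar> = 1"
      proof
        fix e assume "e \<in> pairs n - {e \<in> ?S. m e > 0}"
        then have "m e = 0" using pairs_subset[of n] by auto
        then show "\<bar>?r e\<bar> = 1"
          by (simp add: prob_space.prob_space[OF prob_space_std_complex_gaussian, simplified])
      qed
    qed simp
    also have "\<dots> \<le> (\<Prod>e\<in>{e \<in> ?S. m e > 0}. p * ?c (m e))"
      by (intro prod_mono conjI mom) auto
    finally show ?thesis
      unfolding eq sync_space_def using integrable_pair_mult[OF fg] by simp
  qed
  note tail = Q.trace_power_tail[OF prob_space_sync_space conjunct1[OF key] conjunct2[OF key] p k]
  show "measure (sync_space n p) {\<omega> \<in> space (sync_space n p).
        trace_power n (X \<omega>) k \<ge> (exp 1 * subgaussian_const K * real k) ^ k} \<le> 3 * real k / p * exp (- real k)"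
    by (rule tail(1))
  show "(\<lambda>\<omega>. trace_power n (X \<omega>) k) \<in> borel_measurable (sync_space n p)"
    by (rule tail(2))
qed

definition graph_entry :: "nat \<Rightarrow> real \<Rightarrow> (nat \<times> nat \<Rightarrow> bool) \<Rightarrow> nat \<times> nat \<Rightarrow> real" where
  "graph_entry n p a e = of_bool (e \<in> pairs n) * (of_bool (a e) - p)"

definition noise_entry :: "nat \<Rightarrow> (complex \<Rightarrow> real) \<Rightarrow> (nat \<times> nat \<Rightarrow> bool) \<Rightarrow> (nat \<times> nat \<Rightarrow> complex) \<Rightarrow> nat \<times> nat \<Rightarrow> real" where
  "noise_entry n \<rho> a w e = of_bool (e \<in> pairs n) * (of_bool (a e) * \<rho> (w e))"

lemma centred_bernoulli_moment:
  assumes p: "0 < p" "p \<le> 1" and m: "m > 0"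
  shows "\<bar>\<integral>b. (of_bool b - p) ^ m \<partial>bernoulli_pmf p\<bar> \<le> p * (\<integral>x. x ^ m \<partial>measure_pmf skew_coin)"
proof -
  have val: "(\<integral>b. (of_bool b - p) ^ m \<partial>bernoulli_pmf p) = p * (1 - p) ^ m + (1 - p) * (- p) ^ m"
    using p by simp
  show ?thesis
  proof (cases "m = 1")
    case True
    then show ?thesis unfolding val by (simp add: skew_coin_integral algebra_simps)
  next
    case False
    with m have m2: "m \<ge> 2" by simp
    have "\<bar>p * (1 - p) ^ m + (1 - p) * (- p) ^ m\<bar> \<le> p * (1 - p) ^ m + (1 - p) * p ^ m"
      using p by (intro order_trans[OF abs_triangle_ineq]) (simp add: abs_mult power_abs)
    also have "\<dots> \<le> p * (1 - p)\<^sup>2 + (1 - p) * p\<^sup>2"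
      using p m2 by (intro add_mono mult_left_mono power_decreasing) auto
    also have "\<dots> = p * (1 - p)"
      by (simp add: power2_eq_square algebra_simps)
    also have "\<dots> \<le> p" using p by (simp add: mult_le_cancel_left1)
    also have "\<dots> \<le> p * (\<integral>x. x ^ m \<partial>measure_pmf skew_coin)"
      using skew_coin_moment_ge_1[OF m2] p by simp
    finally show ?thesis unfolding val .
  qed
qed

lemma graph_trace_power_tail:
  assumes p: "0 < p" "p \<le> 1" and k: "k = 2 * l" "l > 0" "p * real n \<le> real k"
  shows "measure (sync_space n p) {\<omega> \<in> space (sync_space n p).
        trace_power n (graph_entry n p (fst \<omega>)) k \<ge> (exp 1 * subgaussian_const 4 * real k) ^ k}
      \<le> 3 * real k / p * exp (- real k)"
    and "(\<lambda>\<omega>. trace_power n (graph_entry n p (fst \<omega>)) k) \<in> borel_measurable (sync_space n p)"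
proof -
  interpret G: prob_space std_complex_gaussian by (rule prob_space_std_complex_gaussian)
  have "\<bar>(\<integral>b. (of_bool b - p) ^ m \<partial>bernoulli_pmf p) * (\<integral>w. 1 ^ m \<partial>std_complex_gaussian)\<bar>
      \<le> p * (\<integral>x. x ^ m \<partial>measure_pmf skew_coin)" if "m > 0" for m
    using centred_bernoulli_moment[OF p that] G.prob_space by simp
  note tail = sync_trace_power_tail[where \<phi> = "\<lambda>b. of_bool b - p" and \<psi> = "\<lambda>_. 1" and n = n,
      OF subgaussian_skew_coin _ this p k]
  show "measure (sync_space n p) {\<omega> \<in> space (sync_space n p).
        trace_power n (graph_entry n p (fst \<omega>)) k \<ge> (exp 1 * subgaussian_const 4 * real k) ^ k}
      \<le> 3 * real k / p * exp (- real k)"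
    and "(\<lambda>\<omega>. trace_power n (graph_entry n p (fst \<omega>)) k) \<in> borel_measurable (sync_space n p)"
    using tail unfolding graph_entry_def[abs_def] by simp_all
qed

lemma noise_trace_power_tail:
  assumes p: "0 < p" "p \<le> 1" and k: "k = 2 * l" "l > 0" "p * real n \<le> real k"
    and \<rho>: "\<rho> \<in> borel_measurable borel" "distr std_complex_gaussian borel \<rho> = half_normal"
  shows "measure (sync_space n p) {\<omega> \<in> space (sync_space n p).
        trace_power n (noise_entry n \<rho> (fst \<omega>) (snd \<omega>)) k \<ge> (exp 1 * subgaussian_const (1 / 4) * real k) ^ k}
      \<le> 3 * real k / p * exp (- real k)"
    and "(\<lambda>\<omega>. trace_power n (noise_entry n \<rho> (fst \<omega>) (snd \<omega>)) k) \<in> borel_measurable (sync_space n p)"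
proof -
  interpret H: subgaussian_law half_normal "1 / 4" by (rule subgaussian_half_normal)
  have m\<rho> [measurable]: "\<rho> \<in> std_complex_gaussian \<rightarrow>\<^sub>M borel"
    using \<rho>(1) by (simp cong: measurable_cong_sets)
  have int: "integrable std_complex_gaussian (\<lambda>w. \<rho> w ^ m)" for m
    using H.integrable_moment[of m] unfolding \<rho>(2)[symmetric] by (subst (asm) integrable_distr_eq) auto
  have val: "(\<integral>w. \<rho> w ^ m \<partial>std_complex_gaussian) = (\<integral>x. x ^ m \<partial>half_normal)" for m
    unfolding \<rho>(2)[symmetric] by (subst integral_distr) auto
  have "\<bar>(\<integral>b. of_bool b ^ m \<partial>bernoulli_pmf p) * (\<integral>w. \<rho> w ^ m \<partial>std_complex_gaussian)\<bar>
      \<le> p * (\<integral>x. x ^ m \<partial>half_normal)" if "m > 0" for m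
    using p that H.moment_nonneg[of m] by (simp add: val abs_mult zero_power)
  note tail = sync_trace_power_tail[where \<phi> = of_bool and \<psi> = \<rho> and n = n,
      OF subgaussian_half_normal int this p k]
  show "measure (sync_space n p) {\<omega> \<in> space (sync_space n p).
        trace_power n (noise_entry n \<rho> (fst \<omega>) (snd \<omega>)) k \<ge> (exp 1 * subgaussian_const (1 / 4) * real k) ^ k}
      \<le> 3 * real k / p * exp (- real k)"
    and "(\<lambda>\<omega>. trace_power n (noise_entry n \<rho> (fst \<omega>) (snd \<omega>)) k) \<in> borel_measurable (sync_space n p)"
    using tail unfolding noise_entry_def[abs_def] by simp_all
qed

section \<open>Complex vectors and phases\<close>

abbreviation cnorm :: "nat \<Rightarrow> (nat \<Rightarrow> complex) \<Rightarrow> real" where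
  "cnorm n x \<equiv> L2_set (\<lambda>j. cmod (x j)) {..<n}"

lemma cnorm_sq: "(cnorm n x)\<^sup>2 = (\<Sum>j<n. (cmod (x j))\<^sup>2)"
  by (simp add: L2_set_def sum_nonneg)

lemma cnorm_add_le: "cnorm n (\<lambda>j. x j + y j) \<le> cnorm n x + cnorm n y"
  by (rule order_trans[OF L2_set_mono L2_set_triangle_ineq]) (auto intro: norm_triangle_ineq)

lemma cnorm_mult_unit:
  "(\<And>j. j < n \<Longrightarrow> cmod (c j) = 1) \<Longrightarrow> cnorm n (\<lambda>j. c j * x j) = cnorm n x"
  by (rule L2_set_cong) (auto simp: norm_mult)

lemma cnorm_scale: "cnorm n (\<lambda>j. c * x j) = cmod c * cnorm n x"
  by (simp add: norm_mult L2_set_right_distrib)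

lemma norm_sum_cnj_le: "cmod (\<Sum>j<n. cnj (x j) * y j) \<le> cnorm n x * cnorm n y"
proof -
  have "cmod (\<Sum>j<n. cnj (x j) * y j) \<le> (\<Sum>j<n. \<bar>cmod (x j)\<bar> * \<bar>cmod (y j)\<bar>)"
    by (rule order_trans[OF norm_sum]) (simp add: norm_mult)
  also have "\<dots> \<le> cnorm n x * cnorm n y"
    by (rule L2_set_mult_ineq)
  finally show ?thesis .
qed

lemma norm_phase [simp]: "cmod (phase c) = 1"
  by (simp add: phase_def norm_divide)

lemma phase_mult_unit: "c \<noteq> 0 \<Longrightarrow> cmod b = 1 \<Longrightarrow> phase (c * b) = phase c * b"
  by (auto simp: phase_def norm_mult)

lemma cnj_mult_self: "cnj b * b = of_real (cmod b) * of_real (cmod b)"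
  by (simp add: complex_norm_square[symmetric] mult.commute[of "cnj b"] power2_eq_square)

lemma phase_divide:
  assumes "c \<noteq> 0" "b \<noteq> 0"
  shows "phase (c / b) = phase c * cnj (phase b)"
proof -
  have "of_real (cmod b) / b = cnj b / of_real (cmod b)"
    using assms by (simp add: divide_simps cnj_mult_self)
  then have "c / of_real (cmod c) * (of_real (cmod b) / b) = c / of_real (cmod c) * (cnj b / of_real (cmod b))"
    by simp
  then show ?thesis
    using assms by (simp add: phase_def norm_divide mult.commute)
qed

lemma cnj_phase_mult: "cnj (phase S) * S = of_real (cmod S)"
  using cnj_mult_self[of S] by (simp add: phase_def)

text \<open>
  Normalising \<open>x\<close> moves it by \<open>| 1 - |x| |\<close>, which is at most its distance to 1.
\<close>

lemma phase_minus_one_le: "cmod (phase x - 1) \<le> 2 * cmod (x - 1)"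
proof (cases "x = 0")
  case False
  have "phase x - x = of_real (1 - cmod x) * phase x"
    using False by (simp add: phase_def field_simps)
  then have "cmod (phase x - x) = \<bar>1 - cmod x\<bar>"
    by (simp only: norm_mult norm_of_real norm_phase mult_1_right)
  also have "\<dots> \<le> cmod (x - 1)"
    using norm_triangle_ineq3[of x 1] by (simp add: abs_minus_commute)
  finally have "cmod (phase x - x) \<le> cmod (x - 1)" .
  then show ?thesis
    using norm_triangle_ineq[of "phase x - x" "x - 1"] by simp
qed (simp add: phase_def)

text \<open>
  If \<open>s\<close> has argument \<open>\<theta>\<close>, then the left-hand side is \<open>4 sin\<^sup>2 (\<theta>/2)\<close> and the right-hand side is
  \<open>tan\<^sup>2 \<theta>\<close>.
\<close>

lemma phase_minus_one_sq_le:
  assumes "Re s > 0"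
  shows "(cmod (phase s - 1))\<^sup>2 \<le> (Im s / Re s)\<^sup>2"
proof -
  define r where "r = cmod s"
  have r: "r > 0" "Re s \<le> r" "r\<^sup>2 = (Re s)\<^sup>2 + (Im s)\<^sup>2"
    using assms complex_Re_le_cmod[of s] by (auto simp: r_def cmod_power2)
  have "s \<noteq> 0" using assms by auto
  then have "(cmod (phase s - 1))\<^sup>2 = (Re s / r - 1)\<^sup>2 + (Im s / r)\<^sup>2"
    by (simp add: phase_def cmod_power2 r_def)
  also have "\<dots> = ((Re s)\<^sup>2 + (Im s)\<^sup>2) / r\<^sup>2 - 2 * Re s / r + 1"
    using r(1) by (simp add: power2_eq_square field_simps)
  also have "\<dots> = 2 * (r - Re s) / r"
    unfolding r(3)[symmetric] using r(1) by (simp add: field_simps)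
  also have "\<dots> \<le> (r + Re s) * (r - Re s) / (Re s)\<^sup>2"
  proof -
    have "2 * (Re s)\<^sup>2 \<le> r * (r + Re s)"
    proof -
      have "Re s * Re s \<le> r * r" "Re s * Re s \<le> r * Re s"
        using r assms by (auto intro!: mult_mono)
      then show ?thesis unfolding power2_eq_square distrib_left by linarith
    qed
    then have "2 / r \<le> (r + Re s) / (Re s)\<^sup>2"
      using r(1) assms by (simp add: field_simps)
    from mult_right_mono[OF this, of "r - Re s"] r(2) show ?thesis by simp
  qed
  also have "(r + Re s) * (r - Re s) = (Im s)\<^sup>2"
    using r(3) by (simp add: power2_eq_square algebra_simps)
  finally show ?thesis by (simp add: power_divide)
qed

section \<open>Spectral initialisation\<close>

text \<open>
  The deterministic view of one instance: \<open>A\<close> is the adjacency matrix, \<open>H\<close> the masked noise, \<open>z\<close> the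
  vector of true phases, and \<open>\<kappa>\<close> bounds the operator norms of the centred adjacency matrix and of the
  noise.
\<close>

locale sync_instance =
  fixes n :: nat and A :: "nat \<Rightarrow> nat \<Rightarrow> real" and H :: "nat \<Rightarrow> nat \<Rightarrow> complex"
    and z :: "nat \<Rightarrow> complex" and \<sigma> p \<kappa> :: real
  assumes n_pos: "0 < n" and p_pos: "0 < p" and \<sigma>_pos: "0 < \<sigma>" and \<kappa>_nonneg: "0 \<le> \<kappa>"
    and z_unit: "\<And>j. j < n \<Longrightarrow> cmod (z j) = 1"
    and graph_norm: "\<And>x. cnorm n (\<lambda>j. \<Sum>k<n. of_real (A j k - of_bool (j \<noteq> k) * p) * x k) \<le> \<kappa> * cnorm n x"
    and noise_norm: "\<And>x. cnorm n (\<lambda>j. \<Sum>k<n. H j k * x k) \<le> \<kappa> * cnorm n x"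
begin

definition data :: "nat \<Rightarrow> nat \<Rightarrow> complex" where
  "data j k = of_real (A j k) * (z j * cnj (z k)) + of_real \<sigma> * H j k"

definition rotated_noise :: "nat \<Rightarrow> complex" where
  "rotated_noise j = cnj (z j) * (\<Sum>k<n. H j k * z k)"

lemma z_cnj [simp]: "j < n \<Longrightarrow> z j * cnj (z j) = 1" "j < n \<Longrightarrow> cnj (z j) * z j = 1"
  using z_unit[of j] by (simp_all add: complex_norm_square[symmetric] mult.commute[of "cnj _"])

lemma cnorm_z: "cnorm n z = sqrt (real n)"
  by (simp add: L2_set_def z_unit)

lemma graph_apply:
  "j < n \<Longrightarrow> (\<Sum>k<n. of_real (A j k) * x k)
     = (\<Sum>k<n. of_real (A j k - of_bool (j \<noteq> k) * p) * x k) + of_real p * (\<Sum>k<n. x k) - of_real p * x j"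
proof -
  assume j: "j < n"
  have "(\<Sum>k<n. of_bool (j \<noteq> k) * x k) = (\<Sum>k<n. x k) - (\<Sum>k<n. of_bool (j = k) * x k)"
    unfolding sum_subtractf[symmetric] by (intro sum.cong) auto
  also have "(\<Sum>k<n. of_bool (j = k) * x k) = x j"
    using j by (simp add: of_bool_def if_distrib[of "\<lambda>y. y * _"] sum.delta' cong: if_cong)
  finally have eq: "(\<Sum>k<n. of_bool (j \<noteq> k) * x k) = (\<Sum>k<n. x k) - x j" .
  have "(\<Sum>k<n. of_real (A j k - of_bool (j \<noteq> k) * p) * x k)
      = (\<Sum>k<n. of_real (A j k) * x k - of_real p * (of_bool (j \<noteq> k) * x k))"
    by (intro sum.cong refl) (simp add: of_bool_def algebra_simps)
  also have "\<dots> = (\<Sum>k<n. of_real (A j k) * x k) - of_real p * ((\<Sum>k<n. x k) - x j)"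
    unfolding sum_subtractf sum_distrib_left[symmetric] eq ..
  finally show ?thesis by (simp add: algebra_simps)
qed

text \<open>
  The data matrix minus its noiseless mean \<open>p (z z\<^sup>* - I)\<close>, applied to \<open>x\<close>.
\<close>

definition residual :: "(nat \<Rightarrow> complex) \<Rightarrow> nat \<Rightarrow> complex" where
  "residual x j = z j * (\<Sum>k<n. of_real (A j k - of_bool (j \<noteq> k) * p) * (cnj (z k) * x k))
     + of_real \<sigma> * (\<Sum>k<n. H j k * x k)"

lemma residual_norm: "cnorm n (residual x) \<le> \<kappa> * (1 + \<sigma>) * cnorm n x"
proof -
  have "cnorm n (residual x) \<le> cnorm n (\<lambda>j. z j * (\<Sum>k<n. of_real (A j k - of_bool (j \<noteq> k) * p) * (cnj (z k) * x k)))
     + cnorm n (\<lambda>j. of_real \<sigma> * (\<Sum>k<n. H j k * x k))"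
    unfolding residual_def by (rule cnorm_add_le)
  also have "\<dots> = cnorm n (\<lambda>j. \<Sum>k<n. of_real (A j k - of_bool (j \<noteq> k) * p) * (cnj (z k) * x k))
     + \<sigma> * cnorm n (\<lambda>j. \<Sum>k<n. H j k * x k)"
    using \<sigma>_pos by (simp only: cnorm_mult_unit[OF z_unit] cnorm_scale) simp
  also have "\<dots> \<le> \<kappa> * cnorm n (\<lambda>k. cnj (z k) * x k) + \<sigma> * (\<kappa> * cnorm n x)"
    using \<sigma>_pos by (intro add_mono mult_left_mono graph_norm noise_norm) auto
  also have "cnorm n (\<lambda>k. cnj (z k) * x k) = cnorm n x"
    by (intro cnorm_mult_unit) (simp add: z_unit)
  finally show ?thesis by (simp add: algebra_simps)
qed

lemma data_apply:
  assumes j: "j < n"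
  shows "(\<Sum>k<n. data j k * x k) = of_real p * z j * (\<Sum>k<n. cnj (z k) * x k) - of_real p * x j + residual x j"
proof -
  have "(\<Sum>k<n. data j k * x k) = z j * (\<Sum>k<n. of_real (A j k) * (cnj (z k) * x k)) + of_real \<sigma> * (\<Sum>k<n. H j k * x k)"
    by (simp add: data_def algebra_simps sum.distrib sum_distrib_left)
  also have "z j * (\<Sum>k<n. of_real (A j k) * (cnj (z k) * x k))
     = z j * (\<Sum>k<n. of_real (A j k - of_bool (j \<noteq> k) * p) * (cnj (z k) * x k))
       + of_real p * z j * (\<Sum>k<n. cnj (z k) * x k) - of_real p * ((z j * cnj (z j)) * x j)"
    unfolding graph_apply[OF j] by (simp add: algebra_simps)
  finally show ?thesis
    using j by (simp add: residual_def algebra_simps)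
qed

text \<open>
  The eigenvalue equation reads \<open>(\<mu> + p) u = p \<langle>z, u\<rangle> z + residual u\<close>, so \<open>u\<close> differs from a multiple
  of \<open>z\<close> by \<open>residual u / (\<mu> + p)\<close>. The Rayleigh quotient of \<open>z\<close> shows that \<open>\<mu> + p\<close> is at least \<open>n p\<close>
  minus the norm of the residual. Passing to the phases at most doubles the relative error of each
  coordinate.
\<close>

lemma spectral_loss:
  assumes eig: "\<And>j. j < n \<Longrightarrow> (\<Sum>k<n. data j k * u k) = of_real \<mu> * u j"
    and nz: "\<exists>j<n. u j \<noteq> 0"
    and rayleigh: "\<And>x. Re (\<Sum>j<n. cnj (x j) * (\<Sum>k<n. data j k * x k)) \<le> \<mu> * (cnorm n x)\<^sup>2"
    and gap: "4 * (\<kappa> * (1 + \<sigma>)) \<le> real n * p"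
  shows "\<exists>a. cmod a = 1 \<and> (\<Sum>j<n. (cmod (phase (u j) * a - z j))\<^sup>2)
    \<le> 16 * (\<kappa> * (1 + \<sigma>))\<^sup>2 * real n / (real n * p)\<^sup>2"
proof -
  define K where "K = \<kappa> * (1 + \<sigma>)"
  define R where "R = real n * p"
  have K0: "K \<ge> 0" using \<kappa>_nonneg \<sigma>_pos by (simp add: K_def)
  have R: "R > 0" using n_pos p_pos by (simp add: R_def)
  have KR: "4 * K \<le> R" using gap by (simp add: K_def R_def)
  have res: "cnorm n (residual x) \<le> K * cnorm n x" for x
    using residual_norm by (simp add: K_def)
  have sumz: "(\<Sum>k<n. cnj (z k) * z k) = of_nat n"
    by (simp add: sum.cong[OF refl z_cnj(2)])
  have "of_real p * (of_nat n * of_nat n) - of_real p * of_nat n + (\<Sum>j<n. cnj (z j) * residual z j)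
     = (\<Sum>j<n. cnj (z j) * (\<Sum>k<n. data j k * z k))"
  proof -
    have "(\<Sum>j<n. cnj (z j) * (\<Sum>k<n. data j k * z k))
       = (\<Sum>j<n. of_real p * of_nat n * (cnj (z j) * z j) - of_real p * (cnj (z j) * z j) + cnj (z j) * residual z j)"
    proof (rule sum.cong[OF refl])
      fix j assume "j \<in> {..<n}"
      then have "(\<Sum>k<n. data j k * z k) = of_real p * z j * of_nat n - of_real p * z j + residual z j"
        by (simp only: data_apply sumz lessThan_iff)
      then show "cnj (z j) * (\<Sum>k<n. data j k * z k)
         = of_real p * of_nat n * (cnj (z j) * z j) - of_real p * (cnj (z j) * z j) + cnj (z j) * residual z j"
        by (simp only: distrib_left right_diff_distrib mult_ac)
    qed
    also have "\<dots> = of_real p * of_nat n * (\<Sum>j<n. cnj (z j) * z j) - of_real p * (\<Sum>j<n. cnj (z j) * z j)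
        + (\<Sum>j<n. cnj (z j) * residual z j)"
      by (simp only: sum.distrib sum_subtractf sum_distrib_left)
    finally show ?thesis unfolding sumz by simp
  qed
  from arg_cong[OF this, of Re]
  have "p * (real n * real n) - p * real n + Re (\<Sum>j<n. cnj (z j) * residual z j) \<le> \<mu> * real n"
    using rayleigh[of z] by (simp add: cnorm_z)
  moreover have "\<bar>Re (\<Sum>j<n. cnj (z j) * residual z j)\<bar> \<le> K * real n"
  proof -
    have "\<bar>Re (\<Sum>j<n. cnj (z j) * residual z j)\<bar> \<le> cnorm n z * cnorm n (residual z)"
      using abs_Re_le_cmod norm_sum_cnj_le by (rule order_trans)
    also have "\<dots> \<le> cnorm n z * (K * cnorm n z)"
      by (intro mult_left_mono res) simp
    also have "\<dots> = K * real n" by (simp add: cnorm_z)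
    finally show ?thesis .
  qed
  ultimately have "(R - p - K) * real n \<le> \<mu> * real n"
    by (simp add: R_def algebra_simps)
  then have \<mu>: "R - K \<le> \<mu> + p" using n_pos by simp
  then have \<mu>R: "3 / 4 * R \<le> \<mu> + p" "\<mu> + p > 0" using KR R by linarith+
  define c where "c = of_real p * (\<Sum>k<n. cnj (z k) * u k) / of_real (\<mu> + p)"
  have dec: "u j - c * z j = of_real (1 / (\<mu> + p)) * residual u j" if "j < n" for j
  proof -
    have "of_real \<mu> * u j = of_real p * z j * (\<Sum>k<n. cnj (z k) * u k) - of_real p * u j + residual u j"
      using eig[OF that] data_apply[OF that, of u] by simp
    moreover have "of_real (\<mu> + p) \<noteq> (0 :: complex)"
      using \<mu>R(2) unfolding of_real_eq_0_iff by linarith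
    ultimately show ?thesis
      unfolding c_def by (simp add: field_simps)
  qed
  define U where "U = cnorm n u"
  have U: "U > 0"
  proof -
    have "U \<noteq> 0" using nz by (auto simp: U_def L2_set_eq_0_iff)
    then show ?thesis by (simp add: U_def order_less_le)
  qed
  define Y where "Y = cnorm n (\<lambda>j. u j - c * z j)"
  have "Y = cnorm n (\<lambda>j. of_real (1 / (\<mu> + p)) * residual u j)"
    unfolding Y_def by (rule L2_set_cong) (auto simp: dec)
  also have "\<dots> = 1 / (\<mu> + p) * cnorm n (residual u)"
    using \<mu>R(2) by (simp only: cnorm_scale norm_of_real) simp
  also have "\<dots> \<le> 1 / (3 / 4 * R) * (K * U)"
    unfolding U_def using \<mu>R R by (intro mult_mono res divide_left_mono) auto
  finally have Y: "Y \<le> 4 / 3 * (K / R) * U" by (simp add: field_simps)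
  have Y13: "Y \<le> U / 3"
  proof -
    have "K / R \<le> 1 / 4" using KR R by (simp add: field_simps)
    then have "4 / 3 * (K / R) * U \<le> 4 / 3 * (1 / 4) * U"
      using U by (intro mult_right_mono mult_left_mono) auto
    from order_trans[OF Y this] show ?thesis by simp
  qed
  have "U \<le> Y + cmod c * sqrt (real n)"
  proof -
    have "U = cnorm n (\<lambda>j. (u j - c * z j) + c * z j)" by (simp add: U_def)
    also have "\<dots> \<le> Y + cnorm n (\<lambda>j. c * z j)" unfolding Y_def by (rule cnorm_add_le)
    finally show ?thesis by (simp only: cnorm_scale cnorm_z)
  qed
  with Y13 have cU: "2 / 3 * U \<le> cmod c * sqrt (real n)" by simp
  with U have c0: "c \<noteq> 0" by auto
  have co: "cmod (phase (u j) * cnj (phase c) - z j) \<le> 2 * (cmod (u j - c * z j) / cmod c)" if j: "j < n" for j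
  proof (cases "u j = 0")
    case True
    have "cmod (phase (u j) * cnj (phase c) - z j) \<le> cmod (phase (u j) * cnj (phase c)) + cmod (z j)"
      by (rule norm_triangle_ineq4)
    then show ?thesis using True c0 z_unit[OF j] by (simp add: norm_mult)
  next
    case False
    have zj: "z j \<noteq> 0" using z_unit[OF j] by auto
    have "phase (c * z j) = phase c * z j" by (rule phase_mult_unit[OF c0 z_unit[OF j]])
    then have "phase (u j / (c * z j)) = phase (u j) * (cnj (phase c) * cnj (z j))"
      using False c0 zj by (simp add: phase_divide)
    then have "phase (u j) * cnj (phase c) - z j = z j * (phase (u j / (c * z j)) - 1)"
      using j z_cnj(1)[OF j] by (simp add: algebra_simps)
    then have "cmod (phase (u j) * cnj (phase c) - z j) = cmod (phase (u j / (c * z j)) - 1)"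
      using z_unit[OF j] by (simp add: norm_mult)
    also have "\<dots> \<le> 2 * cmod (u j / (c * z j) - 1)"
      by (rule phase_minus_one_le)
    also have "u j / (c * z j) - 1 = (u j - c * z j) / (c * z j)"
      using c0 zj by (simp add: field_simps)
    finally show ?thesis using z_unit[OF j] by (simp add: norm_divide norm_mult)
  qed
  have "(\<Sum>j<n. (cmod (phase (u j) * cnj (phase c) - z j))\<^sup>2) \<le> (\<Sum>j<n. (2 * (cmod (u j - c * z j) / cmod c))\<^sup>2)"
    by (intro sum_mono power_mono co) auto
  also have "\<dots> = 4 * Y\<^sup>2 / (cmod c)\<^sup>2"
    unfolding Y_def cnorm_sq by (simp add: power_mult_distrib power_divide sum_distrib_left sum_divide_distrib)
  also have "\<dots> \<le> 4 * (4 / 3 * (K / R) * U)\<^sup>2 / (2 / 3 * U / sqrt (real n))\<^sup>2"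
  proof (rule frac_le)
    show "4 * Y\<^sup>2 \<le> 4 * (4 / 3 * (K / R) * U)\<^sup>2"
      using Y by (intro mult_left_mono power_mono) (auto simp: Y_def)
    show "(2 / 3 * U / sqrt (real n))\<^sup>2 \<le> (cmod c)\<^sup>2"
      using cU U n_pos by (intro power_mono) (auto simp: field_simps)
  qed (use U n_pos in auto)
  also have "\<dots> = 16 * K\<^sup>2 * real n / R\<^sup>2"
    using U n_pos by (simp add: power_mult_distrib power_divide field_simps)
  finally show ?thesis
    unfolding K_def R_def by (intro exI[of _ "cnj (phase c)"]) simp
qed

end

section \<open>One step of the power method\<close>

lemma contraction_constant:
  fixes \<eta> :: real
  assumes "0 \<le> \<eta>" "\<eta> \<le> 1 / 20"
  shows "(1 + \<eta>) ^ 3 / (1 - \<eta>)\<^sup>2 \<le> 1 + 6 * \<eta>"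
proof -
  have "(1 + 6 * \<eta>) * (1 - \<eta>)\<^sup>2 - (1 + \<eta>) ^ 3 = \<eta> * (1 - 14 * \<eta> + 5 * \<eta>\<^sup>2)"
    by (simp add: power2_eq_square power3_eq_cube algebra_simps)
  moreover have "0 \<le> \<eta> * (1 - 14 * \<eta> + 5 * \<eta>\<^sup>2)"
    using assms by (intro mult_nonneg_nonneg add_nonneg_nonneg) auto
  ultimately have "(1 + \<eta>) ^ 3 \<le> (1 + 6 * \<eta>) * (1 - \<eta>)\<^sup>2" by linarith
  then show ?thesis
    using assms by (simp add: divide_le_eq)
qed

lemma square_sum_le:
  fixes a b \<eta> :: real
  assumes "0 < \<eta>"
  shows "(a + b)\<^sup>2 \<le> (1 + \<eta>) * a\<^sup>2 + (1 + 1 / \<eta>) * b\<^sup>2"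
proof -
  have "0 \<le> (\<eta> * a - b)\<^sup>2 / \<eta>" using assms by simp
  also have "\<dots> = \<eta> * a\<^sup>2 + b\<^sup>2 / \<eta> - 2 * a * b"
    using assms by (simp add: power2_eq_square field_simps)
  finally show ?thesis by (simp add: power2_sum algebra_simps)
qed

context sync_instance
begin

text \<open>
  The part of a rotated row sum that depends on the deviation \<open>h\<close> of the iterate from the truth,
  except for the contribution of \<open>\<Sum> h\<close>.
\<close>

definition perturbation :: "(nat \<Rightarrow> complex) \<Rightarrow> nat \<Rightarrow> complex" where
  "perturbation h j = (\<Sum>k<n. of_real (A j k - of_bool (j \<noteq> k) * p) * h k)
     + of_real \<sigma> * (cnj (z j) * (\<Sum>k<n. H j k * (z k * h k))) - of_real p * h j"

lemma perturbation_norm: "cnorm n (perturbation h) \<le> (\<kappa> * (1 + \<sigma>) + p) * cnorm n h"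
proof -
  let ?g = "\<lambda>j. \<Sum>k<n. of_real (A j k - of_bool (j \<noteq> k) * p) * h k"
  let ?w = "\<lambda>j. of_real \<sigma> * (cnj (z j) * (\<Sum>k<n. H j k * (z k * h k)))"
  have "cnorm n (perturbation h) = cnorm n (\<lambda>j. ?g j + ?w j + of_real (- p) * h j)"
    by (simp add: perturbation_def[abs_def])
  also have "\<dots> \<le> cnorm n ?g + cnorm n ?w + cnorm n (\<lambda>j. of_real (- p) * h j)"
    by (rule order_trans[OF cnorm_add_le add_right_mono[OF cnorm_add_le]])
  also have "\<dots> = cnorm n (\<lambda>j. \<Sum>k<n. of_real (A j k - of_bool (j \<noteq> k) * p) * h k)
     + \<sigma> * cnorm n (\<lambda>j. \<Sum>k<n. H j k * (z k * h k)) + p * cnorm n h"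
    using \<sigma>_pos p_pos
    by (simp only: cnorm_scale cnorm_mult_unit[of n "\<lambda>j. cnj (z j)"] z_unit complex_mod_cnj norm_of_real abs_minus_cancel abs_of_pos)
  also have "\<dots> \<le> \<kappa> * cnorm n h + \<sigma> * (\<kappa> * cnorm n (\<lambda>k. z k * h k)) + p * cnorm n h"
    using \<sigma>_pos by (intro add_mono mult_left_mono graph_norm noise_norm order_refl) auto
  also have "cnorm n (\<lambda>k. z k * h k) = cnorm n h"
    by (intro cnorm_mult_unit z_unit)
  finally show ?thesis by (simp add: algebra_simps)
qed

lemma rotated_row_sum:
  assumes j: "j < n" and sum_h: "(\<Sum>k<n. h k) = of_real (- l / 2)"
  shows "cnj (z j) * (\<Sum>k<n. data j k * (z k * (1 + h k)))
    = of_real ((\<Sum>k<n. A j k) - p * l / 2) + of_real \<sigma> * rotated_noise j + perturbation h j"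
proof -
  have "cnj (z j) * (\<Sum>k<n. data j k * (z k * (1 + h k)))
     = (\<Sum>k<n. of_real (A j k) * ((cnj (z j) * z j) * (cnj (z k) * z k)) * (1 + h k))
       + of_real \<sigma> * (cnj (z j) * (\<Sum>k<n. H j k * (z k * (1 + h k))))"
    unfolding sum_distrib_left sum.distrib[symmetric]
    by (intro sum.cong refl) (simp add: data_def algebra_simps del: z_cnj)
  also have "(\<Sum>k<n. of_real (A j k) * ((cnj (z j) * z j) * (cnj (z k) * z k)) * (1 + h k))
     = (\<Sum>k<n. of_real (A j k) * (1 + h k))"
    using j by (intro sum.cong refl) simp
  also have "\<dots> = of_real (\<Sum>k<n. A j k) + (\<Sum>k<n. of_real (A j k) * h k)"
    by (simp add: distrib_left sum.distrib)
  also have "(\<Sum>k<n. H j k * (z k * (1 + h k))) = (\<Sum>k<n. H j k * z k) + (\<Sum>k<n. H j k * (z k * h k))"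
    by (simp add: algebra_simps sum.distrib)
  finally show ?thesis
    unfolding graph_apply[OF j, of h] sum_h rotated_noise_def perturbation_def
    by (simp add: algebra_simps)
qed

text \<open>
  If neither the noise nor the perturbation lowers the real part by \<open>\<eta> R / 4\<close>, then it is at least
  \<open>(1 - \<eta>) R\<close> and the phase error is bounded through the imaginary part. Otherwise the trivial bound 4
  is charged to the indicator or, as in Chebyshev's inequality, to \<open>|q|\<^sup>2\<close>.
\<close>

lemma power_step_coordinate:
  assumes j: "j < n" and s: "s = of_real d + of_real \<sigma> * w + q"
    and \<eta>: "0 < \<eta>" "\<eta> < 1" and R: "R > 0" and d: "d \<ge> R * (1 - \<eta> / 2)"
  shows "(cmod (phase s - 1))\<^sup>2 \<le> ((1 + \<eta>) * \<sigma>\<^sup>2 * (Im w)\<^sup>2 + (1 + 1 / \<eta>) * (cmod q)\<^sup>2) / ((1 - \<eta>) * R)\<^sup>2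
     + 4 * of_bool (\<sigma> * Re w < - (\<eta> * R / 4)) + 64 * (cmod q)\<^sup>2 / (\<eta> * R)\<^sup>2"
    (is "_ \<le> ?main + ?bad + ?large")
proof -
  have main0: "0 \<le> ?main" using \<eta> by (intro divide_nonneg_nonneg add_nonneg_nonneg) auto
  have large0: "0 \<le> ?large" by simp
  have four: "(cmod (phase s - 1))\<^sup>2 \<le> 4"
    using power_mono[of "cmod (phase s - 1)" 2 2] norm_triangle_ineq4[of "phase s" 1] by simp
  consider "\<sigma> * Re w < - (\<eta> * R / 4)" | "cmod q > \<eta> * R / 4"
    | "\<sigma> * Re w \<ge> - (\<eta> * R / 4)" "cmod q \<le> \<eta> * R / 4" by linarith
  then show ?thesis
  proof cases
    case 1
    then have "?bad = 4" by simp
    then show ?thesis using four main0 large0 by linarith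
  next
    case 2
    have "(\<eta> * R / 4)\<^sup>2 \<le> (cmod q)\<^sup>2" using 2 \<eta> R by (intro power_mono) auto
    then have "4 \<le> ?large" using \<eta> R by (simp add: field_simps)
    moreover have "0 \<le> ?bad" by simp
    ultimately show ?thesis using four main0 by linarith
  next
    case 3
    have "- (\<eta> * R / 4) \<le> Re q" using abs_Re_le_cmod[of q] 3 by linarith
    then have re: "Re s \<ge> (1 - \<eta>) * R"
      using 3 d by (simp add: s algebra_simps)
    have pos: "(1 - \<eta>) * R > 0" using \<eta> R by simp
    have im: "Im s = \<sigma> * Im w + Im q" by (simp add: s)
    have "(cmod (phase s - 1))\<^sup>2 \<le> (Im s / Re s)\<^sup>2"
      using re pos by (intro phase_minus_one_sq_le) linarith
    also have "\<dots> \<le> (Im s)\<^sup>2 / ((1 - \<eta>) * R)\<^sup>2"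
    proof -
      have "((1 - \<eta>) * R)\<^sup>2 \<le> (Re s)\<^sup>2" using re pos by (intro power_mono) auto
      moreover have "0 < (Re s)\<^sup>2 * ((1 - \<eta>) * R)\<^sup>2"
        using re pos mult_pos_pos[OF zero_less_power[of "Re s" 2] zero_less_power[OF pos, of 2]] by linarith
      ultimately show ?thesis unfolding power_divide by (intro divide_left_mono) auto
    qed
    also have "(Im s)\<^sup>2 \<le> (1 + \<eta>) * (\<sigma> * Im w)\<^sup>2 + (1 + 1 / \<eta>) * (Im q)\<^sup>2"
      unfolding im using \<eta> by (intro square_sum_le)
    also have "\<dots> \<le> (1 + \<eta>) * \<sigma>\<^sup>2 * (Im w)\<^sup>2 + (1 + 1 / \<eta>) * (cmod q)\<^sup>2"
    proof -
      have "(Im q)\<^sup>2 \<le> (cmod q)\<^sup>2" by (simp add: cmod_power2)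
      then have "(1 + 1 / \<eta>) * (Im q)\<^sup>2 \<le> (1 + 1 / \<eta>) * (cmod q)\<^sup>2"
        using \<eta> by (intro mult_left_mono) auto
      then show ?thesis by (simp add: power_mult_distrib)
    qed
    finally have "(cmod (phase s - 1))\<^sup>2 \<le> ?main" by (simp add: divide_right_mono)
    moreover have "0 \<le> ?bad" by simp
    ultimately show ?thesis using large0 by linarith
  qed
qed

text \<open>
  Under the optimal rotation \<open>a\<close>, the sum of the deviations \<open>h\<close> is the real number \<open>- l / 2\<close>. So the
  mean \<open>p\<close> of the graph acts on \<open>h\<close> only by lowering the real parts by \<open>p l / 2\<close>, and the rest has a
  norm of order \<open>sqrt (n p (1 + \<sigma>\<^sup>2) l)\<close>. Outside the counted coordinates, the noise at the truth
  enters through its imaginary parts only.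
\<close>

lemma power_step_loss:
  fixes x :: "nat \<Rightarrow> complex" and \<eta> :: real
  defines "S \<equiv> \<Sum>k<n. x k * cnj (z k)"
  defines "a \<equiv> cnj (phase S)"
  defines "l \<equiv> \<Sum>k<n. (cmod (x k * a - z k))\<^sup>2"
  assumes x: "\<And>k. k < n \<Longrightarrow> cmod (x k) = 1"
    and \<eta>: "0 < \<eta>" "\<eta> \<le> 1 / 20"
    and degree: "\<And>j. j < n \<Longrightarrow> real n * p * (1 - \<eta> / 4) \<le> (\<Sum>k<n. A j k)"
    and close: "l \<le> \<eta> * real n / 2"
    and imag: "(\<Sum>j<n. (Im (rotated_noise j))\<^sup>2) \<le> (1 + \<eta>)\<^sup>2 * (real n * (real n * p) / 2)"
    and bad: "4 * real (card {j \<in> {..<n}. \<sigma> * Re (rotated_noise j) < - (\<eta> * (real n * p) / 4)}) \<le> \<eta> * \<sigma>\<^sup>2 / (2 * p)"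
  shows "(\<Sum>j<n. (cmod (phase (\<Sum>k<n. data j k * x k) * a - z j))\<^sup>2)
    \<le> 70 / \<eta>\<^sup>2 * ((\<kappa> * (1 + \<sigma>) + p) / (real n * p))\<^sup>2 * l + (1 + 7 * \<eta>) * (\<sigma>\<^sup>2 / (2 * p))"
proof -
  define R where "R = real n * p"
  have R: "R > 0" using n_pos p_pos by (simp add: R_def)
  define h where "h k = x k * a * cnj (z k) - 1" for k
  have a1: "cmod a = 1" by (simp add: a_def)
  have aS: "a * S = of_real (cmod S)" by (simp add: a_def cnj_phase_mult)
  have h_norm: "cmod (h k) = cmod (x k * a - z k)" if "k < n" for k
  proof -
    have "x k * a - z k = z k * h k"
      using z_cnj(1)[OF that] by (simp add: h_def algebra_simps)
    then show ?thesis using z_unit[OF that] by (simp add: norm_mult)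
  qed
  have l: "l = (cnorm n h)\<^sup>2"
    unfolding cnorm_sq l_def by (intro sum.cong) (auto simp: h_norm)
  have sum_h': "(\<Sum>k<n. h k) = of_real (cmod S - real n)"
  proof -
    have "(\<Sum>k<n. h k) = a * S - of_nat n"
      by (simp add: h_def S_def sum_subtractf sum_distrib_left mult_ac)
    then show ?thesis by (simp add: aS)
  qed
  have "l = (\<Sum>k<n. - 2 * Re (h k))"
    unfolding l_def
  proof (intro sum.cong refl)
    fix k assume "k \<in> {..<n}"
    then have k: "k < n" by simp
    have "cmod (1 + h k) = 1" using x[OF k] z_unit[OF k] a1 by (simp add: h_def norm_mult)
    then have "(Re (1 + h k))\<^sup>2 + (Im (1 + h k))\<^sup>2 = 1" by (simp only: cmod_power2[symmetric]) simp
    then have "(cmod (h k))\<^sup>2 = - 2 * Re (h k)"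
      unfolding cmod_power2 by (simp add: power2_eq_square algebra_simps)
    then show "(cmod (x k * a - z k))\<^sup>2 = - 2 * Re (h k)" by (simp add: h_norm[OF k])
  qed
  also have "\<dots> = - 2 * Re (\<Sum>k<n. h k)" by (simp add: sum_distrib_left sum_negf)
  finally have sum_h: "(\<Sum>k<n. h k) = of_real (- l / 2)" by (simp add: sum_h')
  define q where "q = perturbation h"
  define w where "w = rotated_noise"
  have q: "(\<Sum>j<n. (cmod (q j))\<^sup>2) \<le> (\<kappa> * (1 + \<sigma>) + p)\<^sup>2 * l"
    using power_mono[OF perturbation_norm[of h], of 2]
    by (simp add: q_def cnorm_sq[symmetric] power_mult_distrib l)
  have coord: "(cmod (phase (\<Sum>k<n. data j k * x k) * a - z j))\<^sup>2
     \<le> ((1 + \<eta>) * \<sigma>\<^sup>2 * (Im (w j))\<^sup>2 + (1 + 1 / \<eta>) * (cmod (q j))\<^sup>2) / ((1 - \<eta>) * R)\<^sup>2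
     + 4 * of_bool (\<sigma> * Re (w j) < - (\<eta> * R / 4)) + 64 * (cmod (q j))\<^sup>2 / (\<eta> * R)\<^sup>2"
    (is "?lhs \<le> ?rhs") if j: "j < n" for j
  proof -
    define t where "t = (\<Sum>k<n. data j k * x k)"
    define s where "s = cnj (z j) * (a * t)"
    have "a * t = (\<Sum>k<n. data j k * (z k * (1 + h k)))"
      unfolding t_def sum_distrib_left
    proof (intro sum.cong refl)
      fix k assume "k \<in> {..<n}"
      then have "z k * (1 + h k) = x k * a"
        using z_cnj(1)[of k] by (simp add: h_def algebra_simps)
      then show "a * (data j k * x k) = data j k * (z k * (1 + h k))" by (simp add: mult_ac)
    qed
    then have s: "s = of_real ((\<Sum>k<n. A j k) - p * l / 2) + of_real \<sigma> * w j + q j"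
      using rotated_row_sum[OF j sum_h] by (simp add: s_def w_def q_def)
    have d: "(\<Sum>k<n. A j k) - p * l / 2 \<ge> R * (1 - \<eta> / 2)"
    proof -
      have "R - \<eta> * R / 4 \<le> (\<Sum>k<n. A j k)"
        using degree[OF j] by (simp add: R_def algebra_simps)
      moreover have "p * l \<le> \<eta> * R / 2"
        using mult_left_mono[OF close, of p] p_pos by (simp add: R_def mult_ac)
      moreover have "R * (1 - \<eta> / 2) = R - \<eta> * R / 2" by (simp add: algebra_simps)
      ultimately show ?thesis by linarith
    qed
    have bound: "(cmod (phase s - 1))\<^sup>2 \<le> ?rhs"
      using \<eta> by (intro power_step_coordinate[OF j s _ _ R d]) auto
    show ?thesis
    proof (cases "t = 0")
      case False
      have "phase s = phase t * (cnj (z j) * a)"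
        using phase_mult_unit[OF False, of "cnj (z j) * a"] z_unit[OF j] a1
        by (simp add: s_def norm_mult mult_ac)
      then have "phase t * a - z j = z j * (phase s - 1)"
        using z_cnj(1)[OF j] by (simp add: algebra_simps)
      then have "?lhs = (cmod (phase s - 1))\<^sup>2"
        using z_unit[OF j] by (simp add: t_def[symmetric] norm_mult)
      with bound show ?thesis by simp
    next
      case True
      \<comment> \<open>Then \<open>s = 0\<close>, so that the coordinate is bad or its perturbation is large.\<close>
      have "s = 0" using True by (simp add: s_def)
      then have "Re s = 0" by simp
      then have re: "(\<Sum>k<n. A j k) - p * l / 2 + \<sigma> * Re (w j) + Re (q j) = 0" by (simp add: s)
      have lhs: "?lhs \<le> 4"
        using power_mono[of "cmod (phase t * a - z j)" 2 2] norm_triangle_ineq4[of "phase t * a" "z j"]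
          z_unit[OF j] a1 by (simp add: t_def norm_mult)
      have main0: "0 \<le> ((1 + \<eta>) * \<sigma>\<^sup>2 * (Im (w j))\<^sup>2 + (1 + 1 / \<eta>) * (cmod (q j))\<^sup>2) / ((1 - \<eta>) * R)\<^sup>2"
        using \<eta> by (intro divide_nonneg_nonneg add_nonneg_nonneg) auto
      show ?thesis
      proof (cases "\<sigma> * Re (w j) < - (\<eta> * R / 4)")
        case True
        then show ?thesis using lhs main0 by (simp add: add_increasing2)
      next
        case False
        have "\<eta> * R \<le> 1 / 20 * R" using \<eta> R by (intro mult_right_mono) auto
        moreover have "R * (1 - \<eta> / 2) = R - \<eta> * R / 2" by (simp add: algebra_simps)
        ultimately have "\<eta> * R / 4 \<le> - Re (q j)" using re d False R by linarith
        also have "\<dots> \<le> cmod (q j)" using abs_Re_le_cmod[of "q j"] by linarith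
        finally have "(\<eta> * R / 4)\<^sup>2 \<le> (cmod (q j))\<^sup>2" using \<eta> R by (intro power_mono) auto
        then have "4 \<le> 64 * (cmod (q j))\<^sup>2 / (\<eta> * R)\<^sup>2" using \<eta> R by (simp add: field_simps)
        moreover have "(0 :: real) \<le> 4 * of_bool (\<sigma> * Re (w j) < - (\<eta> * R / 4))" by simp
        ultimately show ?thesis using lhs main0 by linarith
      qed
    qed
  qed
  define P where "P = (1 - \<eta>) * R"
  have P: "P > 0" using \<eta> R by (simp add: P_def)
  define Q where "Q = (\<Sum>j<n. (cmod (q j))\<^sup>2)"
  define B where "B = card {j \<in> {..<n}. \<sigma> * Re (w j) < - (\<eta> * R / 4)}"
  have "(\<Sum>j<n. (cmod (phase (\<Sum>k<n. data j k * x k) * a - z j))\<^sup>2)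
     \<le> (\<Sum>j<n. ((1 + \<eta>) * \<sigma>\<^sup>2 * (Im (w j))\<^sup>2 + (1 + 1 / \<eta>) * (cmod (q j))\<^sup>2) / P\<^sup>2
       + 4 * of_bool (\<sigma> * Re (w j) < - (\<eta> * R / 4)) + 64 * (cmod (q j))\<^sup>2 / (\<eta> * R)\<^sup>2)"
    unfolding P_def by (intro sum_mono coord) auto
  also have "\<dots> = ((1 + \<eta>) * \<sigma>\<^sup>2 * (\<Sum>j<n. (Im (w j))\<^sup>2) + (1 + 1 / \<eta>) * Q) / P\<^sup>2 + 4 * real B + 64 * Q / (\<eta> * R)\<^sup>2"
  proof -
    have "(\<Sum>j<n. of_bool (\<sigma> * Re (w j) < - (\<eta> * R / 4)) :: real) = real B"
      unfolding B_def by (simp add: sum_of_bool_eq Int_def)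
    then show ?thesis
      by (simp add: sum.distrib Q_def sum_distrib_left[symmetric] sum_divide_distrib[symmetric])
  qed
  also have "\<dots> = (1 + \<eta>) * \<sigma>\<^sup>2 * (\<Sum>j<n. (Im (w j))\<^sup>2) / P\<^sup>2 + 4 * real B + ((1 + 1 / \<eta>) / P\<^sup>2 + 64 / (\<eta> * R)\<^sup>2) * Q"
    by (simp add: add_divide_distrib algebra_simps)
  also have "\<dots> \<le> (1 + 6 * \<eta>) * (\<sigma>\<^sup>2 / (2 * p)) + \<eta> * \<sigma>\<^sup>2 / (2 * p) + 70 / (\<eta> * R)\<^sup>2 * ((\<kappa> * (1 + \<sigma>) + p)\<^sup>2 * l)"
  proof (intro add_mono mult_mono)
    have "(1 + \<eta>) * \<sigma>\<^sup>2 * (\<Sum>j<n. (Im (w j))\<^sup>2) / P\<^sup>2 \<le> (1 + \<eta>) * \<sigma>\<^sup>2 * ((1 + \<eta>)\<^sup>2 * (real n * R / 2)) / P\<^sup>2"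
      using imag \<eta> by (intro divide_right_mono mult_left_mono) (auto simp: w_def R_def)
    also have "\<dots> = ((1 + \<eta>) ^ 3 / (1 - \<eta>)\<^sup>2) * (\<sigma>\<^sup>2 / (2 * p))"
    proof -
      have "e * t * (e\<^sup>2 * (N * (N * p) / 2)) / (m * (N * p))\<^sup>2 = (e ^ 3 / m\<^sup>2) * (t / (2 * p))"
        if "m \<noteq> 0" "N \<noteq> 0" for e m t N :: real
        using that p_pos by (simp add: power2_eq_square power3_eq_cube field_simps)
      from this[of "1 - \<eta>" "real n" "1 + \<eta>" "\<sigma>\<^sup>2"] show ?thesis
        using n_pos \<eta> unfolding P_def R_def by simp
    qed
    also have "\<dots> \<le> (1 + 6 * \<eta>) * (\<sigma>\<^sup>2 / (2 * p))"
      using \<eta> p_pos by (intro mult_right_mono contraction_constant) auto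
    finally show "(1 + \<eta>) * \<sigma>\<^sup>2 * (\<Sum>j<n. (Im (w j))\<^sup>2) / P\<^sup>2 \<le> (1 + 6 * \<eta>) * (\<sigma>\<^sup>2 / (2 * p))" .
    show "4 * real B \<le> \<eta> * \<sigma>\<^sup>2 / (2 * p)"
      using bad by (simp add: B_def w_def R_def)
    have "(1 + 1 / \<eta>) / P\<^sup>2 \<le> 6 / (\<eta> * R)\<^sup>2"
    proof -
      have "(1 + 1 / \<eta>) * \<eta>\<^sup>2 = \<eta>\<^sup>2 + \<eta>" using \<eta> by (simp add: power2_eq_square field_simps)
      also have "\<dots> \<le> 1" using \<eta> mult_mono[of \<eta> "1 / 20" \<eta> "1 / 20"] by (simp add: power2_eq_square)
      also have "\<dots> \<le> 6 * (19 / 20)\<^sup>2" by (simp add: power2_eq_square)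
      also have "\<dots> \<le> 6 * (1 - \<eta>)\<^sup>2" using \<eta> by (intro mult_left_mono power_mono) auto
      finally have "(1 + 1 / \<eta>) / (1 - \<eta>)\<^sup>2 \<le> 6 / \<eta>\<^sup>2"
        using \<eta> by (simp add: divide_le_eq le_divide_eq)
      then have "(1 + 1 / \<eta>) / (1 - \<eta>)\<^sup>2 / R\<^sup>2 \<le> 6 / \<eta>\<^sup>2 / R\<^sup>2" by (intro divide_right_mono) auto
      then show ?thesis by (simp add: P_def power_mult_distrib)
    qed
    then show "(1 + 1 / \<eta>) / P\<^sup>2 + 64 / (\<eta> * R)\<^sup>2 \<le> 70 / (\<eta> * R)\<^sup>2"
      by (simp add: add_divide_distrib[symmetric])
    show "Q \<le> (\<kappa> * (1 + \<sigma>) + p)\<^sup>2 * l" using q by (simp add: Q_def)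
  qed (auto simp: Q_def intro: sum_nonneg)
  also have "\<dots> = 70 / \<eta>\<^sup>2 * ((\<kappa> * (1 + \<sigma>) + p) / R)\<^sup>2 * l + (1 + 7 * \<eta>) * (\<sigma>\<^sup>2 / (2 * p))"
  proof -
    have "70 / (\<eta> * R)\<^sup>2 * (X\<^sup>2 * l) = 70 / \<eta>\<^sup>2 * (X / R)\<^sup>2 * l" for X
      by (simp add: power_mult_distrib power_divide)
    moreover have "(1 + 6 * \<eta>) * T + \<eta> * \<sigma>\<^sup>2 / (2 * p) = (1 + 7 * \<eta>) * T" if "T = \<sigma>\<^sup>2 / (2 * p)" for T
    proof -
      have "\<eta> * \<sigma>\<^sup>2 / (2 * p) = \<eta> * T" using that by simp
      then show ?thesis by (simp only:) (simp add: algebra_simps)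
    qed
    ultimately show ?thesis by simp
  qed
  finally show ?thesis by (simp add: R_def)
qed

end

section \<open>Degrees and linear functionals of the noise\<close>

lemma (in prob_space) chernoff_bound:
  assumes s: "s > 0" and f [measurable]: "f \<in> borel_measurable M"
    and mgf: "(\<integral>\<^sup>+ x. ennreal (exp (s * f x)) \<partial>M) \<le> ennreal B" and B: "0 \<le> B"
  shows "prob {x \<in> space M. f x \<ge> a} \<le> exp (- s * a) * B"
proof -
  have "emeasure M {x \<in> space M. f x \<ge> a}
      \<le> ennreal (exp (- s * a)) * (\<integral>\<^sup>+ x. ennreal (exp (s * f x)) * indicator (space M) x \<partial>M)"
    using s by (intro Chernoff_ineq_nn_integral_ge) auto
  also have "(\<integral>\<^sup>+ x. ennreal (exp (s * f x)) * indicator (space M) x \<partial>M) = (\<integral>\<^sup>+ x. ennreal (exp (s * f x)) \<partial>M)"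
    by (intro nn_integral_cong) simp
  also have "ennreal (exp (- s * a)) * \<dots> \<le> ennreal (exp (- s * a)) * ennreal B"
    by (intro mult_left_mono mgf) simp
  finally show ?thesis
    using B by (simp add: emeasure_eq_measure ennreal_mult'[symmetric])
qed

lemma sum_over_pairs:
  fixes F :: "nat \<Rightarrow> nat \<Rightarrow> 'a :: comm_monoid_add"
  assumes "\<And>j. F j j = 0"
  shows "(\<Sum>j<n. \<Sum>k<n. F j k) = (\<Sum>(j, k)\<in>pairs n. F j k + F k j)"
proof -
  let ?D = "(\<lambda>j. (j, j)) ` {..<n}" and ?P = "(\<lambda>(j, k). (k, j)) ` pairs n"
  have split: "{..<n} \<times> {..<n} = pairs n \<union> (?P \<union> ?D)"
    by (auto simp: pairs_def image_iff)
  have disj: "pairs n \<inter> (?P \<union> ?D) = {}" "?P \<inter> ?D = {}"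
    by (auto simp: pairs_def)
  have inj: "inj_on (\<lambda>(j, k). (k, j)) (pairs n)" by (auto simp: inj_on_def)
  have "(\<Sum>j<n. \<Sum>k<n. F j k) = (\<Sum>(j, k)\<in>{..<n} \<times> {..<n}. F j k)"
    by (simp add: sum.cartesian_product)
  also have "\<dots> = (\<Sum>(j, k)\<in>pairs n. F j k) + ((\<Sum>(j, k)\<in>?P. F j k) + (\<Sum>(j, k)\<in>?D. F j k))"
    unfolding split using disj by (subst sum.union_disjoint; simp)+
  also have "(\<Sum>(j, k)\<in>?D. F j k) = 0"
    using assms by (intro sum.neutral) auto
  also have "(\<Sum>(j, k)\<in>?P. F j k) = (\<Sum>(j, k)\<in>pairs n. F k j)"
    by (subst sum.reindex[OF inj]) (simp add: case_prod_unfold)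
  finally show ?thesis
    by (simp add: sum.distrib case_prod_unfold)
qed

definition adj :: "(nat \<times> nat \<Rightarrow> bool) \<Rightarrow> nat \<Rightarrow> nat \<Rightarrow> real" where
  "adj a j k = (if j < k then of_bool (a (j, k)) else if k < j then of_bool (a (k, j)) else 0)"

definition herm :: "(nat \<times> nat \<Rightarrow> complex) \<Rightarrow> nat \<Rightarrow> nat \<Rightarrow> complex" where
  "herm w j k = (if j < k then w (j, k) else if k < j then cnj (w (k, j)) else 0)"

definition vertex_degree :: "nat \<Rightarrow> (nat \<times> nat \<Rightarrow> bool) \<Rightarrow> nat \<Rightarrow> real" where
  "vertex_degree n a j = (\<Sum>k<n. adj a j k)"

definition incidence :: "nat \<Rightarrow> nat \<times> nat \<Rightarrow> real" where
  "incidence j e = of_bool (fst e = j) + of_bool (snd e = j)"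

lemma incidence_01: "e \<in> pairs n \<Longrightarrow> incidence j e = 0 \<or> incidence j e = 1"
  by (auto simp: incidence_def pairs_def)

lemma incidence_sq: "e \<in> pairs n \<Longrightarrow> (incidence j e)\<^sup>2 = incidence j e"
  using incidence_01[of e n j] by auto

lemma row_as_pair_sum:
  fixes F :: "nat \<Rightarrow> nat \<Rightarrow> real"
  assumes j: "j < n" and sym: "\<And>i k. F i k = F k i" and diag: "\<And>i. F i i = 0"
  shows "(\<Sum>k<n. F j k) = (\<Sum>e\<in>pairs n. incidence j e * F (fst e) (snd e))"
proof -
  have "(\<Sum>k<n. F j k) = (\<Sum>i<n. of_bool (i = j) * (\<Sum>k<n. F i k))"
    using j by (simp add: of_bool_def if_distrib[of "\<lambda>x. x * _"] sum.delta cong: if_cong)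
  also have "\<dots> = (\<Sum>i<n. \<Sum>k<n. of_bool (i = j) * F i k)"
    by (simp add: sum_distrib_left)
  also have "\<dots> = (\<Sum>(i, k)\<in>pairs n. of_bool (i = j) * F i k + of_bool (k = j) * F k i)"
    by (rule sum_over_pairs) (simp add: diag)
  also have "\<dots> = (\<Sum>e\<in>pairs n. incidence j e * F (fst e) (snd e))"
    by (intro sum.cong refl) (auto simp: incidence_def sym algebra_simps)
  finally show ?thesis .
qed

lemma adj_pairs: "e \<in> pairs n \<Longrightarrow> adj a (fst e) (snd e) = of_bool (a e)"
  by (auto simp: adj_def pairs_def)

lemma degree_as_pair_sum:
  assumes "j < n"
  shows "vertex_degree n a j = (\<Sum>e\<in>pairs n. incidence j e * of_bool (a e))"
  unfolding vertex_degree_def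
  by (subst row_as_pair_sum[OF assms]) (auto simp: adj_def adj_pairs[symmetric] intro!: sum.cong)

lemma sum_incidence: "j < n \<Longrightarrow> (\<Sum>e\<in>pairs n. incidence j e) = real n - 1"
proof -
  assume j: "j < n"
  have "(\<Sum>e\<in>pairs n. incidence j e) = (\<Sum>e\<in>pairs n. incidence j e * of_bool (fst e \<noteq> snd e))"
    by (intro sum.cong refl) (auto simp: pairs_def)
  also have "\<dots> = (\<Sum>k<n. of_bool (j \<noteq> k))"
    using j by (subst row_as_pair_sum) auto
  also have "\<dots> = (\<Sum>k<n. 1) - (\<Sum>k<n. of_bool (j = k))"
    unfolding sum_subtractf[symmetric] by (intro sum.cong) auto
  also have "\<dots> = real n - 1"
    using j by (simp add: of_bool_def)
  finally show ?thesis .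
qed

lemma bernoulli_mgf:
  assumes p: "0 \<le> p" "p \<le> 1" and s: "- 1 \<le> s" "s \<le> 1"
  shows "(\<integral>\<^sup>+ b. ennreal (exp (s * (of_bool b - p))) \<partial>bernoulli_pmf p) \<le> ennreal (exp (p * s\<^sup>2))"
proof -
  have "(\<integral>\<^sup>+ b. ennreal (exp (s * (of_bool b - p))) \<partial>bernoulli_pmf p)
     = ennreal (exp (s * (1 - p)) * p + exp (s * (0 - p)) * (1 - p))"
    using p by (simp add: ennreal_mult'[symmetric] ennreal_plus[symmetric] del: ennreal_plus)
  also have "exp (s * (1 - p)) * p + exp (s * (0 - p)) * (1 - p) = exp (- s * p) * (1 + p * (exp s - 1))"
    by (simp add: exp_diff exp_minus algebra_simps divide_inverse)
  also have "\<dots> \<le> exp (- s * p) * exp (p * (s + s\<^sup>2))"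
  proof (rule mult_left_mono)
    have "1 + p * (exp s - 1) \<le> exp (p * (exp s - 1))"
      by (rule exp_ge_add_one_self)
    also have "\<dots> \<le> exp (p * (s + s\<^sup>2))"
      using exp_le_quadratic[OF s] p by (simp add: mult_left_mono)
    finally show "1 + p * (exp s - 1) \<le> exp (p * (s + s\<^sup>2))" .
  qed simp
  also have "\<dots> = exp (p * s\<^sup>2)"
    by (simp add: exp_add[symmetric] algebra_simps)
  finally show ?thesis by (simp add: ennreal_leI)
qed

lemma component_measurable_graph [measurable]:
  assumes "e \<in> pairs n"
  shows "(\<lambda>a. of_bool (a e) :: real) \<in> borel_measurable (graph_space n p)"
proof -
  have "(\<lambda>b. of_bool b :: real) \<in> borel_measurable (measure_pmf (bernoulli_pmf p))" by simp
  from measurable_compose[OF measurable_component_singleton[OF assms] this] show ?thesis .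
qed

lemma degree_mgf:
  assumes j: "j < n" and p: "0 \<le> p" "p \<le> 1" and s: "- 1 \<le> s" "s \<le> 1"
  shows "(\<integral>\<^sup>+ a. ennreal (exp (s * (vertex_degree n a j - (real n - 1) * p))) \<partial>graph_space n p)
    \<le> ennreal (exp (s\<^sup>2 * (real n * p)))"
proof -
  interpret A: product_prob_space "\<lambda>_ :: nat \<times> nat. measure_pmf (bernoulli_pmf p)"
    by (rule product_prob_bernoulli)
  have "s * (vertex_degree n a j - (real n - 1) * p) = (\<Sum>e\<in>pairs n. s * incidence j e * (of_bool (a e) - p))" for a
    unfolding degree_as_pair_sum[OF j] sum_incidence[OF j, symmetric]
    by (simp only: sum_distrib_left sum_distrib_right right_diff_distrib sum_subtractf mult.assoc)
  then have "(\<integral>\<^sup>+ a. ennreal (exp (s * (vertex_degree n a j - (real n - 1) * p))) \<partial>graph_space n p)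
     = (\<integral>\<^sup>+ a. (\<Prod>e\<in>pairs n. ennreal (exp (s * incidence j e * (of_bool (a e) - p)))) \<partial>graph_space n p)"
    by (simp add: exp_sum prod_ennreal)
  also have "\<dots> = (\<Prod>e\<in>pairs n. \<integral>\<^sup>+ b. ennreal (exp (s * incidence j e * (of_bool b - p))) \<partial>bernoulli_pmf p)"
    by (rule A.product_nn_integral_prod) auto
  also have "\<dots> \<le> (\<Prod>e\<in>pairs n. ennreal (exp (p * s\<^sup>2 * incidence j e)))"
  proof (rule prod_mono_ennreal)
    fix e assume e: "e \<in> pairs n"
    have "- 1 \<le> s * incidence j e" "s * incidence j e \<le> 1"
      using incidence_01[OF e, of j] s by auto
    from bernoulli_mgf[OF p this]
    show "(\<integral>\<^sup>+ b. ennreal (exp (s * incidence j e * (of_bool b - p))) \<partial>bernoulli_pmf p)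
        \<le> ennreal (exp (p * s\<^sup>2 * incidence j e))"
      by (simp add: power_mult_distrib incidence_sq[OF e] mult.assoc)
  qed
  also have "\<dots> = ennreal (exp (p * s\<^sup>2 * (real n - 1)))"
    by (simp add: prod_ennreal exp_sum[symmetric] sum_distrib_left[symmetric] sum_incidence[OF j])
  also have "\<dots> \<le> ennreal (exp (s\<^sup>2 * (real n * p)))"
    using p by (intro ennreal_leI) (simp add: algebra_simps)
  finally show ?thesis .
qed

lemma degree_measurable [measurable]: "j < n \<Longrightarrow> (\<lambda>a. vertex_degree n a j) \<in> borel_measurable (graph_space n p)"
  by (simp only: degree_as_pair_sum) measurable

text \<open>
  A Chernoff bound for each degree; the deviation \<open>2 s n p\<close> is the one for which \<open>s\<close> is the optimal
  exponent.
\<close>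

lemma degree_tail:
  assumes n: "n > 0" and p: "0 < p" "p \<le> 1" and s: "0 < s" "s \<le> 1"
  shows "measure (graph_space n p) {a \<in> space (graph_space n p).
      \<exists>j<n. 2 * s * (real n * p) \<le> \<bar>vertex_degree n a j - (real n - 1) * p\<bar>} \<le> 2 * real n * exp (- (s\<^sup>2 * (real n * p)))"
proof -
  interpret P: prob_space "graph_space n p" by (rule prob_space_graph)
  let ?R = "real n * p" and ?D = "\<lambda>a j. vertex_degree n a j - (real n - 1) * p"
  let ?up = "\<lambda>j. {a \<in> space (graph_space n p). 2 * s * ?R \<le> ?D a j}"
  let ?lo = "\<lambda>j. {a \<in> space (graph_space n p). 2 * s * ?R \<le> - ?D a j}"
  have one: "P.prob (?up j) \<le> exp (- (s\<^sup>2 * ?R))" "P.prob (?lo j) \<le> exp (- (s\<^sup>2 * ?R))" if j: "j < n" for j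
  proof -
    note [measurable] = degree_measurable[OF j, of p]
    have e: "exp (- s * (2 * s * ?R)) * exp (s\<^sup>2 * ?R) = exp (- (s\<^sup>2 * ?R))"
      by (simp add: exp_add[symmetric] power2_eq_square algebra_simps)
    have "P.prob (?up j) \<le> exp (- s * (2 * s * ?R)) * exp (s\<^sup>2 * ?R)"
      using s p by (intro P.chernoff_bound degree_mgf j) auto
    then show "P.prob (?up j) \<le> exp (- (s\<^sup>2 * ?R))" unfolding e .
    have "(\<integral>\<^sup>+ a. ennreal (exp (- s * ?D a j)) \<partial>graph_space n p) \<le> ennreal (exp ((- s)\<^sup>2 * ?R))"
      using s p by (intro degree_mgf[OF j]) auto
    then have "(\<integral>\<^sup>+ a. ennreal (exp (s * - ?D a j)) \<partial>graph_space n p) \<le> ennreal (exp (s\<^sup>2 * ?R))"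
      by (simp only: mult_minus_left mult_minus_right power2_minus)
    then have "P.prob (?lo j) \<le> exp (- s * (2 * s * ?R)) * exp (s\<^sup>2 * ?R)"
      using s by (intro P.chernoff_bound) auto
    then show "P.prob (?lo j) \<le> exp (- (s\<^sup>2 * ?R))" unfolding e .
  qed
  have sets: "?up j \<in> P.events" "?lo j \<in> P.events" if "j < n" for j
  proof -
    note [measurable] = degree_measurable[OF that, of p]
    show "?up j \<in> P.events" "?lo j \<in> P.events" by measurable
  qed
  have eq: "{a \<in> space (graph_space n p). \<exists>j<n. 2 * s * ?R \<le> \<bar>?D a j\<bar>} = (\<Union>j<n. ?up j \<union> ?lo j)"
    by (auto simp: abs_real_def split: if_splits)
  have "P.prob {a \<in> space (graph_space n p). \<exists>j<n. 2 * s * ?R \<le> \<bar>?D a j\<bar>} \<le> (\<Sum>j<n. P.prob (?up j \<union> ?lo j))"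
    unfolding eq by (rule P.finite_measure_subadditive_finite) (use sets in blast)+
  also have "\<dots> \<le> (\<Sum>j<n. exp (- (s\<^sup>2 * ?R)) + exp (- (s\<^sup>2 * ?R)))"
    using one sets by (intro sum_mono order_trans[OF measure_Un_le] add_mono) auto
  finally show ?thesis by simp
qed

lemma noise_mgf:
  "(\<integral>\<^sup>+ w. ennreal (exp (\<Sum>e\<in>pairs n. Re (c e * w e))) \<partial>noise_space n)
    = ennreal (exp ((\<Sum>e\<in>pairs n. (cmod (c e))\<^sup>2) / 4))"
proof -
  interpret W: product_prob_space "\<lambda>_ :: nat \<times> nat. std_complex_gaussian"
    by (rule product_prob_gaussian)
  have "(\<integral>\<^sup>+ w. ennreal (exp (\<Sum>e\<in>pairs n. Re (c e * w e))) \<partial>noise_space n)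
     = (\<integral>\<^sup>+ w. (\<Prod>e\<in>pairs n. ennreal (exp (Re (c e * w e)))) \<partial>noise_space n)"
    by (simp add: exp_sum prod_ennreal)
  also have "\<dots> = (\<Prod>e\<in>pairs n. \<integral>\<^sup>+ w. ennreal (exp (Re (c e * w))) \<partial>std_complex_gaussian)"
    by (rule W.product_nn_integral_prod) auto
  also have "\<dots> = ennreal (exp ((\<Sum>e\<in>pairs n. (cmod (c e))\<^sup>2) / 4))"
    by (simp only: complex_gaussian_mgf) (simp add: prod_ennreal exp_sum[symmetric] sum_divide_distrib)
  finally show ?thesis .
qed

definition noise_row :: "nat \<Rightarrow> (nat \<Rightarrow> complex) \<Rightarrow> (nat \<times> nat \<Rightarrow> bool) \<Rightarrow> (nat \<times> nat \<Rightarrow> complex) \<Rightarrow> nat \<Rightarrow> complex" where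
  "noise_row n z a w j = cnj (z j) * (\<Sum>k<n. of_real (adj a j k) * herm w j k * z k)"

lemma sum_Re_noise_row:
  "(\<Sum>j<n. g j * Re (noise_row n z a w j))
    = (\<Sum>e\<in>pairs n. Re (of_real (of_bool (a e) * (g (fst e) + g (snd e))) * (cnj (z (fst e)) * z (snd e)) * w e))"
proof -
  let ?F = "\<lambda>j k. g j * adj a j k * Re (cnj (z j) * herm w j k * z k)"
  have "(\<Sum>j<n. g j * Re (noise_row n z a w j)) = (\<Sum>j<n. \<Sum>k<n. ?F j k)"
  proof (intro sum.cong refl)
    fix j
    have "noise_row n z a w j = (\<Sum>k<n. of_real (adj a j k) * (cnj (z j) * herm w j k * z k))"
      by (simp add: noise_row_def sum_distrib_left mult_ac)
    then show "g j * Re (noise_row n z a w j) = (\<Sum>k<n. ?F j k)"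
      by (simp add: sum_distrib_left mult.assoc)
  qed
  also have "\<dots> = (\<Sum>(j, k)\<in>pairs n. ?F j k + ?F k j)"
    by (rule sum_over_pairs) (simp add: adj_def)
  also have "\<dots> = (\<Sum>e\<in>pairs n. Re (of_real (of_bool (a e) * (g (fst e) + g (snd e))) * (cnj (z (fst e)) * z (snd e)) * w e))"
  proof (rule sum.cong[OF refl])
    fix e assume e: "e \<in> pairs n"
    obtain j k where jk: "e = (j, k)" by (cases e)
    have lt: "j < k" using e by (simp add: jk pairs_def)
    have hw: "herm w j k = w (j, k)" "herm w k j = cnj (w (j, k))"
      using lt by (simp_all add: herm_def)
    have "Re (cnj (z k) * herm w k j * z j) = Re (cnj (cnj (z j) * z k * w (j, k)))"
      by (simp only: hw complex_cnj_mult complex_cnj_cnj mult_ac)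
    then have "Re (cnj (z k) * herm w k j * z j) = Re (cnj (z j) * z k * w (j, k))"
      by (simp only: cnj.sel)
    moreover have "Re (cnj (z j) * herm w j k * z k) = Re (cnj (z j) * z k * w (j, k))"
      by (simp only: hw mult_ac)
    ultimately show "(case e of (j, k) \<Rightarrow> ?F j k + ?F k j)
       = Re (of_real (of_bool (a e) * (g (fst e) + g (snd e))) * (cnj (z (fst e)) * z (snd e)) * w e)"
      using lt by (simp add: jk adj_def mult.assoc distrib_right)
  qed
  finally show ?thesis .
qed

text \<open>
  The two rows that contain an edge see conjugate values of its noise, so their imaginary parts are
  opposite and only the difference of the coefficients remains.
\<close>

lemma sum_Im_noise_row:
  "(\<Sum>j<n. g j * Im (noise_row n z a w j))
    = (\<Sum>e\<in>pairs n. Re (- \<i> * of_real (of_bool (a e) * (g (fst e) - g (snd e))) * (cnj (z (fst e)) * z (snd e)) * w e))"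
proof -
  let ?F = "\<lambda>j k. g j * adj a j k * Im (cnj (z j) * herm w j k * z k)"
  have "(\<Sum>j<n. g j * Im (noise_row n z a w j)) = (\<Sum>j<n. \<Sum>k<n. ?F j k)"
  proof (intro sum.cong refl)
    fix j
    have "noise_row n z a w j = (\<Sum>k<n. of_real (adj a j k) * (cnj (z j) * herm w j k * z k))"
      by (simp add: noise_row_def sum_distrib_left mult_ac)
    then show "g j * Im (noise_row n z a w j) = (\<Sum>k<n. ?F j k)"
      by (simp add: sum_distrib_left mult.assoc)
  qed
  also have "\<dots> = (\<Sum>(j, k)\<in>pairs n. ?F j k + ?F k j)"
    by (rule sum_over_pairs) (simp add: adj_def)
  also have "\<dots> = (\<Sum>e\<in>pairs n. Re (- \<i> * of_real (of_bool (a e) * (g (fst e) - g (snd e))) * (cnj (z (fst e)) * z (snd e)) * w e))"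
  proof (rule sum.cong[OF refl])
    fix e assume e: "e \<in> pairs n"
    obtain j k where jk: "e = (j, k)" by (cases e)
    have lt: "j < k" using e by (simp add: jk pairs_def)
    have hw: "herm w j k = w (j, k)" "herm w k j = cnj (w (j, k))"
      using lt by (simp_all add: herm_def)
    have "Im (cnj (z k) * herm w k j * z j) = Im (cnj (cnj (z j) * z k * w (j, k)))"
      by (simp only: hw complex_cnj_mult complex_cnj_cnj mult_ac)
    then have 1: "Im (cnj (z k) * herm w k j * z j) = - Im (cnj (z j) * z k * w (j, k))"
      "Im (cnj (z j) * herm w j k * z k) = Im (cnj (z j) * z k * w (j, k))"
      by (simp_all only: cnj.sel hw mult_ac)
    have 2: "Re (- \<i> * of_real x * y * v) = x * Im (y * v)" for x y v
      by (simp add: mult.assoc)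
    have adjv: "adj a j k = of_bool (a (j, k))" "adj a k j = of_bool (a (j, k))"
      using lt by (simp_all add: adj_def)
    have gen: "x * b * T + y * b * - T = b * (x - y) * T" for x y b T :: real
      by (simp add: algebra_simps)
    show "(case e of (j, k) \<Rightarrow> ?F j k + ?F k j)
       = Re (- \<i> * of_real (of_bool (a e) * (g (fst e) - g (snd e))) * (cnj (z (fst e)) * z (snd e)) * w e)"
      unfolding 2 jk prod.case fst_conv snd_conv 1 adjv by (rule gen)
  qed
  finally show ?thesis .
qed

section \<open>Concentration of the noise for a fixed graph\<close>

lemma herm_measurable:
  assumes "\<And>e. e \<in> pairs n \<Longrightarrow> (\<lambda>x. W x e) \<in> borel_measurable M" "j < n" "k < n"
  shows "(\<lambda>x. herm (W x) j k) \<in> borel_measurable M"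
proof -
  consider "j < k" | "k < j" | "j = k" by linarith
  then show ?thesis
  proof cases
    case 1
    with assms(1)[of "(j, k)"] assms(3) show ?thesis by (simp add: herm_def pairs_def)
  next
    case 2
    with assms(1)[of "(k, j)"] assms(2) have "(\<lambda>x. W x (k, j)) \<in> borel_measurable M"
      by (simp add: pairs_def)
    then have "(\<lambda>x. cnj (W x (k, j))) \<in> borel_measurable M"
      by (rule measurable_compose) (intro borel_measurable_continuous_onI continuous_intros)
    with 2 show ?thesis by (simp add: herm_def)
  qed (simp add: herm_def)
qed

lemma noise_row_measurable:
  assumes W: "\<And>e. e \<in> pairs n \<Longrightarrow> (\<lambda>x. W x e) \<in> borel_measurable M"
    and A: "\<And>j k. j < n \<Longrightarrow> k < n \<Longrightarrow> (\<lambda>x. adj (A x) j k) \<in> borel_measurable M" and j: "j < n"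
  shows "(\<lambda>x. noise_row n z (A x) (W x) j) \<in> borel_measurable M"
  unfolding noise_row_def
  by (intro borel_measurable_times borel_measurable_const borel_measurable_sum borel_measurable_of_real)
     (use herm_measurable[OF W] A j in auto)

lemma noise_component_measurable: "e \<in> pairs n \<Longrightarrow> (\<lambda>w. w e) \<in> borel_measurable (noise_space n)"
  using measurable_component_singleton[of e "pairs n" "\<lambda>_. std_complex_gaussian"]
  by (simp cong: measurable_cong_sets)

lemma noise_row_measurable_noise:
  assumes "j < n"
  shows "(\<lambda>w. noise_row n z a w j) \<in> borel_measurable (noise_space n)"
  by (rule noise_row_measurable) (use assms noise_component_measurable in auto)

lemma unit_cnj_mult: "e \<in> pairs n \<Longrightarrow> (\<And>j. j < n \<Longrightarrow> cmod (z j) = 1) \<Longrightarrow> cmod (cnj (z (fst e)) * z (snd e)) = 1"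
  by (auto simp: pairs_def norm_mult)

lemma Re_noise_row_tail:
  assumes z: "\<And>j. j < n \<Longrightarrow> cmod (z j) = 1" and j: "j < n"
    and R: "R > 0" "vertex_degree n a j \<le> 2 * R" and t: "t > 0"
  shows "measure (noise_space n) {w \<in> space (noise_space n). - Re (noise_row n z a w j) \<ge> t}
    \<le> exp (- (t\<^sup>2 / (2 * R)))"
proof -
  interpret P: prob_space "noise_space n" by (rule prob_space_noise)
  note [measurable] = noise_row_measurable_noise[OF j]
  \<comment> \<open>The exponent \<open>t / R\<close> is the optimal one when the degree is \<open>2 R\<close>.\<close>
  define s where "s = t / R"
  have s: "s > 0" using t R by (simp add: s_def)
  let ?g = "\<lambda>i. - s * of_bool (i = j)"
  let ?c = "\<lambda>e. of_real (of_bool (a e) * (?g (fst e) + ?g (snd e))) * (cnj (z (fst e)) * z (snd e))"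
  have lin: "s * - Re (noise_row n z a w j) = (\<Sum>e\<in>pairs n. Re (?c e * w e))" for w
  proof -
    have "s * - Re (noise_row n z a w j) = (\<Sum>i<n. ?g i * Re (noise_row n z a w i))"
      using j by (simp add: of_bool_def if_distrib[of "\<lambda>x. x * _"] if_distrib[of "\<lambda>x. _ * x"] sum.delta cong: if_cong)
    then show ?thesis by (simp only: sum_Re_noise_row)
  qed
  have "(\<Sum>e\<in>pairs n. (cmod (?c e))\<^sup>2) = (\<Sum>e\<in>pairs n. s\<^sup>2 * (incidence j e * of_bool (a e)))"
  proof (rule sum.cong[OF refl])
    fix e assume e: "e \<in> pairs n"
    have u: "cmod (cnj (z (fst e)) * z (snd e)) = 1" by (rule unit_cnj_mult[OF e]) (rule z)
    have "(cmod (?c e))\<^sup>2 = (of_bool (a e) * (?g (fst e) + ?g (snd e)))\<^sup>2"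
      unfolding norm_mult[of "of_real _" "cnj (z (fst e)) * z (snd e)"] u norm_of_real mult_1_right
      by (rule power2_abs)
    also have "\<dots> = (of_bool (a e) * (- s * incidence j e))\<^sup>2"
      by (simp add: incidence_def algebra_simps)
    also have "\<dots> = s\<^sup>2 * (incidence j e * of_bool (a e))"
      by (simp add: power_mult_distrib incidence_sq[OF e])
    finally show "(cmod (?c e))\<^sup>2 = s\<^sup>2 * (incidence j e * of_bool (a e))" .
  qed
  then have c: "(\<Sum>e\<in>pairs n. (cmod (?c e))\<^sup>2) = s\<^sup>2 * vertex_degree n a j"
    by (simp only: degree_as_pair_sum[OF j] sum_distrib_left)
  have "(\<integral>\<^sup>+ w. ennreal (exp (s * - Re (noise_row n z a w j))) \<partial>noise_space n)
      = ennreal (exp (s\<^sup>2 * vertex_degree n a j / 4))"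
    unfolding lin noise_mgf c ..
  also have "\<dots> \<le> ennreal (exp (s\<^sup>2 * (2 * R) / 4))"
  proof (rule ennreal_leI)
    have "s\<^sup>2 * vertex_degree n a j / 4 \<le> s\<^sup>2 * (2 * R) / 4"
      using R by (intro divide_right_mono mult_left_mono) auto
    then show "exp (s\<^sup>2 * vertex_degree n a j / 4) \<le> exp (s\<^sup>2 * (2 * R) / 4)"
      by (simp only: exp_le_cancel_iff)
  qed
  finally have "P.prob {w \<in> space (noise_space n). - Re (noise_row n z a w j) \<ge> t} \<le> exp (- s * t) * exp (s\<^sup>2 * (2 * R) / 4)"
    by (intro P.chernoff_bound s) auto
  also have "\<dots> = exp (- (t\<^sup>2 / (2 * R)))"
    using R by (simp add: exp_add[symmetric] s_def power2_eq_square field_simps)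
  finally show ?thesis .
qed

text \<open>
  The expected count is the sum of the individual tails; Markov's inequality suffices.
\<close>

lemma bad_count_tail:
  assumes z: "\<And>j. j < n \<Longrightarrow> cmod (z j) = 1"
    and R: "R > 0" and deg: "\<And>j. j < n \<Longrightarrow> vertex_degree n a j \<le> 2 * R" and t: "t > 0" and x: "x > 0"
  shows "measure (noise_space n) {w \<in> space (noise_space n).
      x \<le> real (card {j \<in> {..<n}. Re (noise_row n z a w j) < - t})} \<le> real n * exp (- (t\<^sup>2 / (2 * R))) / x"
proof -
  interpret P: prob_space "noise_space n" by (rule prob_space_noise)
  let ?S = "\<lambda>j. {w \<in> space (noise_space n). Re (noise_row n z a w j) < - t}"
  define u where "u w = (\<Sum>j<n. indicator (?S j) w :: real)" for w
  have sets: "?S j \<in> P.events" if "j < n" for j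
  proof -
    note [measurable] = noise_row_measurable_noise[OF that]
    show ?thesis by measurable
  qed
  have u: "u w = real (card {j \<in> {..<n}. Re (noise_row n z a w j) < - t})" if "w \<in> space (noise_space n)" for w
  proof -
    have "u w = (\<Sum>j<n. of_bool (Re (noise_row n z a w j) < - t))"
      using that by (simp add: u_def indicator_def)
    then show ?thesis by (simp add: sum_of_bool_eq Int_def)
  qed
  have int: "integrable (noise_space n) u"
    unfolding u_def using sets by (intro Bochner_Integration.integrable_sum) (auto simp: P.emeasure_eq_measure)
  have "(\<integral>w. u w \<partial>noise_space n) = (\<Sum>j<n. P.prob (?S j))"
    unfolding u_def using sets
    by (subst Bochner_Integration.integral_sum) (auto simp: P.emeasure_eq_measure)
  also have "\<dots> \<le> (\<Sum>j<n. exp (- (t\<^sup>2 / (2 * R))))"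
  proof (rule sum_mono)
    fix j assume "j \<in> {..<n}"
    then have j: "j < n" by simp
    note [measurable] = noise_row_measurable_noise[OF j]
    have "P.prob (?S j) \<le> P.prob {w \<in> space (noise_space n). - Re (noise_row n z a w j) \<ge> t}"
      by (rule P.finite_measure_mono) auto
    also have "\<dots> \<le> exp (- (t\<^sup>2 / (2 * R)))"
      by (rule Re_noise_row_tail[OF z j R deg[OF j] t])
    finally show "P.prob (?S j) \<le> exp (- (t\<^sup>2 / (2 * R)))" .
  qed
  finally have E: "(\<integral>w. u w \<partial>noise_space n) \<le> real n * exp (- (t\<^sup>2 / (2 * R)))" by simp
  have "P.prob {w \<in> space (noise_space n). u w \<ge> x} \<le> (\<integral>w. u w \<partial>noise_space n) / x"
    by (rule integral_Markov_inequality_measure[OF int]) (use x in \<open>auto simp: u_def sum_nonneg\<close>)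
  also have "\<dots> \<le> real n * exp (- (t\<^sup>2 / (2 * R))) / x"
    using x by (intro divide_right_mono E) auto
  also have "{w \<in> space (noise_space n). u w \<ge> x} = {w \<in> space (noise_space n).
      x \<le> real (card {j \<in> {..<n}. Re (noise_row n z a w j) < - t})}"
    using u by auto
  finally show ?thesis .
qed

lemma half_normal_exp_square:
  assumes "0 \<le> m" "m \<le> 1 / 2"
  shows "(\<integral>\<^sup>+ x. ennreal (exp (m * x\<^sup>2)) \<partial>half_normal) \<le> ennreal (exp ((m + 2 * m\<^sup>2) / 2))"
proof -
  define s where "s = sqrt (1 / (2 * (1 - m)))"
  have s: "s > 0" "s\<^sup>2 = 1 / (2 * (1 - m))" using assms by (simp_all add: s_def)
  have split: "normal_density 0 (sqrt (1 / 2)) x * exp (m * x\<^sup>2) = (1 / sqrt (1 - m)) * normal_density 0 s x" for x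
  proof -
    have "- x\<^sup>2 + m * x\<^sup>2 = - (x\<^sup>2 / (2 * s\<^sup>2))"
    proof -
      have "x\<^sup>2 / (2 * s\<^sup>2) = x\<^sup>2 * (1 - m)" using assms by (simp add: s(2))
      then show ?thesis by (simp add: algebra_simps)
    qed
    then have "exp (- x\<^sup>2) * exp (m * x\<^sup>2) = exp (- (x\<^sup>2 / (2 * s\<^sup>2)))"
      by (simp only: exp_add[symmetric])
    moreover have "2 * pi * s\<^sup>2 * (1 - m) = pi"
      using assms by (simp add: s(2) field_simps)
    then have "sqrt (2 * pi * s\<^sup>2) * sqrt (1 - m) = sqrt pi"
      by (simp only: real_sqrt_mult[symmetric])
    then have "1 / sqrt pi = 1 / sqrt (1 - m) * (1 / sqrt (2 * pi * s\<^sup>2))"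
      by (metis mult.commute divide_divide_eq_left times_divide_eq_left mult_1)
    ultimately show ?thesis
      by (simp add: normal_density_def)
  qed
  interpret S: prob_space "density lborel (\<lambda>x. ennreal (normal_density 0 s x))"
    by (rule prob_space_normal_density) (rule s(1))
  have one: "(\<integral>\<^sup>+ x. ennreal (normal_density 0 s x) \<partial>lborel) = 1"
    using S.emeasure_space_1 by (simp add: emeasure_density)
  have "(\<integral>\<^sup>+ x. ennreal (exp (m * x\<^sup>2)) \<partial>half_normal)
      = (\<integral>\<^sup>+ x. ennreal (1 / sqrt (1 - m)) * ennreal (normal_density 0 s x) \<partial>lborel)"
    using assms by (subst nn_integral_density) (auto simp: ennreal_mult'[symmetric] split)
  also have "\<dots> = ennreal (1 / sqrt (1 - m))"
    by (subst nn_integral_cmult) (simp_all add: one)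
  also have "1 / sqrt (1 - m) \<le> exp ((m + 2 * m\<^sup>2) / 2)"
  proof -
    have "exp (- (m + 2 * m\<^sup>2)) \<le> 1 - m"
      using ln_one_minus_pos_lower_bound[OF assms] assms by (subst (asm) ln_ge_iff) (auto simp: algebra_simps)
    then have "sqrt (exp (- (m + 2 * m\<^sup>2))) \<le> sqrt (1 - m)" by simp
    also have "exp (- (m + 2 * m\<^sup>2)) = (exp (- ((m + 2 * m\<^sup>2) / 2)))\<^sup>2"
      by (simp add: power2_eq_square exp_add[symmetric] field_simps)
    finally have "exp (- ((m + 2 * m\<^sup>2) / 2)) \<le> sqrt (1 - m)" by simp
    then show ?thesis
      using assms by (simp add: exp_minus field_simps)
  qed
  finally show ?thesis by (simp add: ennreal_leI)
qed

text \<open>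
  The quadratic form of the graph Laplacian.
\<close>

definition graph_energy :: "nat \<Rightarrow> (nat \<times> nat \<Rightarrow> bool) \<Rightarrow> (nat \<Rightarrow> real) \<Rightarrow> real" where
  "graph_energy n a g = (\<Sum>e\<in>pairs n. of_bool (a e) * (g (fst e) - g (snd e))\<^sup>2)"

abbreviation "Im_energy n z a w \<equiv> \<Sum>j<n. (Im (noise_row n z a w j))\<^sup>2"

text \<open>
  The exponential of the squared norm is the average of the exponential of a linear functional with an
  independent Gaussian coefficient vector \<open>g\<close>. Exchanging the two averages, the inner one is the
  exponential of the graph energy of \<open>g\<close>.
\<close>

lemma Im_energy_mgf:
  assumes z: "\<And>j. j < n \<Longrightarrow> cmod (z j) = 1"
    and M: "\<And>g. graph_energy n a g \<le> M * (\<Sum>j<n. (g j)\<^sup>2)"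
    and s: "0 \<le> s" "0 \<le> M" "s * M \<le> 1 / 2"
  shows "(\<integral>\<^sup>+ w. ennreal (exp (s * Im_energy n z a w)) \<partial>noise_space n)
     \<le> ennreal (exp (real n * ((s * M + 2 * (s * M)\<^sup>2) / 2)))"
proof -
  let ?\<Gamma> = "\<Pi>\<^sub>M j\<in>{..<n}. half_normal"
  interpret H: product_prob_space "\<lambda>_ :: nat. half_normal"
    by (intro product_prob_spaceI prob_space_half_normal)
  interpret W: prob_space "noise_space n" by (rule prob_space_noise)
  interpret G: prob_space ?\<Gamma> by (intro prob_space_PiM prob_space_half_normal)
  interpret WG: pair_sigma_finite "noise_space n" ?\<Gamma> ..
  \<comment> \<open>Each \<open>g j\<close> has variance 1/2, so the factor \<open>2 sqrt s\<close> yields exactly \<open>s\<close> times the square.\<close>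
  let ?r = "2 * sqrt s"
  have lin: "ennreal (exp (s * Im_energy n z a w))
     = (\<integral>\<^sup>+ g. ennreal (exp (\<Sum>j<n. ?r * g j * Im (noise_row n z a w j))) \<partial>?\<Gamma>)" for w
  proof -
    have "(\<integral>\<^sup>+ g. ennreal (exp (\<Sum>j<n. ?r * g j * Im (noise_row n z a w j))) \<partial>?\<Gamma>)
       = (\<integral>\<^sup>+ g. (\<Prod>j<n. ennreal (exp (?r * Im (noise_row n z a w j) * g j))) \<partial>?\<Gamma>)"
      by (simp add: exp_sum prod_ennreal mult_ac)
    also have "\<dots> = (\<Prod>j<n. \<integral>\<^sup>+ x. ennreal (exp (?r * Im (noise_row n z a w j) * x)) \<partial>half_normal)"
      by (rule H.product_nn_integral_prod) auto
    also have "\<dots> = ennreal (exp (\<Sum>j<n. (?r * Im (noise_row n z a w j))\<^sup>2 / 4))"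
      by (simp only: half_normal_mgf) (simp add: prod_ennreal exp_sum)
    also have "(\<Sum>j<n. (?r * Im (noise_row n z a w j))\<^sup>2 / 4) = s * Im_energy n z a w"
      using s by (simp add: power_mult_distrib sum_distrib_left)
    finally show ?thesis by simp
  qed
  have meas: "(\<lambda>(w, g). ennreal (exp (\<Sum>j<n. ?r * g j * Im (noise_row n z a w j)))) \<in> borel_measurable (noise_space n \<Otimes>\<^sub>M ?\<Gamma>)"
  proof -
    have [measurable]: "(\<lambda>x. Im (noise_row n z a (fst x) j)) \<in> borel_measurable (noise_space n \<Otimes>\<^sub>M ?\<Gamma>)" if "j < n" for j
      using measurable_compose[OF measurable_fst noise_row_measurable_noise[OF that]] by measurable
    have [measurable]: "(\<lambda>x. snd x j) \<in> borel_measurable (noise_space n \<Otimes>\<^sub>M ?\<Gamma>)" if "j < n" for j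
    proof -
      have "(\<lambda>g. g j) \<in> ?\<Gamma> \<rightarrow>\<^sub>M borel"
        using measurable_component_singleton[of j "{..<n}" "\<lambda>_. half_normal"] that by (simp cong: measurable_cong_sets)
      from measurable_compose[OF measurable_snd this] show ?thesis .
    qed
    show ?thesis unfolding case_prod_unfold by (intro measurable_compose[OF _ measurable_ennreal] borel_measurable_exp borel_measurable_sum borel_measurable_times) auto
  qed
  have "(\<integral>\<^sup>+ w. ennreal (exp (s * Im_energy n z a w)) \<partial>noise_space n)
     = (\<integral>\<^sup>+ w. \<integral>\<^sup>+ g. ennreal (exp (\<Sum>j<n. ?r * g j * Im (noise_row n z a w j))) \<partial>?\<Gamma> \<partial>noise_space n)"
    by (simp only: lin)
  also have "\<dots> = (\<integral>\<^sup>+ g. \<integral>\<^sup>+ w. ennreal (exp (\<Sum>j<n. ?r * g j * Im (noise_row n z a w j))) \<partial>noise_space n \<partial>?\<Gamma>)"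
    using WG.Fubini'[OF meas] by simp
  also have "\<dots> \<le> (\<integral>\<^sup>+ g. (\<Prod>j<n. ennreal (exp (s * M * (g j)\<^sup>2))) \<partial>?\<Gamma>)"
  proof (rule nn_integral_mono)
    fix g :: "nat \<Rightarrow> real"
    let ?c = "\<lambda>e. - \<i> * of_real (of_bool (a e) * (?r * g (fst e) - ?r * g (snd e))) * (cnj (z (fst e)) * z (snd e))"
    have "(\<Sum>e\<in>pairs n. (cmod (?c e))\<^sup>2) = (\<Sum>e\<in>pairs n. 4 * s * (of_bool (a e) * (g (fst e) - g (snd e))\<^sup>2))"
    proof (rule sum.cong[OF refl])
      fix e assume e: "e \<in> pairs n"
      have u: "cmod (cnj (z (fst e)) * z (snd e)) = 1" by (rule unit_cnj_mult[OF e]) (rule z)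
      have "(cmod (?c e))\<^sup>2 = (of_bool (a e) * (?r * g (fst e) - ?r * g (snd e)))\<^sup>2"
        unfolding norm_mult[of "_ * of_real _" "cnj (z (fst e)) * z (snd e)"] u
          norm_mult[of "- \<i>"] norm_of_real norm_minus_cancel norm_ii mult_1_right mult_1_left
        by (rule power2_abs)
      also have "\<dots> = (of_bool (a e) * (?r * (g (fst e) - g (snd e))))\<^sup>2"
        by (simp only: right_diff_distrib)
      also have "\<dots> = 4 * s * (of_bool (a e) * (g (fst e) - g (snd e))\<^sup>2)"
        using s by (simp add: power_mult_distrib)
      finally show "(cmod (?c e))\<^sup>2 = 4 * s * (of_bool (a e) * (g (fst e) - g (snd e))\<^sup>2)" .
    qed
    then have c: "(\<Sum>e\<in>pairs n. (cmod (?c e))\<^sup>2) / 4 = s * graph_energy n a g"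
      by (simp add: graph_energy_def sum_distrib_left[symmetric])
    have "(\<integral>\<^sup>+ w. ennreal (exp (\<Sum>j<n. ?r * g j * Im (noise_row n z a w j))) \<partial>noise_space n)
       = ennreal (exp (s * graph_energy n a g))"
      unfolding sum_Im_noise_row[where g = "\<lambda>j. ?r * g j"] noise_mgf c ..
    also have "\<dots> \<le> ennreal (exp (\<Sum>j<n. s * M * (g j)\<^sup>2))"
      using mult_left_mono[OF M[of g] s(1)] by (intro ennreal_leI) (simp add: sum_distrib_left[symmetric] mult.assoc)
    also have "\<dots> = (\<Prod>j<n. ennreal (exp (s * M * (g j)\<^sup>2)))"
      by (simp add: exp_sum prod_ennreal)
    finally show "(\<integral>\<^sup>+ w. ennreal (exp (\<Sum>j<n. ?r * g j * Im (noise_row n z a w j))) \<partial>noise_space n)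
      \<le> (\<Prod>j<n. ennreal (exp (s * M * (g j)\<^sup>2)))" .
  qed
  also have "\<dots> = (\<Prod>j<n. \<integral>\<^sup>+ x. ennreal (exp (s * M * x\<^sup>2)) \<partial>half_normal)"
    by (rule H.product_nn_integral_prod) auto
  also have "\<dots> \<le> (\<Prod>j<n. ennreal (exp ((s * M + 2 * (s * M)\<^sup>2) / 2)))"
    using s by (intro prod_mono_ennreal half_normal_exp_square) auto
  also have "\<dots> = ennreal (exp (real n * ((s * M + 2 * (s * M)\<^sup>2) / 2)))"
    by (simp add: prod_ennreal ennreal_power exp_of_nat_mult[symmetric])
  finally show ?thesis .
qed

text \<open>
  The Chernoff bound at \<open>s M = \<epsilon> / 4\<close>, with exponent \<open>- (n / 2) (\<epsilon>\<^sup>2 / 4 - \<epsilon>\<^sup>2 / 8)\<close>.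
\<close>

lemma Im_energy_tail:
  assumes z: "\<And>j. j < n \<Longrightarrow> cmod (z j) = 1"
    and M: "\<And>g. graph_energy n a g \<le> M * (\<Sum>j<n. (g j)\<^sup>2)" "0 < M"
    and \<epsilon>: "0 < \<epsilon>" "\<epsilon> \<le> 1"
  shows "measure (noise_space n) {w \<in> space (noise_space n). (1 + \<epsilon>) * (real n * M / 2) \<le> Im_energy n z a w}
     \<le> exp (- (real n * \<epsilon>\<^sup>2 / 16))"
proof -
  interpret P: prob_space "noise_space n" by (rule prob_space_noise)
  define s where "s = \<epsilon> / (4 * M)"
  have s: "s > 0" "s * M = \<epsilon> / 4" using \<epsilon> M by (auto simp: s_def)
  have meas: "(\<lambda>w. Im_energy n z a w) \<in> borel_measurable (noise_space n)"
    using noise_row_measurable_noise by (intro borel_measurable_sum borel_measurable_power) (auto intro: measurable_compose[OF _ borel_measurable_Im])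
  have "P.prob {w \<in> space (noise_space n). (1 + \<epsilon>) * (real n * M / 2) \<le> Im_energy n z a w}
     \<le> exp (- s * ((1 + \<epsilon>) * (real n * M / 2))) * exp (real n * ((s * M + 2 * (s * M)\<^sup>2) / 2))"
    using s \<epsilon> M by (intro P.chernoff_bound meas Im_energy_mgf z) auto
  also have "- s * ((1 + \<epsilon>) * (real n * M / 2)) = - (s * M) * ((1 + \<epsilon>) * real n / 2)"
    by simp
  also have "exp (- (s * M) * ((1 + \<epsilon>) * real n / 2)) * exp (real n * ((s * M + 2 * (s * M)\<^sup>2) / 2)) = exp (- (real n * \<epsilon>\<^sup>2 / 16))"
    unfolding s(2) by (simp add: exp_add[symmetric] power2_eq_square field_simps)
  finally show ?thesis .
qed

section \<open>From trace moments to operator norms\<close>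

lemma transpose_norm_le:
  fixes X :: "nat \<times> nat \<Rightarrow> real"
  assumes t: "0 \<le> t" and X: "\<And>f. L2_set (\<lambda>d. \<Sum>a<n. X (a, d) * f a) {..<n} \<le> t * L2_set f {..<n}"
  shows "L2_set (\<lambda>a. \<Sum>d<n. X (a, d) * f d) {..<n} \<le> t * L2_set f {..<n}"
proof -
  define v where "v a = (\<Sum>d<n. X (a, d) * f d)" for a
  let ?V = "L2_set v {..<n}"
  have "?V * ?V = (\<Sum>a<n. v a * (\<Sum>d<n. X (a, d) * f d))"
    by (simp add: L2_set_def sum_nonneg power2_eq_square v_def)
  also have "\<dots> = (\<Sum>a<n. \<Sum>d<n. f d * (X (a, d) * v a))"
    by (simp add: sum_distrib_left mult_ac)
  also have "\<dots> = (\<Sum>d<n. f d * (\<Sum>a<n. X (a, d) * v a))"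
    by (subst sum.swap) (simp add: sum_distrib_left)
  also have "\<dots> \<le> (\<Sum>d<n. \<bar>f d\<bar> * \<bar>\<Sum>a<n. X (a, d) * v a\<bar>)"
    by (intro sum_mono) (metis abs_ge_self abs_mult)
  also have "\<dots> \<le> L2_set f {..<n} * L2_set (\<lambda>d. \<Sum>a<n. X (a, d) * v a) {..<n}"
    by (rule L2_set_mult_ineq)
  also have "\<dots> \<le> L2_set f {..<n} * (t * ?V)"
    by (intro mult_left_mono X) simp
  finally have VV: "?V * ?V \<le> (t * L2_set f {..<n}) * ?V" by (simp only: mult_ac)
  have "?V \<le> t * L2_set f {..<n}"
  proof (cases "?V = 0")
    case False
    then have "0 < ?V" by (simp add: order_less_le)
    with VV show ?thesis by simp
  qed (use t in simp)
  then show ?thesis by (simp add: v_def[abs_def])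
qed

lemma complexify_norm_le:
  fixes X :: "nat \<Rightarrow> nat \<Rightarrow> real"
  assumes t: "0 \<le> t" and X: "\<And>f. L2_set (\<lambda>j. \<Sum>k<n. X j k * f k) {..<n} \<le> t * L2_set f {..<n}"
  shows "cnorm n (\<lambda>j. \<Sum>k<n. of_real (X j k) * x k) \<le> t * cnorm n x"
proof (rule power2_le_imp_le)
  have sq: "(\<Sum>j<n. (\<Sum>k<n. X j k * f k)\<^sup>2) \<le> t\<^sup>2 * (\<Sum>j<n. (f j)\<^sup>2)" for f
    using power_mono[OF X[of f], of 2] by (simp add: L2_set_def sum_nonneg power_mult_distrib)
  have "(cnorm n (\<lambda>j. \<Sum>k<n. of_real (X j k) * x k))\<^sup>2
     = (\<Sum>j<n. (\<Sum>k<n. X j k * Re (x k))\<^sup>2) + (\<Sum>j<n. (\<Sum>k<n. X j k * Im (x k))\<^sup>2)"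
    unfolding cnorm_sq cmod_power2 by (simp add: sum.distrib)
  also have "\<dots> \<le> t\<^sup>2 * (\<Sum>j<n. (Re (x j))\<^sup>2) + t\<^sup>2 * (\<Sum>j<n. (Im (x j))\<^sup>2)"
    by (intro add_mono sq)
  also have "\<dots> = (t * cnorm n x)\<^sup>2"
    unfolding power_mult_distrib cnorm_sq cmod_power2 by (simp add: sum.distrib algebra_simps)
  finally show "(cnorm n (\<lambda>j. \<Sum>k<n. of_real (X j k) * x k))\<^sup>2 \<le> (t * cnorm n x)\<^sup>2" .
qed (use t in simp)

lemma norm_le_of_trace_power:
  assumes tr: "trace_power n X k \<le> \<tau> ^ k" and k: "k = 2 ^ Suc r" and \<tau>: "0 \<le> \<tau>"
  shows "cnorm n (\<lambda>j. \<Sum>k<n. of_real (X (k, j)) * x k) \<le> sqrt \<tau> * cnorm n x"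
    and "cnorm n (\<lambda>j. \<Sum>k<n. of_real (X (j, k)) * x k) \<le> sqrt \<tau> * cnorm n x"
proof -
  have col: "L2_set (\<lambda>d. \<Sum>a<n. X (a, d) * f a) {..<n} \<le> sqrt \<tau> * L2_set f {..<n}" for f
  proof -
    have k0: "k > 0" by (simp add: k)
    have "(\<Sum>d<n. (\<Sum>a<n. X (a, d) * f a)\<^sup>2) ^ k \<le> trace_power n X k * (\<Sum>a<n. (f a)\<^sup>2) ^ k"
      unfolding k by (rule power_le_trace_power)
    also have "\<dots> \<le> \<tau> ^ k * (\<Sum>a<n. (f a)\<^sup>2) ^ k"
      by (intro mult_right_mono tr) (simp add: sum_nonneg)
    also have "\<dots> = (\<tau> * (\<Sum>a<n. (f a)\<^sup>2)) ^ k" by (simp add: power_mult_distrib)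
    finally have "(\<Sum>d<n. (\<Sum>a<n. X (a, d) * f a)\<^sup>2) \<le> \<tau> * (\<Sum>a<n. (f a)\<^sup>2)"
      using k0 \<tau> by (subst (asm) power_mono_iff) (auto simp: sum_nonneg)
    then show ?thesis
      by (simp add: L2_set_def real_sqrt_mult[symmetric])
  qed
  show "cnorm n (\<lambda>j. \<Sum>k<n. of_real (X (k, j)) * x k) \<le> sqrt \<tau> * cnorm n x"
    using complexify_norm_le[where t = "sqrt \<tau>" and X = "\<lambda>j k. X (k, j)" and n = n] col \<tau> by simp
  show "cnorm n (\<lambda>j. \<Sum>k<n. of_real (X (j, k)) * x k) \<le> sqrt \<tau> * cnorm n x"
    using complexify_norm_le[where t = "sqrt \<tau>" and X = "\<lambda>j k. X (j, k)" and n = n] transpose_norm_le[OF _ col] \<tau> by simp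
qed

text \<open>
  The centred adjacency matrix is its upper triangle plus the transpose.
\<close>

lemma graph_matrix_norm:
  assumes tr: "trace_power n (graph_entry n p a) k \<le> \<tau> ^ k" and k: "k = 2 ^ Suc r" and \<tau>: "0 \<le> \<tau>"
  shows "cnorm n (\<lambda>j. \<Sum>k<n. of_real (adj a j k - of_bool (j \<noteq> k) * p) * x k) \<le> 2 * sqrt \<tau> * cnorm n x"
proof -
  let ?X = "graph_entry n p a"
  have entry: "of_real (adj a j k - of_bool (j \<noteq> k) * p) = (of_real (?X (j, k)) + of_real (?X (k, j)) :: complex)"
    if "j < n" "k < n" for j k
    using that by (auto simp: adj_def graph_entry_def pairs_def)
  have "cnorm n (\<lambda>j. \<Sum>k<n. of_real (adj a j k - of_bool (j \<noteq> k) * p) * x k)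
     = cnorm n (\<lambda>j. (\<Sum>k<n. of_real (?X (j, k)) * x k) + (\<Sum>k<n. of_real (?X (k, j)) * x k))"
  proof (intro L2_set_cong refl arg_cong[where f = cmod])
    fix j assume "j \<in> {..<n}"
    then have "(\<Sum>k<n. of_real (adj a j k - of_bool (j \<noteq> k) * p) * x k)
      = (\<Sum>k<n. of_real (?X (j, k)) * x k + of_real (?X (k, j)) * x k)"
      by (intro sum.cong refl) (simp only: entry lessThan_iff distrib_right)
    then show "(\<Sum>k<n. of_real (adj a j k - of_bool (j \<noteq> k) * p) * x k)
      = (\<Sum>k<n. of_real (?X (j, k)) * x k) + (\<Sum>k<n. of_real (?X (k, j)) * x k)"
      by (simp only: sum.distrib)
  qed
  also have "\<dots> \<le> sqrt \<tau> * cnorm n x + sqrt \<tau> * cnorm n x"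
    by (intro order_trans[OF cnorm_add_le] add_mono norm_le_of_trace_power[OF tr k \<tau>])
  finally show ?thesis by simp
qed

text \<open>
  The upper triangle splits into real and imaginary parts, the lower one is its adjoint.
\<close>

lemma noise_matrix_norm:
  assumes tr: "trace_power n (noise_entry n Re a w) k \<le> \<tau> ^ k" "trace_power n (noise_entry n Im a w) k \<le> \<tau> ^ k"
    and k: "k = 2 ^ Suc r" and \<tau>: "0 \<le> \<tau>"
  shows "cnorm n (\<lambda>j. \<Sum>k<n. of_real (adj a j k) * herm w j k * x k) \<le> 4 * sqrt \<tau> * cnorm n x"
proof -
  let ?X = "noise_entry n Re a w" and ?Y = "noise_entry n Im a w"
  have entry: "of_real (adj a j k) * herm w j k
      = (of_real (?X (j, k)) + of_real (?X (k, j))) + \<i> * of_real (?Y (j, k)) + - \<i> * of_real (?Y (k, j))"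
    if "j < n" "k < n" for j k
    using that by (auto simp: adj_def herm_def noise_entry_def pairs_def complex_eq_iff)
  let ?S = "\<lambda>X j. \<Sum>k<n. of_real (X (j, k)) * x k" and ?T = "\<lambda>X j. \<Sum>k<n. of_real (X (k, j)) * x k"
  have "cnorm n (\<lambda>j. \<Sum>k<n. of_real (adj a j k) * herm w j k * x k)
     = cnorm n (\<lambda>j. (?S ?X j + ?T ?X j) + \<i> * ?S ?Y j + - \<i> * ?T ?Y j)"
  proof (intro L2_set_cong refl arg_cong[where f = cmod])
    fix j assume "j \<in> {..<n}"
    then have "(\<Sum>k<n. of_real (adj a j k) * herm w j k * x k)
      = (\<Sum>k<n. (of_real (?X (j, k)) * x k + of_real (?X (k, j)) * x k) + \<i> * (of_real (?Y (j, k)) * x k) + - \<i> * (of_real (?Y (k, j)) * x k))"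
      by (intro sum.cong refl) (simp only: entry lessThan_iff, simp add: algebra_simps)
    then show "(\<Sum>k<n. of_real (adj a j k) * herm w j k * x k) = (?S ?X j + ?T ?X j) + \<i> * ?S ?Y j + - \<i> * ?T ?Y j"
      by (simp only: sum.distrib sum_distrib_left)
  qed
  also have "\<dots> \<le> ((cnorm n (?S ?X) + cnorm n (?T ?X)) + cnorm n (\<lambda>j. \<i> * ?S ?Y j)) + cnorm n (\<lambda>j. - \<i> * ?T ?Y j)"
    by (intro order_trans[OF cnorm_add_le] add_mono cnorm_add_le order_refl)
  also have "\<dots> = ((cnorm n (?S ?X) + cnorm n (?T ?X)) + cnorm n (?S ?Y)) + cnorm n (?T ?Y)"
    unfolding cnorm_scale by simp
  also have "\<dots> \<le> ((sqrt \<tau> * cnorm n x + sqrt \<tau> * cnorm n x) + sqrt \<tau> * cnorm n x) + sqrt \<tau> * cnorm n x"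
    by (intro add_mono norm_le_of_trace_power[OF tr(1) k \<tau>] norm_le_of_trace_power[OF tr(2) k \<tau>])
  finally show ?thesis by simp
qed

section \<open>Rayleigh quotients of Hermitian matrices\<close>

lemma continuous_on_coordinate [continuous_intros]: "continuous_on S (\<lambda>x. x i)"
  by (rule continuous_on_subset[OF continuous_on_product_coordinates]) simp

text \<open>
  Vectors of length \<open>n\<close> are sequences that vanish from \<open>n\<close> on; the sphere is a closed subset of a
  product of compact sets.
\<close>

lemma compact_unit_sphere:
  "compact {x :: nat \<Rightarrow> complex. (\<forall>i\<ge>n. x i = 0) \<and> (\<Sum>i<n. (cmod (x i))\<^sup>2) = 1}"
proof -
  let ?B = "PiE UNIV (\<lambda>i. if i < n then cball 0 1 else {0 :: complex})"
  have "compactin (product_topology (\<lambda>_. euclidean) UNIV) ?B"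
    by (subst compactin_PiE) auto
  then have B: "compact ?B"
    by (simp add: euclidean_product_topology)
  have "closed {x :: nat \<Rightarrow> complex. (\<Sum>i<n. (cmod (x i))\<^sup>2) = 1}"
    by (intro closed_Collect_eq continuous_intros)
  with B have "compact (?B \<inter> {x. (\<Sum>i<n. (cmod (x i))\<^sup>2) = 1})"
    by (rule compact_Int_closed)
  also have "?B \<inter> {x. (\<Sum>i<n. (cmod (x i))\<^sup>2) = 1} = {x. (\<forall>i\<ge>n. x i = 0) \<and> (\<Sum>i<n. (cmod (x i))\<^sup>2) = 1}"
  proof (intro Set.set_eqI iffI)
    fix x :: "nat \<Rightarrow> complex"
    assume "x \<in> {x. (\<forall>i\<ge>n. x i = 0) \<and> (\<Sum>i<n. (cmod (x i))\<^sup>2) = 1}"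
    then have x: "\<forall>i\<ge>n. x i = 0" "(\<Sum>i<n. (cmod (x i))\<^sup>2) = 1" by auto
    have "cmod (x i) \<le> 1" if "i < n" for i
    proof -
      have "(cmod (x i))\<^sup>2 \<le> (\<Sum>i<n. (cmod (x i))\<^sup>2)"
        using that by (intro member_le_sum) auto
      then show ?thesis using x power2_le_imp_le[of "cmod (x i)" 1] by simp
    qed
    then show "x \<in> ?B \<inter> {x. (\<Sum>i<n. (cmod (x i))\<^sup>2) = 1}" using x by auto
  next
    fix x :: "nat \<Rightarrow> complex"
    assume x: "x \<in> ?B \<inter> {x. (\<Sum>i<n. (cmod (x i))\<^sup>2) = 1}"
    then have "x \<in> ?B" by (rule IntD1)
    then have "x i = 0" if "i \<ge> n" for i
      using that PiE_mem[OF \<open>x \<in> ?B\<close>, of i] by simp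
    then show "x \<in> {x. (\<forall>i\<ge>n. x i = 0) \<and> (\<Sum>i<n. (cmod (x i))\<^sup>2) = 1}" using x by auto
  qed
  finally show ?thesis .
qed

definition qform :: "nat \<Rightarrow> (nat \<Rightarrow> nat \<Rightarrow> complex) \<Rightarrow> (nat \<Rightarrow> complex) \<Rightarrow> real" where
  "qform n B x = Re (\<Sum>j<n. cnj (x j) * (\<Sum>k<n. B j k * x k))"

lemma qform_scale: "qform n B (\<lambda>j. of_real c * x j) = c\<^sup>2 * qform n B x"
proof -
  have "(\<Sum>j<n. cnj (of_real c * x j) * (\<Sum>k<n. B j k * (of_real c * x k)))
      = of_real (c\<^sup>2) * (\<Sum>j<n. cnj (x j) * (\<Sum>k<n. B j k * x k))"
    by (simp add: sum_distrib_left power2_eq_square mult_ac)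
  then show ?thesis by (simp add: qform_def)
qed

lemma qform_add:
  assumes herm: "\<And>j k. j < n \<Longrightarrow> k < n \<Longrightarrow> B k j = cnj (B j k)"
  shows "qform n B (\<lambda>j. x j + of_real t * v j)
    = qform n B x + 2 * t * Re (\<Sum>j<n. cnj (v j) * (\<Sum>k<n. B j k * x k)) + t\<^sup>2 * qform n B v"
proof -
  let ?f = "\<lambda>x y. \<Sum>j<n. cnj (x j) * (\<Sum>k<n. B j k * y k)"
  have swap: "?f x v = cnj (?f v x)"
  proof -
    have "?f x v = (\<Sum>j<n. \<Sum>k<n. cnj (x j) * (B j k * v k))" by (simp add: sum_distrib_left)
    also have "\<dots> = (\<Sum>k<n. \<Sum>j<n. cnj (x j) * (B j k * v k))" by (rule sum.swap)
    also have "\<dots> = (\<Sum>k<n. \<Sum>j<n. cnj (cnj (v k) * (B k j * x j)))"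
    proof (intro sum.cong refl)
      fix k j assume "k \<in> {..<n}" "j \<in> {..<n}"
      then have "cnj (B k j) = B j k" using herm[of k j] by simp
      then show "cnj (x j) * (B j k * v k) = cnj (cnj (v k) * (B k j * x j))"
        by (simp only: complex_cnj_mult complex_cnj_cnj mult_ac)
    qed
    also have "\<dots> = cnj (?f v x)" by (simp add: sum_distrib_left cnj_sum)
    finally show ?thesis .
  qed
  let ?B = "\<lambda>y j. \<Sum>k<n. B j k * y k"
  have "?f (\<lambda>j. x j + of_real t * v j) (\<lambda>j. x j + of_real t * v j)
     = (\<Sum>j<n. cnj (x j) * ?B x j + of_real t * (cnj (x j) * ?B v j) + of_real t * (cnj (v j) * ?B x j)
         + of_real (t\<^sup>2) * (cnj (v j) * ?B v j))"
  proof (rule sum.cong[OF refl])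
    fix j
    have "?B (\<lambda>j. x j + of_real t * v j) j = ?B x j + of_real t * ?B v j"
      by (simp add: distrib_left sum.distrib sum_distrib_left mult_ac)
    moreover have "(a + T * b) * (c + T * d) = a * c + T * (a * d) + T * (b * c) + T\<^sup>2 * (b * d)" for a b c d T :: complex
      by (simp add: power2_eq_square algebra_simps)
    ultimately show "cnj (x j + of_real t * v j) * ?B (\<lambda>j. x j + of_real t * v j) j
       = cnj (x j) * ?B x j + of_real t * (cnj (x j) * ?B v j) + of_real t * (cnj (v j) * ?B x j)
         + of_real (t\<^sup>2) * (cnj (v j) * ?B v j)"
      by simp
  qed
  also have "\<dots> = ?f x x + of_real t * ?f x v + of_real t * ?f v x + of_real (t\<^sup>2) * ?f v v"
    by (simp only: sum.distrib sum_distrib_left)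
  finally have "?f (\<lambda>j. x j + of_real t * v j) (\<lambda>j. x j + of_real t * v j)
     = ?f x x + of_real t * ?f x v + of_real t * ?f v x + of_real (t\<^sup>2) * ?f v v" .
  then have "qform n B (\<lambda>j. x j + of_real t * v j)
     = Re (?f x x) + t * Re (?f x v) + t * Re (?f v x) + t\<^sup>2 * Re (?f v v)"
    by (simp add: qform_def del: of_real_power)
  also have "Re (?f x v) = Re (?f v x)" using arg_cong[OF swap, of Re] by (simp only: cnj.sel)
  finally show ?thesis by (simp add: qform_def)
qed

text \<open>
  A maximiser \<open>x0\<close> of the form on the unit sphere exists by compactness. Moving it in the direction of
  \<open>v = B x0 - s x0\<close>, where \<open>s\<close> is the maximum, raises the form minus \<open>s |x|\<^sup>2\<close> at the rate \<open>2 |v|\<^sup>2\<close>;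
  so \<open>v = 0\<close> and \<open>s\<close> is an eigenvalue.
\<close>

lemma rayleigh_le_eigenvalue_bound:
  assumes n: "0 < n" and herm: "\<And>j k. j < n \<Longrightarrow> k < n \<Longrightarrow> B k j = cnj (B j k)"
    and ev: "\<And>s x. \<exists>j<n. x j \<noteq> 0 \<Longrightarrow> \<forall>j<n. (\<Sum>k<n. B j k * x k) = of_real s * x j \<Longrightarrow> s \<le> r"
  shows "qform n B x \<le> r * (cnorm n x)\<^sup>2"
proof -
  let ?S = "{x :: nat \<Rightarrow> complex. (\<forall>i\<ge>n. x i = 0) \<and> (\<Sum>i<n. (cmod (x i))\<^sup>2) = 1}"
  have "(\<Sum>i<n. (cmod (of_bool (i = 0) :: complex))\<^sup>2) = (\<Sum>i<n. if i = 0 then 1 else 0)"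
    by (intro sum.cong refl) auto
  also have "\<dots> = 1" using n by simp
  finally have "(\<Sum>i<n. (cmod (of_bool (i = 0) :: complex))\<^sup>2) = 1" .
  moreover have "\<forall>i\<ge>n. (of_bool (i = 0) :: complex) = 0" using n by simp
  ultimately have ne: "(\<lambda>i. of_bool (i = 0)) \<in> ?S" by (simp only: mem_Collect_eq simp_thms)
  have cont: "continuous_on ?S (qform n B)"
    unfolding qform_def by (intro continuous_intros)
  have "\<exists>x\<in>?S. \<forall>y\<in>?S. qform n B y \<le> qform n B x"
  proof (rule continuous_attains_sup[OF compact_unit_sphere _ cont])
    show "?S \<noteq> {}"
    proof
      assume "?S = {}"
      with ne show False by (simp only: empty_iff)
    qed
  qed
  then obtain x0 where x0: "x0 \<in> ?S" and max: "\<forall>y\<in>?S. qform n B y \<le> qform n B x0"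
    by (rule bexE)
  define s where "s = qform n B x0"
  have norm_x0: "(cnorm n x0)\<^sup>2 = 1" using x0 by (simp add: cnorm_sq)
  \<comment> \<open>By homogeneity the maximality of \<open>x0\<close> extends from the sphere to all vectors.\<close>
  have top: "qform n B y \<le> s * (cnorm n y)\<^sup>2" for y
  proof (cases "cnorm n y = 0")
    case True
    then have "\<forall>j<n. y j = 0" by (simp add: L2_set_eq_0_iff)
    then have "qform n B y = 0" by (simp add: qform_def)
    with True show ?thesis by simp
  next
    case False
    define c where "c = cnorm n y"
    have c: "c > 0" using False by (simp add: c_def order_less_le)
    define y' where "y' i = (if i < n then of_real (1 / c) * y i else 0)" for i
    have "(\<Sum>i<n. (cmod (y' i))\<^sup>2) = (cnorm n (\<lambda>i. of_real (1 / c) * y i))\<^sup>2"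
      unfolding cnorm_sq by (simp add: y'_def)
    also have "\<dots> = 1"
      unfolding cnorm_scale c_def[symmetric] using c by (simp add: norm_divide power_mult_distrib)
    finally have "y' \<in> ?S" by (simp add: y'_def)
    then have "qform n B y' \<le> s" unfolding s_def by (rule max[rule_format])
    moreover have "qform n B y' = qform n B (\<lambda>i. of_real (1 / c) * y i)"
      by (simp add: qform_def y'_def)
    ultimately have "(1 / c)\<^sup>2 * qform n B y \<le> s" by (simp only: qform_scale)
    then show ?thesis
      using c by (simp add: c_def[symmetric] power_divide divide_le_eq)
  qed
  define v where "v j = (\<Sum>k<n. B j k * x0 k) - of_real s * x0 j" for j
  define K where "K = s * (cnorm n v)\<^sup>2 - qform n B v"
  have K0: "K \<ge> 0" using top[of v] by (simp add: K_def)
  have var: "2 * (cnorm n v)\<^sup>2 \<le> t * K" if t: "t > 0" for t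
  proof -
    have nrm: "(cnorm n (\<lambda>j. x0 j + of_real t * v j))\<^sup>2
        = 1 + 2 * t * Re (\<Sum>j<n. cnj (v j) * x0 j) + t\<^sup>2 * (cnorm n v)\<^sup>2"
    proof -
      have "(cmod (x0 j + of_real t * v j))\<^sup>2
          = (cmod (x0 j))\<^sup>2 + 2 * t * Re (cnj (v j) * x0 j) + t\<^sup>2 * (cmod (v j))\<^sup>2" for j
        unfolding cmod_power2 by (simp add: power2_eq_square algebra_simps)
      then have "(cnorm n (\<lambda>j. x0 j + of_real t * v j))\<^sup>2
          = (cnorm n x0)\<^sup>2 + 2 * t * Re (\<Sum>j<n. cnj (v j) * x0 j) + t\<^sup>2 * (cnorm n v)\<^sup>2"
        unfolding cnorm_sq by (simp only: sum.distrib Re_sum sum_distrib_left)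
      then show ?thesis by (simp only: norm_x0)
    qed
    have inner: "(\<Sum>j<n. cnj (v j) * (\<Sum>k<n. B j k * x0 k)) = of_real s * (\<Sum>j<n. cnj (v j) * x0 j) + of_real ((cnorm n v)\<^sup>2)"
    proof -
      have "(\<Sum>j<n. cnj (v j) * (\<Sum>k<n. B j k * x0 k)) = (\<Sum>j<n. of_real s * (cnj (v j) * x0 j) + cnj (v j) * v j)"
        by (intro sum.cong refl) (simp add: v_def algebra_simps)
      moreover have "(\<Sum>j<n. cnj (v j) * v j) = of_real ((cnorm n v)\<^sup>2)"
        unfolding cnorm_sq by (simp add: cnj_mult_self power2_eq_square)
      ultimately show ?thesis
        by (simp only: sum.distrib sum_distrib_left[symmetric])
    qed
    define S where "S = (\<Sum>j<n. cnj (v j) * x0 j)"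
    have "qform n B (\<lambda>j. x0 j + of_real t * v j)
       = qform n B x0 + 2 * t * Re (\<Sum>j<n. cnj (v j) * (\<Sum>k<n. B j k * x0 k)) + t\<^sup>2 * qform n B v"
      by (rule qform_add) (rule herm)
    also have "\<dots> = s + 2 * t * (s * Re S + (cnorm n v)\<^sup>2) + t\<^sup>2 * qform n B v"
      unfolding inner S_def[symmetric] s_def[symmetric] plus_complex.sel Re_complex_of_real by simp
    finally have "s + 2 * t * (s * Re S + (cnorm n v)\<^sup>2) + t\<^sup>2 * qform n B v
       \<le> s * (1 + 2 * t * Re S + t\<^sup>2 * (cnorm n v)\<^sup>2)"
      using top[of "\<lambda>j. x0 j + of_real t * v j"] unfolding nrm S_def[symmetric] by linarith
    then have "t * (2 * (cnorm n v)\<^sup>2) \<le> t * (t * K)"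
      unfolding K_def by (simp add: power2_eq_square algebra_simps)
    then show ?thesis using t by simp
  qed
  have "(cnorm n v)\<^sup>2 \<le> 0"
  proof (rule field_le_epsilon)
    fix e :: real assume e: "e > 0"
    \<comment> \<open>The step size \<open>e / (K + 1)\<close> makes the second-order term at most \<open>e\<close>.\<close>
    have "2 * (cnorm n v)\<^sup>2 \<le> e / (K + 1) * K" using e K0 by (intro var) auto
    also have "\<dots> \<le> e" using e K0 by (simp add: field_simps)
    finally show "(cnorm n v)\<^sup>2 \<le> 0 + e" using e by simp
  qed
  then have "v j = 0" if "j < n" for j using that by (simp add: L2_set_eq_0_iff)
  moreover have "\<exists>j<n. x0 j \<noteq> 0"
  proof (rule ccontr)
    assume "\<not> ?thesis"
    then have "(\<Sum>i<n. (cmod (x0 i))\<^sup>2) = 0" by simp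
    with x0 show False by simp
  qed
  ultimately have "s \<le> r" by (intro ev[of x0]) (auto simp: v_def)
  then have "s * (cnorm n x)\<^sup>2 \<le> r * (cnorm n x)\<^sup>2" by (intro mult_right_mono) auto
  with top[of x] show ?thesis by linarith
qed

section \<open>The loss of the iterates\<close>

lemma loss_le:
  assumes "cmod a = 1"
  shows "loss x zs \<le> (\<Sum>j<dim_vec zs. (cmod (x $ j * a - zs $ j))\<^sup>2)"
proof -
  obtain b where "\<forall>c\<in>sphere 0 1. loss x zs \<le> (\<Sum>j<dim_vec zs. (cmod (x $ j * c - zs $ j))\<^sup>2)"
    using loss_attained[of x zs] by blast
  then show ?thesis using assms by simp
qed

text \<open>
  For \<open>|b| = 1\<close> the sum of \<open>|x\<^sub>j b - z\<^sub>j|\<^sup>2\<close> is \<open>2 n - 2 Re (b S)\<close>, which is smallest when \<open>b S = |S|\<close>.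
\<close>

lemma aligned_loss_le:
  assumes x: "\<And>j. j < dim_vec zs \<Longrightarrow> cmod (x $ j) = 1" and zs: "\<And>j. j < dim_vec zs \<Longrightarrow> cmod (zs $ j) = 1"
  shows "(\<Sum>j<dim_vec zs. (cmod (x $ j * cnj (phase (\<Sum>k<dim_vec zs. x $ k * cnj (zs $ k))) - zs $ j))\<^sup>2) \<le> loss x zs"
proof -
  let ?n = "dim_vec zs"
  define S where "S = (\<Sum>k<?n. x $ k * cnj (zs $ k))"
  have val: "(\<Sum>j<?n. (cmod (x $ j * b - zs $ j))\<^sup>2) = 2 * real ?n - 2 * Re (b * S)" if b: "cmod b = 1" for b
  proof -
    have "(\<Sum>j<?n. (cmod (x $ j * b - zs $ j))\<^sup>2) = (\<Sum>j<?n. 2 - 2 * Re (b * (x $ j * cnj (zs $ j))))"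
    proof (intro sum.cong refl)
      fix j assume "j \<in> {..<?n}"
      then have 1: "cmod (x $ j * b) = 1" "cmod (zs $ j) = 1"
        using x zs b by (auto simp: norm_mult)
      have "(cmod (y - t))\<^sup>2 = (cmod y)\<^sup>2 + (cmod t)\<^sup>2 - 2 * Re (y * cnj t)" for y t
        unfolding cmod_power2 by (simp add: power2_eq_square algebra_simps)
      from this[of "x $ j * b" "zs $ j"]
      show "(cmod (x $ j * b - zs $ j))\<^sup>2 = 2 - 2 * Re (b * (x $ j * cnj (zs $ j)))"
        unfolding 1 by (simp only: mult_ac power_one)
    qed
    also have "\<dots> = 2 * real ?n - 2 * Re (b * S)"
      unfolding S_def sum_subtractf sum_distrib_left Re_sum by simp
    finally show ?thesis .
  qed
  obtain b where b: "cmod b = 1" "loss x zs = (\<Sum>j<?n. (cmod (x $ j * b - zs $ j))\<^sup>2)"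
    using loss_attained[of x zs] by auto
  have "(\<Sum>j<?n. (cmod (x $ j * cnj (phase S) - zs $ j))\<^sup>2) = 2 * real ?n - 2 * cmod S"
    by (subst val) (simp_all add: cnj_phase_mult)
  also have "\<dots> \<le> 2 * real ?n - 2 * Re (b * S)"
    using complex_Re_le_cmod[of "b * S"] b(1) by (simp add: norm_mult)
  also have "\<dots> = loss x zs" by (simp add: b val)
  finally show ?thesis by (simp add: S_def)
qed

lemma hadamard_entry:
  assumes "j < n" "k < n"
  shows "A_mat n a $$ (j, k) * Y_mat n zs \<sigma> w $$ (j, k)
    = of_real (adj a j k) * (zs $ j * cnj (zs $ k)) + of_real \<sigma> * (of_real (adj a j k) * herm w j k)"
  using assms by (auto simp: A_mat_def Y_mat_def Let_def adj_def herm_def algebra_simps)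

text \<open>
  Each step maps the loss \<open>l\<close> to at most \<open>\<eta> l + (1 + 7 \<eta>) \<sigma>\<^sup>2 / (2 p)\<close> as long as \<open>l \<le> \<eta> n / 2\<close>, a
  condition that it preserves. The constant terms sum to a geometric series, and
  \<open>(1 + 7 \<eta>) / (1 - \<eta>) \<le> 1 + 9 \<eta>\<close>.
\<close>

theorem gpm_loss_bound:
  fixes zs u :: "complex vec"
  assumes n: "0 < n" and zs: "zs \<in> phase_vecs n" and p: "0 < p" and \<sigma>: "0 < \<sigma>"
    and tr: "trace_power n (graph_entry n p a) k \<le> \<tau> ^ k"
      "trace_power n (noise_entry n Re a w) k \<le> \<tau> ^ k" "trace_power n (noise_entry n Im a w) k \<le> \<tau> ^ k"
    and k: "k = 2 ^ Suc r" and \<tau>: "0 \<le> \<tau>" and \<kappa>: "\<kappa> = 4 * sqrt \<tau>"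
    and \<eta>: "0 < \<eta>" "\<eta> \<le> 1 / 20"
    and degree: "\<And>j. j < n \<Longrightarrow> real n * p * (1 - \<eta> / 4) \<le> vertex_degree n a j"
    and imag: "Im_energy n (\<lambda>j. zs $ j) a w \<le> (1 + \<eta>)\<^sup>2 * (real n * (real n * p) / 2)"
    and bad: "4 * real (card {j \<in> {..<n}. Re (noise_row n (\<lambda>j. zs $ j) a w j) < - (\<eta> * (real n * p) / (4 * \<sigma>))})
      \<le> \<eta> * \<sigma>\<^sup>2 / (2 * p)"
    and gap: "4 * (\<kappa> * (1 + \<sigma>)) \<le> real n * p"
    and contraction: "70 / \<eta>\<^sup>2 * ((\<kappa> * (1 + \<sigma>) + p) / (real n * p))\<^sup>2 \<le> \<eta>"
    and start: "16 * (\<kappa> * (1 + \<sigma>))\<^sup>2 * real n / (real n * p)\<^sup>2 \<le> \<eta> * real n / 2"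
    and stay: "(1 + 7 * \<eta>) * (\<sigma>\<^sup>2 / (2 * p)) \<le> (1 - \<eta>) * (\<eta> * real n / 2)"
    and lead: "leading_eigenvector (hadamard (A_mat n a) (Y_mat n zs \<sigma> w)) u"
  shows "loss (gpm n (A_mat n a) (Y_mat n zs \<sigma> w) u t) zs
    \<le> \<eta> ^ t * (16 * (\<kappa> * (1 + \<sigma>))\<^sup>2 * real n / (real n * p)\<^sup>2) + (1 + 9 * \<eta>) * (\<sigma>\<^sup>2 / (2 * p))"
proof -
  have dim: "dim_vec zs = n" and unit: "\<And>j. j < n \<Longrightarrow> cmod (zs $ j) = 1"
    using zs by (auto simp: phase_vecs_def)
  have \<kappa>0: "0 \<le> \<kappa>" using \<tau> by (simp add: \<kappa>)
  interpret S: sync_instance n "adj a" "\<lambda>j k. of_real (adj a j k) * herm w j k" "\<lambda>j. zs $ j" \<sigma> p \<kappa>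
  proof
    show "cnorm n (\<lambda>j. \<Sum>k<n. of_real (adj a j k - of_bool (j \<noteq> k) * p) * x k) \<le> \<kappa> * cnorm n x" for x
    proof -
      have "cnorm n (\<lambda>j. \<Sum>k<n. of_real (adj a j k - of_bool (j \<noteq> k) * p) * x k) \<le> 2 * sqrt \<tau> * cnorm n x"
        by (rule graph_matrix_norm[OF tr(1) k \<tau>])
      also have "\<dots> \<le> \<kappa> * cnorm n x"
        using \<tau> by (intro mult_right_mono) (auto simp: \<kappa>)
      finally show ?thesis .
    qed
    show "cnorm n (\<lambda>j. \<Sum>k<n. of_real (adj a j k) * herm w j k * x k) \<le> \<kappa> * cnorm n x" for x
      unfolding \<kappa> by (rule noise_matrix_norm[OF tr(2,3) k \<tau>])
  qed (use n p \<sigma> \<kappa>0 unit in \<open>auto simp: adj_def herm_def\<close>)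
  let ?B = "hadamard (A_mat n a) (Y_mat n zs \<sigma> w)"
  have Bdim: "?B \<in> carrier_mat n n" by (simp add: hadamard_def A_mat_def)
  have entry: "A_mat n a $$ (j, k) * Y_mat n zs \<sigma> w $$ (j, k) = S.data j k" if "j < n" "k < n" for j k
    using hadamard_entry[OF that] by (simp add: S.data_def)
  have B: "?B $$ (j, k) = S.data j k" if "j < n" "k < n" for j k
    using that entry[OF that] by (simp add: hadamard_def A_mat_def)
  have herm: "S.data k j = cnj (S.data j k)" for j k
  proof -
    have "adj a k j = adj a j k" "herm w k j = cnj (herm w j k)"
      by (auto simp: adj_def herm_def)
    then show ?thesis by (simp add: S.data_def mult.commute[of "zs $ k"])
  qed
  have eigen: "(\<Sum>k<n. S.data j k * v $ k) = c * v $ j" if "eigenvector ?B v c" "j < n" for v c j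
  proof -
    have v: "v \<in> carrier_vec n" "?B *\<^sub>v v = c \<cdot>\<^sub>v v"
      using that(1) Bdim by (auto simp: eigenvector_def)
    have "(?B *\<^sub>v v) $ j = (\<Sum>k<n. S.data j k * v $ k)"
      using that(2) v(1) Bdim by (auto simp: scalar_prod_def B atLeast0LessThan intro!: sum.cong)
    then show ?thesis using v that(2) by simp
  qed
  define L0 where "L0 = 16 * (\<kappa> * (1 + \<sigma>))\<^sup>2 * real n / (real n * p)\<^sup>2"
  define T where "T = \<sigma>\<^sup>2 / (2 * p)"
  let ?z = "gpm n (A_mat n a) (Y_mat n zs \<sigma> w) u"
  obtain \<mu> where ev: "eigenvector ?B u (of_real \<mu>)" and top: "\<And>s. eigenvalue ?B (of_real s) \<Longrightarrow> s \<le> \<mu>"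
    using lead by (auto simp: leading_eigenvector_def)
  have u: "u \<in> carrier_vec n" "u \<noteq> 0\<^sub>v n"
    using ev Bdim by (auto simp: eigenvector_def)
  have start_loss: "loss (?z 0) zs \<le> L0"
  proof -
    have nz: "\<exists>j<n. u $ j \<noteq> 0"
    proof (rule ccontr)
      assume "\<not> ?thesis"
      then have "u = 0\<^sub>v n" using u(1) by (intro eq_vecI) auto
      with u(2) show False by simp
    qed
    have ray: "Re (\<Sum>j<n. cnj (x j) * (\<Sum>k<n. S.data j k * x k)) \<le> \<mu> * (cnorm n x)\<^sup>2" for x
    proof -
      have "qform n S.data x \<le> \<mu> * (cnorm n x)\<^sup>2"
      proof (rule rayleigh_le_eigenvalue_bound[OF n])
        fix s :: real and x :: "nat \<Rightarrow> complex"
        assume nz: "\<exists>j<n. x j \<noteq> 0" and eq: "\<forall>j<n. (\<Sum>k<n. S.data j k * x k) = of_real s * x j"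
        have "eigenvector ?B (vec n x) (of_real s)"
          unfolding eigenvector_def
        proof (intro conjI)
          show "vec n x \<in> carrier_vec (dim_row ?B)" using Bdim by simp
          show "vec n x \<noteq> 0\<^sub>v (dim_row ?B)"
          proof
            assume "vec n x = 0\<^sub>v (dim_row ?B)"
            then have "vec n x $ j = 0" if "j < n" for j using that Bdim by simp
            with nz show False by auto
          qed
          show "?B *\<^sub>v vec n x = of_real s \<cdot>\<^sub>v vec n x"
          proof (rule eq_vecI)
            fix j assume "j < dim_vec (of_real s \<cdot>\<^sub>v vec n x)"
            then have j: "j < n" by simp
            have "(?B *\<^sub>v vec n x) $ j = (\<Sum>k<n. S.data j k * x k)"
              using j Bdim by (auto simp: scalar_prod_def B atLeast0LessThan intro!: sum.cong)
            then show "(?B *\<^sub>v vec n x) $ j = (of_real s \<cdot>\<^sub>v vec n x) $ j" using eq j by simp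
          qed (use Bdim in simp)
        qed
        then have "eigenvalue ?B (of_real s)" unfolding eigenvalue_def by blast
        then show "s \<le> \<mu>" by (rule top)
      qed (rule herm)
      then show ?thesis by (simp add: qform_def)
    qed
    obtain b where b: "cmod b = 1" "(\<Sum>j<n. (cmod (phase (u $ j) * b - zs $ j))\<^sup>2) \<le> L0"
      using S.spectral_loss[OF eigen[OF ev] nz ray gap] unfolding L0_def by blast
    have "loss (?z 0) zs \<le> (\<Sum>j<n. (cmod (?z 0 $ j * b - zs $ j))\<^sup>2)"
      using loss_le[OF b(1), of "?z 0" zs] by (simp add: dim)
    also have "\<dots> = (\<Sum>j<n. (cmod (phase (u $ j) * b - zs $ j))\<^sup>2)"
      using u(1) by (intro sum.cong refl) (simp add: gpm_def)
    finally show ?thesis using b(2) by simp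
  qed
  have z_unit: "cmod (?z t $ j) = 1" if "j < n" for t j
  proof (cases t)
    case 0
    then show ?thesis using u(1) that by (simp add: gpm_def)
  next
    case (Suc s)
    then show ?thesis using that by (simp add: gpm_def gpm_step_def)
  qed
  have step: "loss (?z (Suc t)) zs \<le> \<eta> * loss (?z t) zs + (1 + 7 * \<eta>) * T"
    if small: "loss (?z t) zs \<le> \<eta> * real n / 2" for t
  proof -
    let ?x = "\<lambda>j. ?z t $ j"
    define b where "b = cnj (phase (\<Sum>k<n. ?x k * cnj (zs $ k)))"
    define l where "l = (\<Sum>k<n. (cmod (?x k * b - zs $ k))\<^sup>2)"
    have l_le: "l \<le> loss (?z t) zs"
      using aligned_loss_le[of zs "?z t"] z_unit unit by (simp add: dim l_def b_def)
    have l0: "0 \<le> l" by (simp add: l_def sum_nonneg)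
    have set_eq: "{j \<in> {..<n}. \<sigma> * Re (S.rotated_noise j) < - (\<eta> * (real n * p) / 4)}
      = {j \<in> {..<n}. Re (noise_row n (\<lambda>j. zs $ j) a w j) < - (\<eta> * (real n * p) / (4 * \<sigma>))}"
    proof -
      have "S.rotated_noise j = noise_row n (\<lambda>j. zs $ j) a w j" for j
        by (simp add: S.rotated_noise_def noise_row_def)
      moreover have "\<sigma> * y < - (c / 4) \<longleftrightarrow> y < - (c / (4 * \<sigma>))" for y c
        using \<sigma> by (simp add: field_simps)
      ultimately show ?thesis by simp
    qed
    have next_coord: "?z (Suc t) $ j = phase (\<Sum>k<n. S.data j k * ?x k)" if j: "j < n" for j
    proof -
      have "?z (Suc t) $ j = phase (\<Sum>k\<in>{..<n} - {j}. A_mat n a $$ (j, k) * Y_mat n zs \<sigma> w $$ (j, k) * ?x k)"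
        using j by (simp add: gpm_def gpm_step_def)
      also have "(\<Sum>k\<in>{..<n} - {j}. A_mat n a $$ (j, k) * Y_mat n zs \<sigma> w $$ (j, k) * ?x k)
        = (\<Sum>k\<in>{..<n} - {j}. S.data j k * ?x k)"
        using j entry by (intro sum.cong refl) simp
      also have "\<dots> = (\<Sum>k<n. S.data j k * ?x k)"
      proof (rule sum.mono_neutral_left)
        have "S.data j j = 0" unfolding S.data_def by (simp add: adj_def)
        then show "\<forall>k\<in>{..<n} - ({..<n} - {j}). S.data j k * ?x k = 0" by auto
      qed auto
      finally show ?thesis .
    qed
    have "loss (?z (Suc t)) zs \<le> (\<Sum>j<n. (cmod (?z (Suc t) $ j * b - zs $ j))\<^sup>2)"
      using loss_le[of b "?z (Suc t)" zs] by (simp add: dim b_def)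
    also have "\<dots> = (\<Sum>j<n. (cmod (phase (\<Sum>k<n. S.data j k * ?x k) * b - zs $ j))\<^sup>2)"
      by (intro sum.cong refl) (simp add: next_coord)
    also have "\<dots> \<le> 70 / \<eta>\<^sup>2 * ((\<kappa> * (1 + \<sigma>) + p) / (real n * p))\<^sup>2 * l + (1 + 7 * \<eta>) * (\<sigma>\<^sup>2 / (2 * p))"
      unfolding b_def l_def
    proof (rule S.power_step_loss)
      show "(\<Sum>j<n. (Im (S.rotated_noise j))\<^sup>2) \<le> (1 + \<eta>)\<^sup>2 * (real n * (real n * p) / 2)"
        using imag by (simp add: S.rotated_noise_def noise_row_def)
      show "4 * real (card {j \<in> {..<n}. \<sigma> * Re (S.rotated_noise j) < - (\<eta> * (real n * p) / 4)}) \<le> \<eta> * \<sigma>\<^sup>2 / (2 * p)"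
        unfolding set_eq by (rule bad)
      show "(\<Sum>k<n. (cmod (?x k * cnj (phase (\<Sum>k<n. ?x k * cnj (zs $ k))) - zs $ k))\<^sup>2) \<le> \<eta> * real n / 2"
        using l_le small by (simp add: l_def b_def)
    qed (use z_unit \<eta> degree in \<open>auto simp: vertex_degree_def\<close>)
    also have "\<dots> \<le> \<eta> * loss (?z t) zs + (1 + 7 * \<eta>) * (\<sigma>\<^sup>2 / (2 * p))"
      using contraction l_le l0 \<eta> by (intro add_right_mono mult_mono) auto
    finally show ?thesis by (simp add: T_def)
  qed
  have T0: "0 \<le> T" using p by (simp add: T_def)
  have L00: "0 \<le> L0" by (simp add: L0_def)
  have "loss (?z t) zs \<le> \<eta> * real n / 2 \<and> loss (?z t) zs \<le> \<eta> ^ t * L0 + (1 + 9 * \<eta>) * T"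
  proof (induction t)
    case 0
    have "loss (?z 0) zs \<le> \<eta> * real n / 2" using start_loss start by (simp add: L0_def)
    moreover have "loss (?z 0) zs \<le> \<eta> ^ 0 * L0 + (1 + 9 * \<eta>) * T"
      using start_loss T0 \<eta> by (simp add: add_increasing2)
    ultimately show ?case by blast
  next
    case (Suc t)
    have st: "loss (?z (Suc t)) zs \<le> \<eta> * loss (?z t) zs + (1 + 7 * \<eta>) * T"
      using Suc by (intro step) auto
    also have "\<dots> \<le> \<eta> * (\<eta> * real n / 2) + (1 + 7 * \<eta>) * T"
      using Suc \<eta> by (intro add_right_mono mult_left_mono) auto
    also have "\<dots> \<le> \<eta> * (\<eta> * real n / 2) + (1 - \<eta>) * (\<eta> * real n / 2)"
      using stay by (intro add_left_mono) (simp add: T_def)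
    also have "\<dots> = \<eta> * real n / 2" by (simp add: field_simps)
    finally have 1: "loss (?z (Suc t)) zs \<le> \<eta> * real n / 2" .
    have "loss (?z (Suc t)) zs \<le> \<eta> * (\<eta> ^ t * L0 + (1 + 9 * \<eta>) * T) + (1 + 7 * \<eta>) * T"
      using Suc \<eta> by (intro order_trans[OF st] add_right_mono mult_left_mono) auto
    also have "\<dots> = \<eta> ^ Suc t * L0 + (1 + 8 * \<eta> + 9 * \<eta>\<^sup>2) * T"
      by (simp add: power2_eq_square algebra_simps)
    also have "\<dots> \<le> \<eta> ^ Suc t * L0 + (1 + 9 * \<eta>) * T"
    proof (intro add_left_mono mult_right_mono T0)
      have "9 * \<eta>\<^sup>2 \<le> 9 * (\<eta> * (1 / 20))" unfolding power2_eq_square using \<eta> by (intro mult_left_mono) auto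
      then show "1 + 8 * \<eta> + 9 * \<eta>\<^sup>2 \<le> 1 + 9 * \<eta>" using \<eta> by simp
    qed
    finally show ?case using 1 by blast
  qed
  then show ?thesis by (simp add: L0_def T_def)
qed

section \<open>The good event\<close>

lemma subgaussian_const_mono: "K \<le> K' \<Longrightarrow> subgaussian_const K \<le> subgaussian_const K'"
  by (simp add: subgaussian_const_def)

lemma subgaussian_const_pos: "0 < subgaussian_const K"
  by (simp add: subgaussian_const_def)

text \<open>
  The Laplacian form is the form of the degrees minus that of the adjacency matrix. The mean of the
  latter contributes \<open>- p (\<Sum> g)\<^sup>2 \<le> 0\<close>, so beyond the maximal degree only the norm of the centred
  adjacency matrix and the diagonal term \<open>p\<close> appear.
\<close>

lemma graph_energy_le:
  assumes tr: "trace_power n (graph_entry n p a) k \<le> \<tau> ^ k" and k: "k = 2 ^ Suc r" and \<tau>: "0 \<le> \<tau>"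
    and p: "0 \<le> p" and d: "\<And>j. j < n \<Longrightarrow> vertex_degree n a j \<le> d"
  shows "graph_energy n a g \<le> (d + 2 * sqrt \<tau> + p) * (\<Sum>j<n. (g j)\<^sup>2)"
proof -
  let ?D = "\<lambda>j k. adj a j k - of_bool (j \<noteq> k) * p"
  let ?N = "\<Sum>j<n. (g j)\<^sup>2"
  have "graph_energy n a g = (\<Sum>(j, k)\<in>pairs n. adj a j k * ((g j)\<^sup>2 - g j * g k) + adj a k j * ((g k)\<^sup>2 - g k * g j))"
    unfolding graph_energy_def
    by (intro sum.cong refl) (auto simp: adj_def pairs_def power2_eq_square algebra_simps)
  also have "\<dots> = (\<Sum>j<n. \<Sum>k<n. adj a j k * ((g j)\<^sup>2 - g j * g k))"
    by (rule sum_over_pairs[symmetric]) (simp add: adj_def)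
  also have "\<dots> = (\<Sum>j<n. vertex_degree n a j * (g j)\<^sup>2) - (\<Sum>j<n. \<Sum>k<n. adj a j k * (g j * g k))"
    by (simp add: vertex_degree_def right_diff_distrib sum_subtractf sum_distrib_right)
  also have "(\<Sum>j<n. \<Sum>k<n. adj a j k * (g j * g k)) = (\<Sum>j<n. g j * (\<Sum>k<n. ?D j k * g k)) + p * ((\<Sum>j<n. g j)\<^sup>2 - ?N)"
  proof -
    have "(\<Sum>j<n. \<Sum>k<n. of_bool (j \<noteq> k) * (g j * g k)) = (\<Sum>j<n. \<Sum>k<n. g j * g k) - (\<Sum>j<n. \<Sum>k<n. of_bool (j = k) * (g j * g k))"
      unfolding sum_subtractf[symmetric] by (intro sum.cong refl) auto
    also have "(\<Sum>j<n. \<Sum>k<n. of_bool (j = k) * (g j * g k)) = ?N"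
      by (intro sum.cong refl)
        (simp add: of_bool_def if_distrib[of "\<lambda>x. x * _"] sum.delta' power2_eq_square cong: if_cong)
    also have "(\<Sum>j<n. \<Sum>k<n. g j * g k) = (\<Sum>j<n. g j)\<^sup>2"
      by (simp add: power2_eq_square sum_product)
    finally have off: "(\<Sum>j<n. \<Sum>k<n. of_bool (j \<noteq> k) * (g j * g k)) = (\<Sum>j<n. g j)\<^sup>2 - ?N" .
    have "(\<Sum>j<n. \<Sum>k<n. adj a j k * (g j * g k))
       = (\<Sum>j<n. \<Sum>k<n. g j * (?D j k * g k) + p * (of_bool (j \<noteq> k) * (g j * g k)))"
      by (intro sum.cong refl) (simp add: algebra_simps)
    also have "\<dots> = (\<Sum>j<n. g j * (\<Sum>k<n. ?D j k * g k)) + p * (\<Sum>j<n. \<Sum>k<n. of_bool (j \<noteq> k) * (g j * g k))"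
      by (simp only: sum.distrib sum_distrib_left)
    finally show ?thesis unfolding off .
  qed
  finally have eq: "graph_energy n a g = (\<Sum>j<n. vertex_degree n a j * (g j)\<^sup>2)
      - (\<Sum>j<n. g j * (\<Sum>k<n. ?D j k * g k)) - p * (\<Sum>j<n. g j)\<^sup>2 + p * ?N"
    by (simp add: algebra_simps)
  have 1: "(\<Sum>j<n. vertex_degree n a j * (g j)\<^sup>2) \<le> d * ?N"
    unfolding sum_distrib_left by (intro sum_mono mult_right_mono d) auto
  have 2: "\<bar>\<Sum>j<n. g j * (\<Sum>k<n. ?D j k * g k)\<bar> \<le> 2 * sqrt \<tau> * ?N"
  proof -
    let ?x = "\<lambda>j. complex_of_real (g j)"
    have "complex_of_real (\<Sum>j<n. g j * (\<Sum>k<n. ?D j k * g k)) = (\<Sum>j<n. cnj (?x j) * (\<Sum>k<n. of_real (?D j k) * ?x k))"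
      by (simp only: of_real_sum of_real_mult complex_cnj_complex_of_real)
    from arg_cong[OF this, of cmod]
    have "\<bar>\<Sum>j<n. g j * (\<Sum>k<n. ?D j k * g k)\<bar> = cmod (\<Sum>j<n. cnj (?x j) * (\<Sum>k<n. of_real (?D j k) * ?x k))"
      by (simp only: norm_of_real)
    also have "\<dots> \<le> cnorm n ?x * cnorm n (\<lambda>j. \<Sum>k<n. of_real (?D j k) * ?x k)"
      by (rule norm_sum_cnj_le)
    also have "\<dots> \<le> cnorm n ?x * (2 * sqrt \<tau> * cnorm n ?x)"
      by (intro mult_left_mono graph_matrix_norm[OF tr k \<tau>]) simp
    also have "\<dots> = 2 * sqrt \<tau> * (cnorm n ?x)\<^sup>2" by (simp add: power2_eq_square)
    also have "(cnorm n ?x)\<^sup>2 = ?N" unfolding cnorm_sq by simp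
    finally show ?thesis .
  qed
  have 3: "0 \<le> p * (\<Sum>j<n. g j)\<^sup>2" using p by simp
  have "(d + 2 * sqrt \<tau> + p) * ?N = d * ?N + 2 * sqrt \<tau> * ?N + p * ?N" by (simp only: distrib_right)
  with 1 2 3 show ?thesis unfolding eq by linarith
qed

lemma measure_pair_le_of_slices:
  assumes "prob_space M" "prob_space N" and S: "S \<in> sets (M \<Otimes>\<^sub>M N)" and b: "0 \<le> b"
    and slice: "\<And>x. x \<in> space M \<Longrightarrow> measure N (Pair x -` S) \<le> b"
  shows "measure (M \<Otimes>\<^sub>M N) S \<le> b"
proof -
  interpret M: prob_space M by fact
  interpret N: prob_space N by fact
  interpret MN: prob_space "M \<Otimes>\<^sub>M N" by (rule prob_space_pair) fact+
  have "emeasure (M \<Otimes>\<^sub>M N) S = (\<integral>\<^sup>+ x. emeasure N (Pair x -` S) \<partial>M)"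
    by (rule N.emeasure_pair_measure_alt[OF S])
  also have "\<dots> \<le> (\<integral>\<^sup>+ x. ennreal b \<partial>M)"
    by (intro nn_integral_mono) (simp add: N.emeasure_eq_measure slice ennreal_leI)
  also have "\<dots> = ennreal b" by (simp add: M.emeasure_space_1)
  finally show ?thesis using b by (simp add: MN.emeasure_eq_measure)
qed

lemma adj_measurable:
  assumes "j < n" "k < n"
  shows "(\<lambda>\<omega>. adj (fst \<omega>) j k) \<in> borel_measurable (sync_space n p)"
proof -
  have c: "(\<lambda>\<omega>. of_bool (fst \<omega> e) :: real) \<in> borel_measurable (sync_space n p)" if "e \<in> pairs n" for e
    unfolding sync_space_def
    by (rule measurable_compose[OF measurable_fst component_measurable_graph[OF that]])
  consider "j < k" | "k < j" | "j = k" by linarith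
  then show ?thesis
  proof cases
    case 1
    with c[of "(j, k)"] assms show ?thesis by (simp add: adj_def pairs_def)
  next
    case 2
    with c[of "(k, j)"] assms show ?thesis by (simp add: adj_def pairs_def)
  qed (simp add: adj_def)
qed

lemma noise_row_measurable_sync:
  assumes "j < n"
  shows "(\<lambda>\<omega>. noise_row n z (fst \<omega>) (snd \<omega>) j) \<in> borel_measurable (sync_space n p)"
proof (rule noise_row_measurable[OF _ adj_measurable assms])
  fix e assume "e \<in> pairs n"
  then show "(\<lambda>\<omega>. snd \<omega> e) \<in> borel_measurable (sync_space n p)"
    unfolding sync_space_def
    by (rule measurable_compose[OF measurable_snd noise_component_measurable])
qed

lemma vertex_degree_measurable:
  assumes "j < n"
  shows "(\<lambda>\<omega>. vertex_degree n (fst \<omega>) j) \<in> borel_measurable (sync_space n p)"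
  unfolding vertex_degree_def using assms by (intro borel_measurable_sum adj_measurable) auto

definition graph_ok :: "nat \<Rightarrow> real \<Rightarrow> real \<Rightarrow> nat \<Rightarrow> real \<Rightarrow> (nat \<times> nat \<Rightarrow> bool) \<Rightarrow> bool" where
  "graph_ok n p s k \<tau> a \<longleftrightarrow> (\<forall>j<n. \<bar>vertex_degree n a j - (real n - 1) * p\<bar> < 2 * s * (real n * p))
     \<and> trace_power n (graph_entry n p a) k < \<tau> ^ k"

text \<open>
  The excluded events concern the degrees, three trace moments, the squared imaginary parts and the
  number of coordinates with a strongly negative real noise. The last two are bounded
  conditionally on a graph with nearly regular degrees and a small trace moment.
\<close>

theorem good_event:
  fixes z :: "nat \<Rightarrow> complex"
  assumes n: "0 < n" and p: "0 < p" "p \<le> 1" and z: "\<And>j. j < n \<Longrightarrow> cmod (z j) = 1"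
    and k: "k = 2 ^ Suc r" "p * real n \<le> real k" and \<tau>: "\<tau> = exp 1 * subgaussian_const 4 * real k"
    and s: "0 < s" "s \<le> 1 / 2" and \<epsilon>: "0 < \<epsilon>" "\<epsilon> \<le> 1" and t: "0 < t" and x: "0 < x"
    and M: "real n * p + 2 * s * (real n * p) + 2 * sqrt \<tau> + p \<le> M"
  shows "\<exists>E\<in>sets (sync_space n p).
    measure (sync_space n p) E \<ge> 1 - (2 * real n * exp (- (s\<^sup>2 * (real n * p))) + 9 * real k / p * exp (- real k)
        + exp (- (real n * \<epsilon>\<^sup>2 / 16))) - real n * exp (- (t\<^sup>2 / (2 * (real n * p)))) / x
    \<and> (\<forall>(a, w)\<in>E. graph_ok n p s k \<tau> a
        \<and> trace_power n (noise_entry n Re a w) k < \<tau> ^ k \<and> trace_power n (noise_entry n Im a w) k < \<tau> ^ k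
        \<and> Im_energy n z a w < (1 + \<epsilon>) * (real n * M / 2)
        \<and> real (card {j \<in> {..<n}. Re (noise_row n z a w j) < - t}) < x)"
proof -
  define S where "S = sync_space n p"
  have S: "S = graph_space n p \<Otimes>\<^sub>M noise_space n" by (simp add: S_def sync_space_def)
  interpret S: prob_space S unfolding S_def by (rule prob_space_sync_space)
  define R where "R = real n * p"
  have R: "0 < R" using n p by (simp add: R_def)
  have \<tau>0: "0 < \<tau>" using subgaussian_const_pos[of 4] k(1) by (simp add: \<tau>)
  have kl: "k = 2 * 2 ^ r" "(2 :: nat) ^ r > 0" using k by auto
  have "0 < R + 2 * s * R + 2 * sqrt \<tau> + p"
    using R p s \<tau>0 by (intro add_pos_pos mult_pos_pos) auto
  then have M0: "0 < M" using M by (simp only: R_def)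

  define E1 where "E1 = {\<omega> \<in> space S. \<exists>j<n. 2 * s * R \<le> \<bar>vertex_degree n (fst \<omega>) j - (real n - 1) * p\<bar>}"
  define E2 where "E2 = {\<omega> \<in> space S. \<tau> ^ k \<le> trace_power n (graph_entry n p (fst \<omega>)) k}"
  define E3 where "E3 = {\<omega> \<in> space S. \<tau> ^ k \<le> trace_power n (noise_entry n Re (fst \<omega>) (snd \<omega>)) k}"
  define E4 where "E4 = {\<omega> \<in> space S. \<tau> ^ k \<le> trace_power n (noise_entry n Im (fst \<omega>) (snd \<omega>)) k}"
  define G where "G = space S - (E1 \<union> E2)"
  define E5 where "E5 = {\<omega> \<in> space S. \<omega> \<in> G \<and> (1 + \<epsilon>) * (real n * M / 2) \<le> Im_energy n z (fst \<omega>) (snd \<omega>)}"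
  define E6 where "E6 = {\<omega> \<in> space S. \<omega> \<in> G \<and> x \<le> real (card {j \<in> {..<n}. Re (noise_row n z (fst \<omega>) (snd \<omega>) j) < - t})}"

  have meas_E1: "E1 \<in> sets S"
  proof -
    have "E1 = (\<Union>j<n. {\<omega> \<in> space S. 2 * s * R \<le> \<bar>vertex_degree n (fst \<omega>) j - (real n - 1) * p\<bar>})"
      by (auto simp: E1_def)
    also have "\<dots> \<in> sets S"
    proof (intro sets.finite_UN)
      fix j assume "j \<in> {..<n}"
      then have [measurable]: "(\<lambda>\<omega>. vertex_degree n (fst \<omega>) j) \<in> borel_measurable S"
        unfolding S_def by (intro vertex_degree_measurable) simp
      show "{\<omega> \<in> space S. 2 * s * R \<le> \<bar>vertex_degree n (fst \<omega>) j - (real n - 1) * p\<bar>} \<in> sets S" by measurable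
    qed simp
    finally show ?thesis .
  qed
  have b1: "S.prob E1 \<le> 2 * real n * exp (- (s\<^sup>2 * R))"
    unfolding S
  proof (rule order_trans)
    interpret P: prob_space "noise_space n" by (rule prob_space_noise)
    let ?D = "{a \<in> space (graph_space n p). \<exists>j<n. 2 * s * R \<le> \<bar>vertex_degree n a j - (real n - 1) * p\<bar>}"
    have D: "?D \<in> sets (graph_space n p)"
    proof -
      have "?D = (\<Union>j<n. {a \<in> space (graph_space n p). 2 * s * R \<le> \<bar>vertex_degree n a j - (real n - 1) * p\<bar>})" by auto
      also have "\<dots> \<in> sets (graph_space n p)"
      proof (intro sets.finite_UN)
        fix j assume "j \<in> {..<n}"
        then have [measurable]: "(\<lambda>a. vertex_degree n a j) \<in> borel_measurable (graph_space n p)"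
          by (intro degree_measurable) simp
        show "{a \<in> space (graph_space n p). 2 * s * R \<le> \<bar>vertex_degree n a j - (real n - 1) * p\<bar>} \<in> sets (graph_space n p)" by measurable
      qed simp
      finally show ?thesis .
    qed
    have "E1 = ?D \<times> space (noise_space n)" by (auto simp: E1_def S space_pair_measure)
    then have "emeasure (graph_space n p \<Otimes>\<^sub>M noise_space n) E1 = emeasure (graph_space n p) ?D"
      using P.emeasure_pair_measure_Times[OF D, of "space (noise_space n)"] by (simp add: P.emeasure_space_1)
    then show "measure (graph_space n p \<Otimes>\<^sub>M noise_space n) E1 \<le> measure (graph_space n p) ?D"
      by (simp add: measure_def)
    show "measure (graph_space n p) ?D \<le> 2 * real n * exp (- (s\<^sup>2 * R))"
      unfolding R_def using s by (intro degree_tail n p) auto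
  qed

  note gt = graph_trace_power_tail[OF p kl(1,2) k(2)]
  have b2: "S.prob E2 \<le> 3 * real k / p * exp (- real k)"
    using gt(1) by (simp add: S_def E2_def \<tau>)
  have meas_E2: "E2 \<in> sets S"
  proof -
    have [measurable]: "(\<lambda>\<omega>. trace_power n (graph_entry n p (fst \<omega>)) k) \<in> borel_measurable S"
      using gt(2) by (simp add: S_def)
    show ?thesis unfolding E2_def by measurable
  qed
  have noise_part: "S.prob {\<omega> \<in> space S. \<tau> ^ k \<le> trace_power n (noise_entry n \<rho> (fst \<omega>) (snd \<omega>)) k} \<le> 3 * real k / p * exp (- real k)
      \<and> {\<omega> \<in> space S. \<tau> ^ k \<le> trace_power n (noise_entry n \<rho> (fst \<omega>) (snd \<omega>)) k} \<in> sets S"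
    if \<rho>: "\<rho> \<in> borel_measurable borel" "distr std_complex_gaussian borel \<rho> = half_normal" for \<rho>
  proof -
    note nt = noise_trace_power_tail[OF p kl(1,2) k(2) \<rho>]
    have [measurable]: "(\<lambda>\<omega>. trace_power n (noise_entry n \<rho> (fst \<omega>) (snd \<omega>)) k) \<in> borel_measurable S"
      using nt(2) by (simp add: S_def)
    have le: "(exp 1 * subgaussian_const (1 / 4) * real k) ^ k \<le> \<tau> ^ k"
      unfolding \<tau> using subgaussian_const_mono[of "1 / 4" 4] subgaussian_const_pos[of "1 / 4"]
      by (intro power_mono mult_right_mono mult_left_mono) auto
    have "S.prob {\<omega> \<in> space S. \<tau> ^ k \<le> trace_power n (noise_entry n \<rho> (fst \<omega>) (snd \<omega>)) k}
       \<le> S.prob {\<omega> \<in> space S. (exp 1 * subgaussian_const (1 / 4) * real k) ^ k \<le> trace_power n (noise_entry n \<rho> (fst \<omega>) (snd \<omega>)) k}"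
      using le by (intro S.finite_measure_mono) auto
    also have "\<dots> \<le> 3 * real k / p * exp (- real k)" using nt(1) by (simp add: S_def)
    finally show ?thesis by simp
  qed
  have b3: "S.prob E3 \<le> 3 * real k / p * exp (- real k)" and meas_E3: "E3 \<in> sets S"
    using noise_part[OF borel_measurable_Re distr_Re] by (simp_all add: E3_def)
  have b4: "S.prob E4 \<le> 3 * real k / p * exp (- real k)" and meas_E4: "E4 \<in> sets S"
    using noise_part[OF borel_measurable_Im distr_Im] by (simp_all add: E4_def)

  have meas_G [measurable]: "G \<in> sets S" using meas_E1 meas_E2 by (auto simp: G_def)
  have ok: "graph_ok n p s k \<tau> a" if "(a, w) \<in> G" for a w
    using that by (auto simp: G_def E1_def E2_def graph_ok_def R_def not_le)
  have deg_up: "vertex_degree n a j \<le> R + 2 * s * R" if "(a, w) \<in> G" "j < n" for a w j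
  proof -
    have "\<bar>vertex_degree n a j - (real n - 1) * p\<bar> < 2 * s * R"
      using ok[OF that(1)] that(2) by (auto simp: graph_ok_def R_def)
    then have "vertex_degree n a j < (real n - 1) * p + 2 * s * R" by linarith
    also have "(real n - 1) * p \<le> R" using p by (simp add: R_def algebra_simps)
    finally show ?thesis by simp
  qed
  have meas_E5: "E5 \<in> sets S"
  proof -
    have [measurable]: "(\<lambda>\<omega>. Im_energy n z (fst \<omega>) (snd \<omega>)) \<in> borel_measurable S"
      unfolding S_def using noise_row_measurable_sync
      by (intro borel_measurable_sum borel_measurable_power) (auto intro: measurable_compose[OF _ borel_measurable_Im])
    show ?thesis unfolding E5_def by measurable
  qed
  have b5: "S.prob E5 \<le> exp (- (real n * \<epsilon>\<^sup>2 / 16))"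
    unfolding S
  proof (rule measure_pair_le_of_slices[OF prob_space_graph prob_space_noise])
    interpret P: prob_space "noise_space n" by (rule prob_space_noise)
    show "E5 \<in> sets (graph_space n p \<Otimes>\<^sub>M noise_space n)" using meas_E5 by (simp add: S)
    fix a assume "a \<in> space (graph_space n p)"
    show "measure (noise_space n) (Pair a -` E5) \<le> exp (- (real n * \<epsilon>\<^sup>2 / 16))"
    proof (cases "\<exists>w. (a, w) \<in> G")
      case False
      then have "Pair a -` E5 = {}" by (auto simp: E5_def)
      then show ?thesis by simp
    next
      case True
      then obtain w0 where w0: "(a, w0) \<in> G" by blast
      have en: "graph_energy n a g \<le> M * (\<Sum>j<n. (g j)\<^sup>2)" for g
      proof -
        have "graph_energy n a g \<le> (R + 2 * s * R + 2 * sqrt \<tau> + p) * (\<Sum>j<n. (g j)\<^sup>2)"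
          using ok[OF w0] \<tau>0 p deg_up[OF w0] by (intro graph_energy_le[OF _ k(1)]) (auto simp: graph_ok_def)
        also have "\<dots> \<le> M * (\<Sum>j<n. (g j)\<^sup>2)"
          using M by (intro mult_right_mono) (auto simp: R_def sum_nonneg)
        finally show ?thesis .
      qed
      have "(\<lambda>w. Im_energy n z a w) \<in> borel_measurable (noise_space n)"
        using noise_row_measurable_noise by (intro borel_measurable_sum borel_measurable_power) (auto intro: measurable_compose[OF _ borel_measurable_Im])
      then have "measure (noise_space n) (Pair a -` E5)
         \<le> measure (noise_space n) {w \<in> space (noise_space n). (1 + \<epsilon>) * (real n * M / 2) \<le> Im_energy n z a w}"
        by (intro P.finite_measure_mono) (auto simp: E5_def S space_pair_measure)
      also have "\<dots> \<le> exp (- (real n * \<epsilon>\<^sup>2 / 16))"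
        by (rule Im_energy_tail[OF z en M0 \<epsilon>])
      finally show ?thesis .
    qed
  qed simp
  have meas_E6: "E6 \<in> sets S"
  proof -
    have eq: "real (card {j \<in> {..<n}. Re (noise_row n z (fst \<omega>) (snd \<omega>) j) < - t})
       = (\<Sum>j<n. of_bool (Re (noise_row n z (fst \<omega>) (snd \<omega>) j) < - t))" for \<omega>
      by (simp add: sum_of_bool_eq Int_def)
    have [measurable]: "(\<lambda>\<omega>. \<Sum>j<n. of_bool (Re (noise_row n z (fst \<omega>) (snd \<omega>) j) < - t) :: real) \<in> borel_measurable S"
    proof (intro borel_measurable_sum)
      fix j assume "j \<in> {..<n}"
      then have [measurable]: "(\<lambda>\<omega>. noise_row n z (fst \<omega>) (snd \<omega>) j) \<in> borel_measurable S"
        unfolding S_def by (intro noise_row_measurable_sync) simp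
      show "(\<lambda>\<omega>. of_bool (Re (noise_row n z (fst \<omega>) (snd \<omega>) j) < - t) :: real) \<in> borel_measurable S"
        unfolding of_bool_def by measurable
    qed
    show ?thesis unfolding E6_def eq by measurable
  qed
  have b6: "S.prob E6 \<le> real n * exp (- (t\<^sup>2 / (2 * R))) / x"
    unfolding S
  proof (rule measure_pair_le_of_slices[OF prob_space_graph prob_space_noise])
    interpret P: prob_space "noise_space n" by (rule prob_space_noise)
    show "E6 \<in> sets (graph_space n p \<Otimes>\<^sub>M noise_space n)" using meas_E6 by (simp add: S)
    show b0: "0 \<le> real n * exp (- (t\<^sup>2 / (2 * R))) / x" using x by simp
    fix a assume a: "a \<in> space (graph_space n p)"
    show "measure (noise_space n) (Pair a -` E6) \<le> real n * exp (- (t\<^sup>2 / (2 * R))) / x"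
    proof (cases "\<exists>w. (a, w) \<in> G")
      case False
      then have "Pair a -` E6 = {}" by (auto simp: E6_def)
      then show ?thesis using b0 by simp
    next
      case True
      then obtain w0 where w0: "(a, w0) \<in> G" by blast
      have deg: "vertex_degree n a j \<le> 2 * R" if "j < n" for j
      proof -
        have "2 * s * R \<le> 1 * R" using s R by (intro mult_right_mono) auto
        then show ?thesis using deg_up[OF w0 that] by simp
      qed
      let ?T = "{w \<in> space (noise_space n). x \<le> real (card {j \<in> {..<n}. Re (noise_row n z a w j) < - t})}"
      have T: "?T \<in> sets (noise_space n)"
      proof -
        have eq: "real (card {j \<in> {..<n}. Re (noise_row n z a w j) < - t}) = (\<Sum>j<n. of_bool (Re (noise_row n z a w j) < - t))" for w
          by (simp add: sum_of_bool_eq Int_def)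
        have [measurable]: "(\<lambda>w. \<Sum>j<n. of_bool (Re (noise_row n z a w j) < - t) :: real) \<in> borel_measurable (noise_space n)"
        proof (intro borel_measurable_sum)
          fix j assume "j \<in> {..<n}"
          then have [measurable]: "(\<lambda>w. noise_row n z a w j) \<in> borel_measurable (noise_space n)"
            by (intro noise_row_measurable_noise) simp
          show "(\<lambda>w. of_bool (Re (noise_row n z a w j) < - t) :: real) \<in> borel_measurable (noise_space n)"
            unfolding of_bool_def by measurable
        qed
        show ?thesis unfolding eq by measurable
      qed
      have "Pair a -` E6 \<subseteq> ?T"
        unfolding E6_def S space_pair_measure by (rule subsetI) (simp del: of_nat_le_iff)
      then have "measure (noise_space n) (Pair a -` E6) \<le> measure (noise_space n) ?T"
        using T by (rule P.finite_measure_mono)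
      also have "\<dots> \<le> real n * exp (- (t\<^sup>2 / (2 * R))) / x"
        by (rule bad_count_tail[OF z R deg t x])
      finally show ?thesis .
    qed
  qed

  define E where "E = space S - (E1 \<union> E2 \<union> E3 \<union> E4 \<union> E5 \<union> E6)"
  note meas = meas_E1 meas_E2 meas_E3 meas_E4 meas_E5 meas_E6
  have "S.prob E = 1 - S.prob (E1 \<union> E2 \<union> E3 \<union> E4 \<union> E5 \<union> E6)"
    unfolding E_def using meas by (intro S.prob_compl) auto
  moreover have "S.prob (E1 \<union> E2 \<union> E3 \<union> E4 \<union> E5 \<union> E6) \<le> S.prob E1 + S.prob E2 + S.prob E3 + S.prob E4 + S.prob E5 + S.prob E6"
    using meas by (intro order_trans[OF measure_Un_le] add_right_mono order_refl) auto
  moreover have "9 * real k / p * exp (- real k) = 3 * (3 * real k / p * exp (- real k))" by simp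
  ultimately have prob: "S.prob E \<ge> 1 - (2 * real n * exp (- (s\<^sup>2 * R)) + 9 * real k / p * exp (- real k)
        + exp (- (real n * \<epsilon>\<^sup>2 / 16))) - real n * exp (- (t\<^sup>2 / (2 * R))) / x"
    using b1 b2 b3 b4 b5 b6 by linarith
  have "E \<in> sets S" unfolding E_def using meas by auto
  moreover have "graph_ok n p s k \<tau> a
        \<and> trace_power n (noise_entry n Re a w) k < \<tau> ^ k \<and> trace_power n (noise_entry n Im a w) k < \<tau> ^ k
        \<and> Im_energy n z a w < (1 + \<epsilon>) * (real n * M / 2)
        \<and> real (card {j \<in> {..<n}. Re (noise_row n z a w j) < - t}) < x" if "(a, w) \<in> E" for a w
  proof -
    have G: "(a, w) \<in> G" using that by (auto simp: E_def G_def)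
    with that show ?thesis
      using ok[OF G] by (auto simp: E_def E3_def E4_def E5_def E6_def not_le)
  qed
  ultimately show ?thesis
    using prob unfolding S_def R_def by (intro bexI[of _ E]) auto
qed

section \<open>Choice of the parameters\<close>

text \<open>
  The operator norms of the centred adjacency matrix and of the masked noise are at most
  \<open>sqrt (norm_const * n p)\<close> on the good event.
\<close>

definition norm_const :: real where
  "norm_const = 32 * exp 1 * subgaussian_const 4"

lemma norm_const_pos: "0 < norm_const"
  by (simp add: norm_const_def subgaussian_const_pos)

lemma ex_power_2_between:
  fixes R :: real
  assumes "2 \<le> R"
  shows "\<exists>r. R \<le> 2 ^ Suc r \<and> 2 ^ Suc r \<le> 2 * R"
proof -
  define m where "m = (LEAST m :: nat. R \<le> 2 ^ m)"
  have ex: "\<exists>m :: nat. R \<le> 2 ^ m"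
    using real_arch_pow[of 2 R] by (auto intro: less_imp_le)
  have m: "R \<le> 2 ^ m" unfolding m_def by (rule LeastI_ex[OF ex])
  then have "m \<noteq> 0" using assms by (cases m) auto
  then obtain r where r: "m = Suc r" by (cases m) auto
  have "\<not> R \<le> 2 ^ r" using not_less_Least[of r "\<lambda>m. R \<le> 2 ^ m"] by (simp add: m_def[symmetric] r)
  with m r show ?thesis by (intro exI[of _ r]) auto
qed

text \<open>
  The assumptions give \<open>\<eta>\<^sup>2 R \<ge> 1024 ln n\<close>, and \<open>n\<close> and \<open>k\<close> are at least \<open>R\<close>, so each
  exponential is at most the fourth power of \<open>1 / n\<close>.
\<close>

lemma gpm_probability_terms:
  fixes n k :: nat and \<eta> R p :: real
  assumes n: "5 \<le> n" and p: "0 < p" "p \<le> 1" and R: "R = real n * p"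
    and log: "2 ^ 20 * ln (real n) \<le> R" and \<eta>: "0 < \<eta>" "ln (real n) / R \<le> \<eta> ^ 4"
    and k: "R \<le> real k" "real k \<le> 2 * R"
  shows "2 * real n * exp (- ((\<eta> / 16)\<^sup>2 * R)) + 9 * real k / p * exp (- real k) + exp (- (real n * \<eta>\<^sup>2 / 16)) \<le> 1 / real n"
proof -
  define L where "L = ln (real n)"
  have L: "L > 0" using n by (simp add: L_def)
  have R0: "R > 0" using n p by (simp add: R)
  have Rn: "R \<le> real n" using p n by (simp add: R mult_le_cancel_left1)
  have "(1024 * L)\<^sup>2 = (2 ^ 20 * L) * L" by (simp add: power2_eq_square)
  also have "\<dots> \<le> R * L" using log L by (intro mult_right_mono) (auto simp: L_def)
  also have "\<dots> = (L / R) * R\<^sup>2" using R0 by (simp add: power2_eq_square)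
  also have "\<dots> \<le> \<eta> ^ 4 * R\<^sup>2" using \<eta> by (intro mult_right_mono) (auto simp: L_def)
  also have "\<dots> = (\<eta>\<^sup>2 * R)\<^sup>2" by (simp add: power_mult_distrib)
  finally have big: "1024 * L \<le> \<eta>\<^sup>2 * R"
    by (rule power2_le_imp_le) (use R0 in simp)
  have e4: "exp (- (4 * L)) = 1 / real n ^ 4"
  proof -
    have "exp (- (4 * L)) = inverse (exp L ^ 4)"
      by (simp add: exp_minus exp_of_nat_mult[symmetric])
    then show ?thesis using n by (simp add: L_def divide_inverse)
  qed
  have "exp (- ((\<eta> / 16)\<^sup>2 * R)) \<le> exp (- (4 * L))"
    using big by (simp add: power_divide)
  then have 1: "2 * real n * exp (- ((\<eta> / 16)\<^sup>2 * R)) \<le> 2 * real n * (1 / real n ^ 4)"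
    unfolding e4 by (intro mult_left_mono) auto
  have "\<eta>\<^sup>2 * R \<le> \<eta>\<^sup>2 * real n" using Rn by (intro mult_left_mono) auto
  then have "exp (- (real n * \<eta>\<^sup>2 / 16)) \<le> exp (- (4 * L))"
    using big L by (simp add: mult.commute)
  then have 3: "exp (- (real n * \<eta>\<^sup>2 / 16)) \<le> 1 / real n ^ 4" unfolding e4 .
  have "4 * L \<le> 2 ^ 20 * L" using L by simp
  also have "\<dots> \<le> real k" using log k by (simp add: L_def)
  finally have "exp (- real k) \<le> 1 / real n ^ 4" unfolding e4[symmetric] by simp
  moreover have "9 * real k / p \<le> 18 * real n"
    using k p by (simp add: R field_simps)
  ultimately have 2: "9 * real k / p * exp (- real k) \<le> 18 * real n * (1 / real n ^ 4)"
    by (intro mult_mono) auto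
  have "2 * real n * (1 / real n ^ 4) + 18 * real n * (1 / real n ^ 4) + 1 / real n ^ 4 = (20 * real n + 1) / real n ^ 4"
    by (simp add: add_divide_distrib[symmetric])
  also have "\<dots> \<le> 1 / real n"
  proof -
    have "5 * 5 \<le> real n * real n" using n by (intro mult_mono) auto
    then have "21 * real n \<le> real n * real n * real n" using n by (intro mult_right_mono) auto
    then have "20 * real n + 1 \<le> real n * real n * real n" using n by linarith
    then have "20 * real n + 1 \<le> real n ^ 3" by (simp only: power3_eq_cube)
    then have "(20 * real n + 1) / real n ^ 4 \<le> real n ^ 3 / real n ^ 4" by (intro divide_right_mono) auto
    also have "\<dots> = 1 / real n" using n by (simp add: power3_eq_cube power4_eq_xxxx)
    finally show ?thesis .
  qed
  finally show ?thesis using 1 2 3 by linarith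
qed

text \<open>
  In terms of \<open>y\<close> one has \<open>R / \<sigma>\<^sup>2 = y ^ 4\<close> and \<open>\<eta> \<ge> 1 / y\<close>, so the Gaussian exponent
  \<open>\<eta>\<^sup>2 R / (32 \<sigma>\<^sup>2)\<close> is at least \<open>y\<^sup>2 / 32\<close>.
\<close>

lemma bad_count_term:
  fixes n :: nat and \<eta> R p \<sigma> :: real
  assumes n: "0 < n" and p: "0 < p" and \<sigma>: "0 < \<sigma>" and R: "R = real n * p"
    and \<eta>: "0 < \<eta>" "\<sigma>\<^sup>2 / R \<le> \<eta> ^ 4" and y: "y = (R / \<sigma>\<^sup>2) powr (1 / 4)"
    and tail: "8 * y ^ 5 * exp (- (y\<^sup>2 / 32)) \<le> exp (- y)"
  shows "real n * exp (- ((\<eta> * R / (4 * \<sigma>))\<^sup>2 / (2 * R))) / (\<eta> * \<sigma>\<^sup>2 / (8 * p)) \<le> exp (- y)"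
proof -
  have R0: "R > 0" using n p by (simp add: R)
  define Q where "Q = R / \<sigma>\<^sup>2"
  have Q: "Q > 0" using R0 \<sigma> by (simp add: Q_def)
  have y0: "y > 0" using Q by (simp add: y Q_def[symmetric])
  have y4: "y ^ 4 = Q"
    using Q y0 by (simp add: y Q_def[symmetric] powr_realpow[symmetric] powr_powr)
  have "(1 / y) ^ 4 \<le> \<eta> ^ 4"
    using \<eta>(2) by (simp add: power_divide y4 Q_def)
  then have \<eta>y: "1 / y \<le> \<eta>" using power_mono_iff[of "1 / y" \<eta> 4] y0 \<eta>(1) by simp
  have "real n * exp (- ((\<eta> * R / (4 * \<sigma>))\<^sup>2 / (2 * R))) / (\<eta> * \<sigma>\<^sup>2 / (8 * p))
     = 8 * (y ^ 4 * (1 / \<eta>)) * exp (- (\<eta>\<^sup>2 * y ^ 4 / 32))"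
  proof -
    have "(\<eta> * R / (4 * \<sigma>))\<^sup>2 / (2 * R) = \<eta>\<^sup>2 * Q / 32"
      using R0 by (simp add: Q_def power2_eq_square)
    moreover have "real n * E / (\<eta> * \<sigma>\<^sup>2 / (8 * p)) = 8 * (Q * (1 / \<eta>)) * E" for E
      by (simp add: Q_def R mult_ac)
    ultimately show ?thesis by (simp only: y4)
  qed
  also have "\<dots> \<le> 8 * (y ^ 4 * y) * exp (- (y\<^sup>2 / 32))"
  proof (intro mult_mono mult_left_mono)
    show "1 / \<eta> \<le> y" using \<eta>y \<eta> y0 by (simp add: field_simps)
    have "(1 / y)\<^sup>2 * y ^ 4 \<le> \<eta>\<^sup>2 * y ^ 4"
      using \<eta>y y0 by (intro mult_right_mono power_mono) auto
    then have "y\<^sup>2 \<le> \<eta>\<^sup>2 * y ^ 4" using y0 by (simp add: power2_eq_square power4_eq_xxxx)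
    then show "exp (- (\<eta>\<^sup>2 * y ^ 4 / 32)) \<le> exp (- (y\<^sup>2 / 32))" by simp
  qed (use y0 \<eta> in auto)
  also have "8 * (y ^ 4 * y) = 8 * y ^ 5" by (simp add: eval_nat_numeral)
  finally show ?thesis using tail by simp
qed

text \<open>
  The fourth power of \<open>\<eta>\<close> dominates \<open>ln n / R\<close>, \<open>(1 + \<sigma>\<^sup>2) / R\<close> and \<open>1 / n\<close>. The contraction factor of
  a step is of order \<open>(1 + \<sigma>\<^sup>2) / (\<eta>\<^sup>2 R) \<le> \<eta>\<^sup>2\<close>, and the degrees deviate from \<open>R\<close> by at most
  \<open>\<eta> R / 8\<close> plus \<open>p\<close>. The order \<open>k\<close> of the trace moments is a power of 2 between \<open>R\<close> and \<open>2 R\<close>.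
\<close>

theorem gpm_nonasymptotic:
  fixes n :: nat and p \<sigma> \<eta> R :: real
  assumes n: "5 \<le> n" and p: "0 < p" "p \<le> 1" and \<sigma>: "0 < \<sigma>" and R: "R = real n * p"
    and log: "2 ^ 20 * ln (real n) \<le> R"
    and \<eta>: "\<eta> = ((ln (real n) + \<sigma>\<^sup>2) / R) powr (1 / 4)" and small: "300 * (norm_const + 1) * \<eta> \<le> 1"
    and y: "y = (R / \<sigma>\<^sup>2) powr (1 / 4)" and tail: "8 * y ^ 5 * exp (- (y\<^sup>2 / 32)) \<le> exp (- y)"
    and zs: "zs \<in> phase_vecs n"
  shows "\<exists>E \<in> sets (sync_space n p).
    measure (sync_space n p) E \<ge> 1 - 1 / real n - exp (- y)
    \<and> (\<forall>(a, w) \<in> E. \<forall>u. leading_eigenvector (hadamard (A_mat n a) (Y_mat n zs \<sigma> w)) u \<longrightarrow>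
        (\<forall>t::nat. t \<ge> 1 \<and> real t \<ge> ln (1 / \<sigma>\<^sup>2) \<longrightarrow>
          loss (gpm n (A_mat n a) (Y_mat n zs \<sigma> w) u t) zs
            \<le> (1 + (9 + 128 * exp 1 * norm_const) * \<eta>) * (\<sigma>\<^sup>2 / (2 * p))))"
proof -
  let ?A = norm_const
  have A: "0 < ?A" by (rule norm_const_pos)
  have R0: "R > 0" using n p by (simp add: R)
  have Rn: "R \<le> real n" using p n by (simp add: R mult_le_cancel_left1)
  have lnn: "1 \<le> ln (real n)"
  proof -
    have "exp 1 \<le> real n" using n exp_le by linarith
    then show ?thesis using n by (simp add: ln_ge_iff)
  qed
  have ratio: "(ln (real n) + \<sigma>\<^sup>2) / R > 0" using lnn R0 by (intro divide_pos_pos add_pos_nonneg) auto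
  have \<eta>0: "0 < \<eta>" using ratio unfolding \<eta> powr_gt_zero by (metis less_irrefl)
  have \<eta>4: "\<eta> ^ 4 = (ln (real n) + \<sigma>\<^sup>2) / R"
  proof -
    have "(q powr (1 / 4)) ^ 4 = q" if "q > 0" for q :: real
      using that by (simp add: powr_realpow[symmetric] powr_powr)
    from this[OF ratio] show ?thesis by (simp only: \<eta>)
  qed
  have \<eta>A: "\<eta> * 300 \<le> 1" "\<eta> * (300 * ?A) \<le> 1"
  proof -
    have "300 * \<eta> + 300 * (\<eta> * ?A) \<le> 1" using small by (simp add: algebra_simps)
    moreover have "0 < \<eta> * ?A" using \<eta>0 A by simp
    moreover have "\<eta> * (300 * ?A) = 300 * (\<eta> * ?A)" by simp
    ultimately show "\<eta> * 300 \<le> 1" "\<eta> * (300 * ?A) \<le> 1" using \<eta>0 by linarith+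
  qed
  have \<eta>20: "\<eta> \<le> 1 / 20" using \<eta>A by simp
  have pow: "\<eta>\<^sup>2 \<le> \<eta> / 300" "\<eta> ^ 4 \<le> \<eta>\<^sup>2" "\<eta> ^ 4 \<le> \<eta> / 300" "\<eta>\<^sup>2 * (300 * ?A) \<le> \<eta>"
  proof -
    have "\<eta> * \<eta> \<le> \<eta> * (1 / 300)" using \<eta>A \<eta>0 by (intro mult_left_mono) auto
    then show 2: "\<eta>\<^sup>2 \<le> \<eta> / 300" by (simp add: power2_eq_square)
    show 4: "\<eta> ^ 4 \<le> \<eta>\<^sup>2" using \<eta>A \<eta>0 by (intro power_decreasing) auto
    show "\<eta> ^ 4 \<le> \<eta> / 300" using 2 4 by linarith
    have "\<eta> * (\<eta> * (300 * ?A)) \<le> \<eta> * 1" using \<eta>A \<eta>0 by (intro mult_left_mono) auto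
    then show "\<eta>\<^sup>2 * (300 * ?A) \<le> \<eta>" by (simp add: power2_eq_square mult.assoc)
  qed
  have \<eta>_log: "ln (real n) / R \<le> \<eta> ^ 4" and \<eta>_\<sigma>: "\<sigma>\<^sup>2 / R \<le> \<eta> ^ 4"
    and \<eta>_1\<sigma>: "(1 + \<sigma>\<^sup>2) / R \<le> \<eta> ^ 4" and \<eta>_R: "1 / R \<le> \<eta> ^ 4"
    unfolding \<eta>4 using R0 lnn zero_le_power2[of \<sigma>] by (intro divide_right_mono; linarith)+
  have n0: "real n > 0" using n by simp
  have inv_n: "1 / real n \<le> \<eta> ^ 4"
  proof -
    have "1 / real n \<le> 1 / R" using Rn R0 by (intro divide_left_mono) auto
    with \<eta>_R show ?thesis by linarith
  qed
  have p_le: "p \<le> \<eta> ^ 4 * R"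
    using mult_right_mono[OF inv_n, of R] R0 n0 by (simp add: R)
  have p_le': "p \<le> \<eta> * R / 8"
  proof -
    have "\<eta> ^ 4 * R \<le> \<eta> / 300 * R" using pow R0 by (intro mult_right_mono) auto
    with p_le have "p \<le> \<eta> / 300 * R" by linarith
    also have "\<dots> \<le> \<eta> * R / 8" using \<eta>0 R0 by simp
    finally show ?thesis .
  qed
  have R2: "2 \<le> R" using log lnn by simp
  obtain r where r: "R \<le> 2 ^ Suc r" "2 ^ Suc r \<le> 2 * R" using ex_power_2_between[OF R2] by blast
  define k :: nat where "k = 2 ^ Suc r"
  have k: "R \<le> real k" "real k \<le> 2 * R" using r by (simp_all add: k_def)
  define \<tau> where "\<tau> = exp 1 * subgaussian_const 4 * real k"
  define \<kappa> where "\<kappa> = 4 * sqrt \<tau>"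
  have \<tau>0: "0 \<le> \<tau>" using subgaussian_const_pos[of 4] by (simp add: \<tau>_def)
  have \<tau>R: "16 * \<tau> \<le> ?A * R"
  proof -
    have "16 * \<tau> \<le> 16 * (exp 1 * subgaussian_const 4 * (2 * R))"
      unfolding \<tau>_def using k subgaussian_const_pos[of 4] by (intro mult_left_mono) auto
    then show ?thesis by (simp add: norm_const_def)
  qed
  have \<kappa>2: "\<kappa>\<^sup>2 \<le> ?A * R" using \<tau>R \<tau>0 by (simp add: \<kappa>_def power_mult_distrib)
  have K2: "(\<kappa> * (1 + \<sigma>))\<^sup>2 \<le> ?A * R * (2 * (1 + \<sigma>\<^sup>2))"
    unfolding power_mult_distrib
  proof (rule mult_mono[OF \<kappa>2])
    show "(1 + \<sigma>)\<^sup>2 \<le> 2 * (1 + \<sigma>\<^sup>2)"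
      using sum_squares_bound[of 1 \<sigma>] by (simp add: power2_sum)
  qed (use A R0 in auto)
  define G where "G = \<kappa> * (1 + \<sigma>) / R"
  have G0: "0 \<le> G" using \<tau>0 \<sigma> R0 by (simp add: G_def \<kappa>_def)
  have G2: "G\<^sup>2 \<le> 2 * ?A * \<eta> ^ 4"
  proof -
    have "G\<^sup>2 \<le> ?A * R * (2 * (1 + \<sigma>\<^sup>2)) / R\<^sup>2"
      unfolding G_def power_divide by (intro divide_right_mono K2) auto
    also have "\<dots> = 2 * ?A * ((1 + \<sigma>\<^sup>2) / R)" using R0 by (simp add: power2_eq_square)
    also have "\<dots> \<le> 2 * ?A * \<eta> ^ 4" using A by (intro mult_left_mono \<eta>_1\<sigma>) auto
    finally show ?thesis .
  qed
  have G2': "G\<^sup>2 \<le> \<eta> / 150"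
  proof -
    have "?A * \<eta> ^ 4 \<le> ?A * \<eta>\<^sup>2" using A pow by (intro mult_left_mono) auto
    then have "300 * (?A * \<eta> ^ 4) \<le> \<eta>" using pow(4) by (simp add: mult_ac)
    then show ?thesis using G2 by (simp add: mult.assoc)
  qed
  have gap: "4 * (\<kappa> * (1 + \<sigma>)) \<le> real n * p"
  proof -
    have "(4 * G)\<^sup>2 \<le> 1\<^sup>2" using G2' \<eta>20 by (simp add: power_mult_distrib)
    then have "4 * G \<le> 1" by (rule power2_le_imp_le) simp
    then have "4 * (\<kappa> * (1 + \<sigma>)) \<le> R" using R0 by (simp add: G_def field_simps)
    then show ?thesis by (simp only: R)
  qed
  have contraction: "70 / \<eta>\<^sup>2 * ((\<kappa> * (1 + \<sigma>) + p) / (real n * p))\<^sup>2 \<le> \<eta>"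
  proof -
    have "(\<kappa> * (1 + \<sigma>) + p) / (real n * p) = G + 1 / real n"
      using p n0 by (simp add: G_def R add_divide_distrib)
    moreover have "(G + 1 / real n)\<^sup>2 \<le> (4 * ?A + 2) * \<eta> ^ 4"
    proof -
      have "(G + 1 / real n)\<^sup>2 \<le> 2 * G\<^sup>2 + 2 * (1 / real n)\<^sup>2"
        using sum_squares_bound[of G "1 / real n"] by (simp add: power2_sum)
      moreover have "(1 / real n)\<^sup>2 \<le> \<eta> ^ 4"
      proof -
        have "(1 / real n)\<^sup>2 \<le> 1 / real n" using n0 n by (simp add: power2_eq_square divide_simps)
        with inv_n show ?thesis by linarith
      qed
      ultimately have "(G + 1 / real n)\<^sup>2 \<le> 2 * (2 * ?A * \<eta> ^ 4) + 2 * \<eta> ^ 4" using G2 by linarith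
      then show ?thesis by (simp add: algebra_simps)
    qed
    ultimately have "70 / \<eta>\<^sup>2 * ((\<kappa> * (1 + \<sigma>) + p) / (real n * p))\<^sup>2 \<le> 70 / \<eta>\<^sup>2 * ((4 * ?A + 2) * \<eta> ^ 4)"
      using \<eta>0 by (intro mult_left_mono) auto
    also have "\<dots> = 280 * (?A * \<eta>\<^sup>2) + 140 * \<eta>\<^sup>2"
      using \<eta>0 by (simp add: power2_eq_square power4_eq_xxxx algebra_simps)
    also have "\<dots> \<le> \<eta>"
    proof -
      have "300 * (?A + 1) * \<eta> * \<eta> \<le> 1 * \<eta>" using small \<eta>0 by (intro mult_right_mono) auto
      then have "300 * (?A * \<eta>\<^sup>2) + 300 * \<eta>\<^sup>2 \<le> \<eta>" by (simp add: power2_eq_square algebra_simps)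
      moreover have "0 \<le> ?A * \<eta>\<^sup>2" "0 \<le> \<eta>\<^sup>2" using A by auto
      ultimately show ?thesis by linarith
    qed
    finally show ?thesis .
  qed
  have L0_eq: "16 * (\<kappa> * (1 + \<sigma>))\<^sup>2 * real n / (real n * p)\<^sup>2 = 16 * G\<^sup>2 * real n"
    by (simp add: G_def R power_divide)
  have start: "16 * (\<kappa> * (1 + \<sigma>))\<^sup>2 * real n / (real n * p)\<^sup>2 \<le> \<eta> * real n / 2"
  proof -
    have "16 * G\<^sup>2 \<le> \<eta> / 2" using G2' \<eta>0 by simp
    then have "16 * G\<^sup>2 * real n \<le> \<eta> / 2 * real n" by (rule mult_right_mono) simp
    then show ?thesis unfolding L0_eq by simp
  qed
  have stay: "(1 + 7 * \<eta>) * (\<sigma>\<^sup>2 / (2 * p)) \<le> (1 - \<eta>) * (\<eta> * real n / 2)"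
  proof -
    have "\<sigma>\<^sup>2 / (2 * p) = \<sigma>\<^sup>2 / R * (real n / 2)" using p n0 by (simp add: R)
    also have "\<dots> \<le> \<eta> / 300 * (real n / 2)" using order_trans[OF \<eta>_\<sigma> pow(3)] by (rule mult_right_mono) simp
    finally have "(1 + 7 * \<eta>) * (\<sigma>\<^sup>2 / (2 * p)) \<le> 2 * (\<eta> / 300 * (real n / 2))"
      using \<eta>20 \<eta>0 p by (intro mult_mono) auto
    also have "\<dots> \<le> (1 / 2) * (\<eta> * real n / 2)" using \<eta>0 by simp
    also have "\<dots> \<le> (1 - \<eta>) * (\<eta> * real n / 2)" using \<eta>20 \<eta>0 by (intro mult_right_mono) auto
    finally show ?thesis .
  qed
  have M: "real n * p + 2 * (\<eta> / 16) * (real n * p) + 2 * sqrt \<tau> + p \<le> (1 + \<eta>) * R"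
  proof -
    have "2 * sqrt \<tau> \<le> \<eta> * R / 2"
    proof (rule power2_le_imp_le)
      have "?A \<le> \<eta>\<^sup>2 * R"
      proof -
        have "?A * \<eta>\<^sup>2 \<le> 1" using pow(4) \<eta>20 A by (simp add: mult_ac)
        moreover have "1 \<le> \<eta> ^ 4 * R" using \<eta>_R R0 by (simp add: divide_le_eq)
        ultimately have "?A * \<eta>\<^sup>2 \<le> (\<eta>\<^sup>2 * R) * \<eta>\<^sup>2" by (simp add: power2_eq_square power4_eq_xxxx mult_ac)
        then show ?thesis using \<eta>0 by (simp add: mult.commute)
      qed
      from mult_right_mono[OF this, of R] R0 have "?A * R \<le> \<eta>\<^sup>2 * R\<^sup>2" by (simp add: power2_eq_square mult_ac)
      then have "16 * \<tau> \<le> \<eta>\<^sup>2 * R\<^sup>2" using \<tau>R by linarith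
      then show "(2 * sqrt \<tau>)\<^sup>2 \<le> (\<eta> * R / 2)\<^sup>2" using \<tau>0 by (simp add: power_mult_distrib power_divide)
    qed (use \<eta>0 R0 in simp)
    moreover have "2 * (\<eta> / 16) * R = \<eta> * R / 8" by simp
    moreover have "0 < \<eta> * R" using \<eta>0 R0 by simp
    moreover have "(1 + \<eta>) * R = R + \<eta> * R" by (simp add: algebra_simps)
    ultimately show ?thesis using p_le' unfolding R[symmetric] by linarith
  qed
  have unit: "cmod (zs $ j) = 1" if "j < n" for j using zs that by (auto simp: phase_vecs_def)
  have "\<exists>E\<in>sets (sync_space n p).
    measure (sync_space n p) E \<ge> 1 - (2 * real n * exp (- ((\<eta> / 16)\<^sup>2 * (real n * p))) + 9 * real k / p * exp (- real k)
        + exp (- (real n * \<eta>\<^sup>2 / 16))) - real n * exp (- ((\<eta> * R / (4 * \<sigma>))\<^sup>2 / (2 * (real n * p)))) / (\<eta> * \<sigma>\<^sup>2 / (8 * p))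
    \<and> (\<forall>(a, w)\<in>E. graph_ok n p (\<eta> / 16) k \<tau> a
        \<and> trace_power n (noise_entry n Re a w) k < \<tau> ^ k \<and> trace_power n (noise_entry n Im a w) k < \<tau> ^ k
        \<and> Im_energy n (\<lambda>j. zs $ j) a w < (1 + \<eta>) * (real n * ((1 + \<eta>) * R) / 2)
        \<and> real (card {j \<in> {..<n}. Re (noise_row n (\<lambda>j. zs $ j) a w j) < - (\<eta> * R / (4 * \<sigma>))}) < \<eta> * \<sigma>\<^sup>2 / (8 * p))"
  proof (rule good_event[OF _ p _ k_def _ \<tau>_def])
    show "p * real n \<le> real k" using k by (simp add: R mult.commute)
  qed (use n unit \<eta>0 \<eta>20 R0 \<sigma> p M in auto)
  then obtain E where E: "E \<in> sets (sync_space n p)"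
    and prob: "measure (sync_space n p) E \<ge> 1 - (2 * real n * exp (- ((\<eta> / 16)\<^sup>2 * R)) + 9 * real k / p * exp (- real k)
        + exp (- (real n * \<eta>\<^sup>2 / 16))) - real n * exp (- ((\<eta> * R / (4 * \<sigma>))\<^sup>2 / (2 * R))) / (\<eta> * \<sigma>\<^sup>2 / (8 * p))"
    and good: "\<And>a w. (a, w) \<in> E \<Longrightarrow> graph_ok n p (\<eta> / 16) k \<tau> a
        \<and> trace_power n (noise_entry n Re a w) k < \<tau> ^ k \<and> trace_power n (noise_entry n Im a w) k < \<tau> ^ k
        \<and> Im_energy n (\<lambda>j. zs $ j) a w < (1 + \<eta>) * (real n * ((1 + \<eta>) * R) / 2)
        \<and> real (card {j \<in> {..<n}. Re (noise_row n (\<lambda>j. zs $ j) a w j) < - (\<eta> * R / (4 * \<sigma>))}) < \<eta> * \<sigma>\<^sup>2 / (8 * p)"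
    unfolding R[symmetric] by blast
  have "measure (sync_space n p) E \<ge> 1 - 1 / real n - exp (- y)"
    using prob gpm_probability_terms[OF n p R log \<eta>0 \<eta>_log k]
      bad_count_term[OF _ p(1) \<sigma> R \<eta>0 \<eta>_\<sigma> y tail] n by linarith
  moreover have "loss (gpm n (A_mat n a) (Y_mat n zs \<sigma> w) u t) zs
      \<le> (1 + (9 + 128 * exp 1 * ?A) * \<eta>) * (\<sigma>\<^sup>2 / (2 * p))"
    if aw: "(a, w) \<in> E" and lead: "leading_eigenvector (hadamard (A_mat n a) (Y_mat n zs \<sigma> w)) u"
      and t: "t \<ge> 1" "real t \<ge> ln (1 / \<sigma>\<^sup>2)" for a w u t
  proof -
    note g = good[OF aw]
    have "loss (gpm n (A_mat n a) (Y_mat n zs \<sigma> w) u t) zs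
      \<le> \<eta> ^ t * (16 * (\<kappa> * (1 + \<sigma>))\<^sup>2 * real n / (real n * p)\<^sup>2) + (1 + 9 * \<eta>) * (\<sigma>\<^sup>2 / (2 * p))"
    proof (rule gpm_loss_bound[OF _ zs p(1) \<sigma> _ _ _ k_def \<tau>0 \<kappa>_def \<eta>0 \<eta>20 _ _ _ gap contraction start stay lead])
      show "real n * p * (1 - \<eta> / 4) \<le> vertex_degree n a j" if "j < n" for j
      proof -
        have "\<bar>vertex_degree n a j - (real n - 1) * p\<bar> < 2 * (\<eta> / 16) * R"
          using g that by (simp add: graph_ok_def R)
        then have "vertex_degree n a j > (real n - 1) * p - \<eta> * R / 8"
          unfolding abs_less_iff by linarith
        moreover have "(real n - 1) * p = R - p" by (simp add: R algebra_simps)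
        moreover have "R * (1 - \<eta> / 4) = R - \<eta> * R / 8 - \<eta> * R / 8" by (simp add: algebra_simps)
        ultimately show ?thesis using p_le' unfolding R[symmetric] by linarith
      qed
      show "Im_energy n (\<lambda>j. zs $ j) a w \<le> (1 + \<eta>)\<^sup>2 * (real n * (real n * p) / 2)"
      proof -
        have "(1 + \<eta>) * (real n * ((1 + \<eta>) * R) / 2) = (1 + \<eta>)\<^sup>2 * (real n * R / 2)"
          by (simp add: power2_eq_square)
        then show ?thesis using g unfolding R[symmetric] by linarith
      qed
      show "4 * real (card {j \<in> {..<n}. Re (noise_row n (\<lambda>j. zs $ j) a w j) < - (\<eta> * (real n * p) / (4 * \<sigma>))})
          \<le> \<eta> * \<sigma>\<^sup>2 / (2 * p)"
      proof -
        have "4 * real (card {j \<in> {..<n}. Re (noise_row n (\<lambda>j. zs $ j) a w j) < - (\<eta> * R / (4 * \<sigma>))}) \<le> 4 * (\<eta> * \<sigma>\<^sup>2 / (8 * p))"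
          using g by (intro mult_left_mono) auto
        then show ?thesis unfolding R[symmetric] by simp
      qed
    qed (use g n in \<open>auto simp: graph_ok_def intro: less_imp_le\<close>)
    also have "\<eta> ^ t * (16 * (\<kappa> * (1 + \<sigma>))\<^sup>2 * real n / (real n * p)\<^sup>2) \<le> 128 * exp 1 * ?A * \<eta> * (\<sigma>\<^sup>2 / (2 * p))"
    proof -
      have L0: "16 * (\<kappa> * (1 + \<sigma>))\<^sup>2 * real n / (real n * p)\<^sup>2 \<le> 32 * ?A / p * (1 + \<sigma>\<^sup>2)"
      proof -
        have "16 * (\<kappa> * (1 + \<sigma>))\<^sup>2 * real n / (real n * p)\<^sup>2 \<le> 16 * (?A * R * (2 * (1 + \<sigma>\<^sup>2))) * real n / (real n * p)\<^sup>2"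
          by (intro divide_right_mono mult_right_mono mult_left_mono K2) auto
        also have "\<dots> = 32 * ?A / p * (1 + \<sigma>\<^sup>2)"
          using n0 p by (simp add: R power2_eq_square)
        finally show ?thesis .
      qed
      have decay: "\<eta> ^ t * (1 + \<sigma>\<^sup>2) \<le> exp 1 * \<eta> * (2 * \<sigma>\<^sup>2)"
      proof -
        have e\<eta>: "exp 1 * \<eta> \<le> 1"
        proof -
          have "exp 1 * \<eta> \<le> 3 * \<eta>" using exp_le \<eta>0 by (intro mult_right_mono) auto
          then show ?thesis using \<eta>20 by simp
        qed
        have "\<eta> ^ t = (exp 1 * \<eta>) ^ t * exp (- real t)"
          by (simp add: power_mult_distrib exp_minus exp_of_nat_mult[symmetric])
        also have "\<dots> \<le> (exp 1 * \<eta>) ^ 1 * exp (- real t)"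
          using e\<eta> \<eta>0 t by (intro mult_right_mono power_decreasing) auto
        finally have "\<eta> ^ t * (1 + \<sigma>\<^sup>2) \<le> exp 1 * \<eta> * exp (- real t) * (1 + \<sigma>\<^sup>2)"
          by (intro mult_right_mono) auto
        moreover have "exp (- real t) * (1 + \<sigma>\<^sup>2) \<le> 2 * \<sigma>\<^sup>2"
        \<comment> \<open>The lower bound \<open>ln (1 / \<sigma>\<^sup>2)\<close> for \<open>t\<close> matters only for small noise; otherwise \<open>t \<ge> 0\<close> is enough.\<close>
        proof (cases "\<sigma>\<^sup>2 \<le> 1")
          case True
          have "- real t \<le> ln (\<sigma>\<^sup>2)" using t(2) \<sigma> by (simp add: ln_div)
          then have "exp (- real t) \<le> \<sigma>\<^sup>2" using \<sigma> by (simp add: ln_ge_iff)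
          then have "exp (- real t) * (1 + \<sigma>\<^sup>2) \<le> \<sigma>\<^sup>2 * 2" using True by (intro mult_mono) auto
          then show ?thesis by simp
        next
          case False
          have "exp (- real t) * (1 + \<sigma>\<^sup>2) \<le> 1 * (1 + \<sigma>\<^sup>2)" by (intro mult_right_mono) auto
          also have "\<dots> \<le> 2 * \<sigma>\<^sup>2" using False by simp
          finally show ?thesis .
        qed
        then have "exp 1 * \<eta> * (exp (- real t) * (1 + \<sigma>\<^sup>2)) \<le> exp 1 * \<eta> * (2 * \<sigma>\<^sup>2)"
          using \<eta>0 by (intro mult_left_mono) auto
        ultimately show ?thesis by (simp only: mult.assoc)
      qed
      have "\<eta> ^ t * (16 * (\<kappa> * (1 + \<sigma>))\<^sup>2 * real n / (real n * p)\<^sup>2) \<le> \<eta> ^ t * (32 * ?A / p * (1 + \<sigma>\<^sup>2))"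
        using \<eta>0 by (intro mult_left_mono L0) auto
      also have "\<dots> = 32 * ?A / p * (\<eta> ^ t * (1 + \<sigma>\<^sup>2))" by (simp only: mult_ac)
      also have "\<dots> \<le> 32 * ?A / p * (exp 1 * \<eta> * (2 * \<sigma>\<^sup>2))"
        using A p by (intro mult_left_mono decay) auto
      also have "\<dots> = 128 * exp 1 * ?A * \<eta> * (\<sigma>\<^sup>2 / (2 * p))" by simp
      finally show ?thesis .
    qed
    finally have "loss (gpm n (A_mat n a) (Y_mat n zs \<sigma> w) u t) zs
      \<le> 128 * exp 1 * ?A * \<eta> * (\<sigma>\<^sup>2 / (2 * p)) + (1 + 9 * \<eta>) * (\<sigma>\<^sup>2 / (2 * p))" by simp
    moreover have "128 * exp 1 * ?A * \<eta> * T + (1 + 9 * \<eta>) * T = (1 + (9 + 128 * exp 1 * ?A) * \<eta>) * T" for T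
      by (simp add: algebra_simps)
    ultimately show ?thesis by (simp only:)
  qed
  ultimately show ?thesis using E by (intro bexI[of _ E]) auto
qed

theorem theorem3p1:
  fixes p \<sigma> :: "nat \<Rightarrow> real"
  assumes p: "\<And>n. 0 < p n \<and> p n \<le> 1"
    and \<sigma>: "\<And>n. 0 < \<sigma> n"
    and noise: "(\<lambda>n. (\<sigma> n)\<^sup>2) \<in> o(\<lambda>n. real n * p n)"
    and degree: "filterlim (\<lambda>n. real n * p n / ln (real n)) at_top sequentially"
  shows "\<exists>\<delta> :: nat \<Rightarrow> real.
      \<delta> \<in> o(\<lambda>_. 1)
    \<and> \<delta> \<in> O(\<lambda>n. ((ln (real n) + (\<sigma> n)\<^sup>2) / (real n * p n)) powr (1/4))
    \<and> (\<forall>\<^sub>F n in sequentially. \<forall>zs \<in> phase_vecs n.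
        \<exists>E \<in> sets (sync_space n (p n)).
          measure (sync_space n (p n)) E
            \<ge> 1 - 1 / real n - exp (- ((real n * p n / (\<sigma> n)\<^sup>2) powr (1/4)))
        \<and> (\<forall>(a, w) \<in> E.
            let A = A_mat n a; Y = Y_mat n zs (\<sigma> n) w in
            \<forall>u. leading_eigenvector (hadamard A Y) u \<longrightarrow>
              (\<forall>t::nat. t \<ge> 1 \<and> real t \<ge> ln (1 / (\<sigma> n)\<^sup>2) \<longrightarrow>
                loss (gpm n A Y u t) zs \<le> (1 + \<delta> n) * ((\<sigma> n)\<^sup>2 / (2 * p n)))))"
proof -
  define R where "R n = real n * p n" for n
  define \<eta> where "\<eta> n = ((ln (real n) + (\<sigma> n)\<^sup>2) / R n) powr (1/4)" for n
  define C where "C = 9 + 128 * exp 1 * norm_const"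
  have ratio: "(\<lambda>n. (ln (real n) + (\<sigma> n)\<^sup>2) / R n) \<longlonglongrightarrow> 0"
  proof -
    have "(\<lambda>n. inverse (R n / ln (real n))) \<longlonglongrightarrow> 0"
      using degree unfolding R_def by (rule tendsto_inverse_0_at_top)
    then have "(\<lambda>n. ln (real n) / R n) \<longlonglongrightarrow> 0" by simp
    moreover have "(\<lambda>n. (\<sigma> n)\<^sup>2 / R n) \<longlonglongrightarrow> 0"
      using smalloD_tendsto[OF noise] by (simp add: R_def)
    ultimately have "(\<lambda>n. ln (real n) / R n + (\<sigma> n)\<^sup>2 / R n) \<longlonglongrightarrow> 0 + 0" by (rule tendsto_add)
    then show ?thesis by (simp add: add_divide_distrib)
  qed
  have \<eta>_lim: "\<eta> \<longlonglongrightarrow> 0"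
  proof -
    have "(\<lambda>n. ((ln (real n) + (\<sigma> n)\<^sup>2) / R n) powr (1/4)) \<longlonglongrightarrow> 0 powr (1/4)"
    proof (rule tendsto_powr2[OF ratio tendsto_const])
      show "\<forall>\<^sub>F n in sequentially. 0 \<le> (ln (real n) + (\<sigma> n)\<^sup>2) / R n"
        using eventually_ge_at_top[of 1]
      proof eventually_elim
        case (elim n)
        then show ?case
          unfolding R_def using p[of n] by (intro divide_nonneg_nonneg add_nonneg_nonneg mult_nonneg_nonneg) auto
      qed
    qed simp
    then show ?thesis by (simp add: \<eta>_def[abs_def])
  qed
  have ev_log: "\<forall>\<^sub>F n in sequentially. 2 ^ 20 * ln (real n) \<le> R n"
  proof -
    have "\<forall>\<^sub>F n in sequentially. 2 ^ 20 \<le> R n / ln (real n)"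
      using degree unfolding R_def filterlim_at_top by blast
    then show ?thesis using eventually_ge_at_top[of 2]
    proof eventually_elim
      case (elim n)
      then have "ln (real n) > 0" by simp
      then show ?case using elim(1) by (simp add: le_divide_eq)
    qed
  qed
  have ev_small: "\<forall>\<^sub>F n in sequentially. 300 * (norm_const + 1) * \<eta> n \<le> 1"
  proof -
    have "(\<lambda>n. 300 * (norm_const + 1) * \<eta> n) \<longlonglongrightarrow> 300 * (norm_const + 1) * 0"
      by (intro tendsto_mult tendsto_const \<eta>_lim)
    then have "\<forall>\<^sub>F n in sequentially. 300 * (norm_const + 1) * \<eta> n < 1"
      by (rule order_tendstoD(2)) simp
    then show ?thesis by eventually_elim simp
  qed
  have ev_tail: "\<forall>\<^sub>F n in sequentially. let y = (R n / (\<sigma> n)\<^sup>2) powr (1/4) in 8 * y ^ 5 * exp (- (y\<^sup>2 / 32)) \<le> exp (- y)"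
  proof -
    have tail: "\<forall>\<^sub>F y :: real in at_top. 8 * y ^ 5 * exp (- (y\<^sup>2 / 32)) \<le> exp (- y)"
      by real_asymp
    have "filterlim (\<lambda>n. inverse ((\<sigma> n)\<^sup>2 / R n)) at_top sequentially"
    proof (rule filterlim_inverse_at_top)
      show "(\<lambda>n. (\<sigma> n)\<^sup>2 / R n) \<longlonglongrightarrow> 0"
        using smalloD_tendsto[OF noise] by (simp add: R_def)
      show "\<forall>\<^sub>F n in sequentially. 0 < (\<sigma> n)\<^sup>2 / R n"
        using eventually_ge_at_top[of 1]
      proof eventually_elim
        case (elim n)
        then show ?case
          unfolding R_def using p[of n] \<sigma>[of n] by (intro divide_pos_pos mult_pos_pos zero_less_power) auto
      qed
    qed
    then have Q: "filterlim (\<lambda>n. R n / (\<sigma> n)\<^sup>2) at_top sequentially" by simp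
    have "filterlim (\<lambda>x :: real. x powr (1/4)) at_top at_top" by real_asymp
    from filterlim_compose[OF this Q]
    have "filterlim (\<lambda>n. (R n / (\<sigma> n)\<^sup>2) powr (1/4)) at_top sequentially" .
    from eventually_compose_filterlim[OF tail this] show ?thesis by (simp add: Let_def)
  qed
  have "(\<lambda>n. C * \<eta> n) \<in> o(\<lambda>_. 1)"
  proof (rule smalloI_tendsto)
    show "(\<lambda>n. C * \<eta> n / 1) \<longlonglongrightarrow> 0"
      using tendsto_mult[OF tendsto_const[of C] \<eta>_lim] by simp
  qed simp
  moreover have "(\<lambda>n. C * \<eta> n) \<in> O(\<lambda>n. ((ln (real n) + (\<sigma> n)\<^sup>2) / (real n * p n)) powr (1/4))"
    unfolding \<eta>_def R_def by (rule bigoI[of _ "\<bar>C\<bar>"]) (simp add: abs_mult)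
  moreover have "\<forall>\<^sub>F n in sequentially. \<forall>zs \<in> phase_vecs n.
        \<exists>E \<in> sets (sync_space n (p n)).
          measure (sync_space n (p n)) E
            \<ge> 1 - 1 / real n - exp (- ((real n * p n / (\<sigma> n)\<^sup>2) powr (1/4)))
        \<and> (\<forall>(a, w) \<in> E.
            let A = A_mat n a; Y = Y_mat n zs (\<sigma> n) w in
            \<forall>u. leading_eigenvector (hadamard A Y) u \<longrightarrow>
              (\<forall>t::nat. t \<ge> 1 \<and> real t \<ge> ln (1 / (\<sigma> n)\<^sup>2) \<longrightarrow>
                loss (gpm n A Y u t) zs \<le> (1 + C * \<eta> n) * ((\<sigma> n)\<^sup>2 / (2 * p n))))"
    using eventually_ge_at_top[of 5] ev_log ev_small ev_tail
  proof eventually_elim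
    case (elim n)
    show ?case
    proof
      fix zs assume zs: "zs \<in> phase_vecs n"
      from gpm_nonasymptotic[OF elim(1) _ _ \<sigma> R_def elim(2) \<eta>_def elim(3) refl _ zs] p elim(4)
      show "\<exists>E \<in> sets (sync_space n (p n)).
          measure (sync_space n (p n)) E
            \<ge> 1 - 1 / real n - exp (- ((real n * p n / (\<sigma> n)\<^sup>2) powr (1/4)))
        \<and> (\<forall>(a, w) \<in> E.
            let A = A_mat n a; Y = Y_mat n zs (\<sigma> n) w in
            \<forall>u. leading_eigenvector (hadamard A Y) u \<longrightarrow>
              (\<forall>t::nat. t \<ge> 1 \<and> real t \<ge> ln (1 / (\<sigma> n)\<^sup>2) \<longrightarrow>
                loss (gpm n A Y u t) zs \<le> (1 + C * \<eta> n) * ((\<sigma> n)\<^sup>2 / (2 * p n))))"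
        by (simp add: R_def C_def Let_def)
    qed
  qed
  ultimately show ?thesis by (intro exI[of _ "\<lambda>n. C * \<eta> n"]) blast
qed

end
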